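(* Let $H$ be a $P_7$ or a fork$^+$, and let $G$ be a $(C_4, H, \text{bull})$-free graph. Then: (i) $\chi(G)\leq\lceil\frac{5}{4}\omega(G)\rceil$, and $\chi(G)\leq\lceil\frac{7}{6}\omega(G)\rceil$ if $G$ is further $C_5^2$-free. (ii) $\chi(G)\leq\omega(G)+1$ if $H=P_7$ and $G$ is further $(C_5^2, C_7^4)$-free. (iii) $\chi(G)\leq\lceil\frac{9}{8}\omega(G)\rceil$ if $H=\text{fork}^+$ and $G$ is further $(C_5^2, C_7^4)$-free. Moreover, all the bounds $\lceil\frac{5}{4}\omega(G)\rceil$, $\lceil\frac{7}{6}\omega(G)\rceil$ and $\lceil\frac{9}{8}\omega(G)\rceil$ are reachable, i.e. each is attained with equality by some graph in the corresponding class.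
   Context: All graphs are finite and simple. $C_k$ is the cycle on $k$ vertices and $P_k$ the path on $k$ vertices. A graph is $(H_1,H_2,\dots)$-free if it has no induced subgraph isomorphic to any $H_i$. A bull is a triangle with two disjoint pendant edges (attached at two different vertices of the triangle). A fork$^+$ is obtained from $K_{1,3}$ by subdividing one edge twice. For a graph $F$ and a positive integer $k$, $F^k$ denotes the $k$-clique blowup of $F$: each vertex $v$ of $F$ is replaced by a clique $A_v$ of size $k$, with all edges between $A_u$ and $A_v$ if $uv\in E(F)$, and no edges between $A_u$ and $A_v$ if $u\ne v$ and $uv\notin E(F)$. $\chi(G)$ and $\omega(G)$ are the chromatic number and clique number. *)

theory Defs
  imports Complex_Main
begin

record 'a ugraph =
  verts :: "'a set"
  edges :: "'a set set"

definition simple_graph :: "'a ugraph \<Rightarrow> bool" where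
  "simple_graph G \<longleftrightarrow> finite (verts G) \<and> (\<forall>e\<in>edges G. e \<subseteq> verts G \<and> card e = 2)"

abbreviation adjacent :: "'a ugraph \<Rightarrow> 'a \<Rightarrow> 'a \<Rightarrow> bool" where
  "adjacent G u v \<equiv> {u, v} \<in> edges G"

definition induced_subgraph :: "'a ugraph \<Rightarrow> 'a set \<Rightarrow> 'a ugraph" where
  "induced_subgraph G W = \<lparr>verts = W, edges = {e \<in> edges G. e \<subseteq> W}\<rparr>"

definition isomorphic :: "'a ugraph \<Rightarrow> 'b ugraph \<Rightarrow> bool" where
  "isomorphic G H \<longleftrightarrow> (\<exists>f. bij_betw f (verts G) (verts H) \<and>
     (\<forall>u\<in>verts G. \<forall>v\<in>verts G. adjacent G u v \<longleftrightarrow> adjacent H (f u) (f v)))"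

definition free_of :: "'b ugraph set \<Rightarrow> 'a ugraph \<Rightarrow> bool" where
  "free_of \<H> G \<longleftrightarrow>
     (\<forall>H\<in>\<H>. \<not> (\<exists>W \<subseteq> verts G. isomorphic (induced_subgraph G W) H))"

definition clique :: "'a ugraph \<Rightarrow> 'a set \<Rightarrow> bool" where
  "clique G K \<longleftrightarrow> K \<subseteq> verts G \<and> (\<forall>u\<in>K. \<forall>v\<in>K. u \<noteq> v \<longrightarrow> adjacent G u v)"

text \<open>The empty set is a clique, so the clique number of the empty graph is 0.\<close>

definition clique_number :: "'a ugraph \<Rightarrow> nat" where
  "clique_number G = Max {card K | K. clique G K}"

definition proper_colouring :: "'a ugraph \<Rightarrow> nat \<Rightarrow> ('a \<Rightarrow> nat) \<Rightarrow> bool" where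
  "proper_colouring G k c \<longleftrightarrow> c ` verts G \<subseteq> {..<k} \<and>
     (\<forall>u\<in>verts G. \<forall>v\<in>verts G. adjacent G u v \<longrightarrow> c u \<noteq> c v)"

definition chromatic_number :: "'a ugraph \<Rightarrow> nat" where
  "chromatic_number G = (LEAST k. \<exists>c. proper_colouring G k c)"

text \<open>Meaningful for \<open>k \<ge> 3\<close> only.\<close>

definition cycle_graph :: "nat \<Rightarrow> nat ugraph" where
  "cycle_graph k = \<lparr>verts = {..<k}, edges = {{i, Suc i mod k} | i. i < k}\<rparr>"

text \<open>The path on \<open>k\<close> vertices (not \<open>k\<close> edges).\<close>

definition path_graph :: "nat \<Rightarrow> nat ugraph" where
  "path_graph k = \<lparr>verts = {..<k}, edges = {{i, Suc i} | i. Suc i < k}\<rparr>"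

text \<open>The triangle 0, 1, 2 with pendant vertices 3 and 4 attached at 0 and 1.\<close>

definition bull :: "nat ugraph" where
  "bull = \<lparr>verts = {..<5}, edges = {{0, 1}, {1, 2}, {0, 2}, {0, 3}, {1, 4}}\<rparr>"

text \<open>The claw with centre 0 and leaves 1, 2, 5 whose edge to 5 is subdivided by 3 and 4.\<close>

definition fork_plus :: "nat ugraph" where
  "fork_plus = \<lparr>verts = {..<6}, edges = {{0, 1}, {0, 2}, {0, 3}, {3, 4}, {4, 5}}\<rparr>"

text \<open>Vertex \<open>v\<close> is replaced by the clique \<open>{v} \<times> {..<k}\<close>.\<close>

definition clique_blowup :: "'a ugraph \<Rightarrow> nat \<Rightarrow> ('a \<times> nat) ugraph" where
  "clique_blowup F k = \<lparr>verts = verts F \<times> {..<k},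
     edges = {{(u, i), (v, j)} | u i v j. u \<in> verts F \<and> v \<in> verts F \<and> i < k \<and> j < k \<and>
                (u = v \<and> i \<noteq> j \<or> adjacent F u v)}\<rparr>"

end

theory Submission
  imports Defs
begin

text \<open>
The upper bounds are proved for all induced subgraphs at once, by induction on the number of
vertices. Two reductions are compatible with every bound \<open>\<beta>(\<omega>)\<close> with \<open>\<beta>\<close> strictly increasing
(\<open>colourable_by_reduction\<close>): a graph with a clique cutset is glued from two smaller graphs, and if
deleting a stable set lowers the clique number, that set can be given a colour of its own. Only graphs
that admit neither reduction are left. They have no universal vertex, as a universal vertex would be
such a stable set.

Such a graph is a clique blowup of a twin-free graph \<open>F\<close>: identify vertices with equal closed
neighbourhoods and weight each vertex of \<open>F\<close> by the size of its class. Since \<open>F\<close> has no clique cutset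
and no universal vertex, every vertex lies on a hole, and excluding \<open>C\<^sub>4\<close> and the bull then forces \<open>F\<close>
to be triangle-free (\<open>twin_free_triangle_free\<close>). So \<open>F\<close> has girth at least five, and the maximal
cliques of the original graph correspond to edges of \<open>F\<close>. Two vertices of weight above \<open>\<omega>/2\<close> are never
adjacent, nor is one of them adjacent to a vertex of weight \<open>\<omega>/2\<close>. Hence, if the vertices of weight
exactly \<open>\<omega>/2\<close> induced a bipartite graph, one of its sides together with all heavier vertices would be
a stable set that meets every maximum clique. Therefore \<open>\<omega> = 2m\<close> is even and \<open>F\<close> has an odd hole
\<open>C\<close> all of whose vertices have weight \<open>m\<close> (\<open>balanced_odd_hole\<close>).

It remains to colour a weighted graph \<open>F\<close> of girth at least five that contains such a hole.

\<^item> If \<open>F\<close> is \<open>fork\<^sup>+\<close>-free and \<open>C\<close> has length \<open>2k + 1 \<ge> 7\<close>, then \<open>F = C\<close>, and a circular colouring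
  uses \<open>2m + \<lceil>m/k\<rceil>\<close> colours.

\<^item> In all other cases \<open>F\<close> maps homomorphically to the Petersen graph (\<open>C5_petersen_hom\<close> and
  \<open>C7_petersen_hom\<close>). The Petersen graph is the Kneser graph of the pairs in a five-element set, so
  splitting the colours into five blocks yields a colouring with \<open>2m + \<lceil>m/2\<rceil> = \<lceil>5\<omega>/4\<rceil>\<close> colours for
  any weights (\<open>multicolouring_if_petersen_hom\<close>).

\<^item> If \<open>C\<^sub>5\<^sup>2\<close> is excluded and \<open>C\<close> has length five, then \<open>m = 1\<close> and the three colours just found are
  \<open>\<omega> + 1\<close>. If \<open>C\<close> has length seven and \<open>F\<close> is \<open>P\<^sub>7\<close>-free, each vertex off \<open>C\<close> has at
  most two neighbours to avoid when the colouring of the blowup of \<open>C\<close> with \<open>2m + \<lceil>m/3\<rceil>\<close> colours is extended (\<open>C7_multicolouring\<close>).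
  Excluding \<open>C\<^sub>7\<^sup>4\<close> too forces \<open>m \<le> 3\<close> on a hole of length seven, and this becomes \<open>\<omega> + 1\<close>.

All three bounds are attained by \<open>C\<^sub>5\<close>, where \<open>\<omega> = 2\<close> and \<open>\<chi> = 3\<close>.
\<close>

section \<open>Clique cutsets and removable stable sets\<close>

text \<open>
Clique cutsets are expressed without paths: \<open>D\<close> is cut off by a clique if its boundary is one and
\<open>D\<close> together with its boundary is not everything. An atom has no such \<open>D\<close>; in particular, taking an
empty boundary, atoms are connected.
\<close>

definition boundary :: "('a \<Rightarrow> 'a \<Rightarrow> bool) \<Rightarrow> 'a set \<Rightarrow> 'a set \<Rightarrow> 'a set" where
  "boundary E V D = {w \<in> V - D. \<exists>d\<in>D. E d w}"

definition atom :: "('a \<Rightarrow> 'a \<Rightarrow> bool) \<Rightarrow> 'a set \<Rightarrow> bool" where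
  "atom E V \<longleftrightarrow> (\<forall>D\<subseteq>V. D \<noteq> {} \<longrightarrow> pairwise E (boundary E V D) \<longrightarrow> D \<union> boundary E V D = V)"

definition colourable :: "('a \<Rightarrow> 'a \<Rightarrow> bool) \<Rightarrow> 'a set \<Rightarrow> nat \<Rightarrow> bool" where
  "colourable E V k \<longleftrightarrow> (\<exists>c. c ` V \<subseteq> {..<k} \<and> (\<forall>u\<in>V. \<forall>v\<in>V. E u v \<longrightarrow> c u \<noteq> c v))"

definition omega :: "('a \<Rightarrow> 'a \<Rightarrow> bool) \<Rightarrow> 'a set \<Rightarrow> nat" where
  "omega E V = Max {card K | K. K \<subseteq> V \<and> pairwise E K}"

text \<open>
A stable set whose removal lowers the clique number is the same as a stable set that meets every
maximum clique.
\<close>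

definition peelable :: "('a \<Rightarrow> 'a \<Rightarrow> bool) \<Rightarrow> 'a set \<Rightarrow> bool" where
  "peelable E V \<longleftrightarrow>
     (\<exists>S\<subseteq>V. pairwise (\<lambda>u v. \<not> E u v) S \<and> omega E (V - S) < omega E V)"

lemma atomD:
  assumes "atom E V" "D \<subseteq> V" "D \<noteq> {}" "pairwise E (boundary E V D)"
  shows "D \<union> boundary E V D = V"
  using assms unfolding atom_def by blast

lemma omega_finite: "finite V \<Longrightarrow> finite {card K | K. K \<subseteq> V \<and> pairwise E K}"
  by simp

lemma card_le_omega:
  "finite V \<Longrightarrow> K \<subseteq> V \<Longrightarrow> pairwise E K \<Longrightarrow> card K \<le> omega E V"
  unfolding omega_def by (rule Max_ge) auto

lemma omega_attained:
  assumes "finite V"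
  obtains K where "K \<subseteq> V" "pairwise E K" "card K = omega E V"
proof -
  have "{} \<subseteq> V \<and> pairwise E {}" by simp
  then have "{card K | K. K \<subseteq> V \<and> pairwise E K} \<noteq> {}" by blast
  then have "omega E V \<in> {card K | K. K \<subseteq> V \<and> pairwise E K}"
    unfolding omega_def by (rule Max_in[OF omega_finite[OF assms]])
  then obtain K where K: "omega E V = card K" "K \<subseteq> V" "pairwise E K"
    unfolding mem_Collect_eq by (elim exE conjE)
  show ?thesis by (rule that[OF K(2,3) K(1)[symmetric]])
qed

lemma omega_mono:
  assumes "finite V" "U \<subseteq> V" shows "omega E U \<le> omega E V"
proof -
  obtain K where K: "K \<subseteq> U" "pairwise E K" "card K = omega E U"
    by (rule omega_attained[OF finite_subset[OF assms(2,1)]])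
  show ?thesis using card_le_omega[OF assms(1) _ K(2)] K(1,3) assms(2) by simp
qed

lemma colourable_mono: "colourable E V k \<Longrightarrow> k \<le> l \<Longrightarrow> colourable E V l"
proof -
  assume "colourable E V k" "k \<le> l"
  then obtain c where c: "c ` V \<subseteq> {..<k}" "\<forall>u\<in>V. \<forall>v\<in>V. E u v \<longrightarrow> c u \<noteq> c v"
    unfolding colourable_def by blast
  have "c ` V \<subseteq> {..<l}" using c(1) \<open>k \<le> l\<close> by auto
  then show "colourable E V l" unfolding colourable_def using c(2) by (intro exI[of _ c]) simp
qed

text \<open>
Both colourings are injective on the common clique, so the colours of the second can be renamed
such that the two agree there.
\<close>

lemma permutation_matching_injections:
  fixes f g :: "'a \<Rightarrow> nat"
  assumes "finite K" "inj_on f K" "inj_on g K" "f ` K \<subseteq> {..<k}" "g ` K \<subseteq> {..<k}"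
  obtains h where "bij_betw h {..<k} {..<k}" "\<And>x. x \<in> K \<Longrightarrow> h (g x) = f x"
proof -
  have "card ({..<k} - g ` K) = card ({..<k} - f ` K)"
    using assms by (simp add: card_Diff_subset card_image)
  then obtain h0 where h0: "bij_betw h0 ({..<k} - g ` K) ({..<k} - f ` K)"
    using finite_same_card_bij by (metis finite_Diff finite_lessThan)
  define h1 where "h1 = (\<lambda>y. f (the_inv_into K g y))"
  have h1: "bij_betw h1 (g ` K) (f ` K)"
    unfolding h1_def using bij_betw_trans[OF bij_betw_the_inv_into[of g K "g ` K"], of f "f ` K"]
      assms by (simp add: bij_betw_def comp_def)
  define h where "h = (\<lambda>y. if y \<in> g ` K then h1 y else h0 y)"
  have "bij_betw h (g ` K \<union> ({..<k} - g ` K)) (f ` K \<union> ({..<k} - f ` K))"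
  proof (rule bij_betw_combine)
    show "bij_betw h (g ` K) (f ` K)"
      using h1 by (subst bij_betw_cong[of _ _ h1]) (auto simp: h_def)
    show "bij_betw h ({..<k} - g ` K) ({..<k} - f ` K)"
      using h0 by (subst bij_betw_cong[of _ _ h0]) (auto simp: h_def)
  qed auto
  moreover have "g ` K \<union> ({..<k} - g ` K) = {..<k}" "f ` K \<union> ({..<k} - f ` K) = {..<k}"
    using assms by auto
  moreover have "h (g x) = f x" if "x \<in> K" for x
    using that assms(3) by (simp add: h_def h1_def the_inv_into_f_f)
  ultimately show ?thesis using that by simp
qed

lemma colourable_glue:
  assumes "finite V" "symp E" "D \<subseteq> V" "pairwise E (boundary E V D)"
    and "colourable E (D \<union> boundary E V D) k" "colourable E (V - D) k"
  shows "colourable E V k"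
proof -
  define K where "K = boundary E V D"
  have K: "K \<subseteq> V - D" by (auto simp: K_def boundary_def)
  obtain f where f: "f ` (D \<union> K) \<subseteq> {..<k}" "\<forall>u\<in>D \<union> K. \<forall>v\<in>D \<union> K. E u v \<longrightarrow> f u \<noteq> f v"
    using assms(5) unfolding colourable_def K_def by blast
  obtain g where g: "g ` (V - D) \<subseteq> {..<k}" "\<forall>u\<in>V - D. \<forall>v\<in>V - D. E u v \<longrightarrow> g u \<noteq> g v"
    using assms(6) unfolding colourable_def K_def by blast
  have "inj_on f K" "inj_on g K"
    using f(2) g(2) K assms(4) unfolding inj_on_def pairwise_def K_def[symmetric] by blast+
  then obtain h where h: "bij_betw h {..<k} {..<k}" "\<And>x. x \<in> K \<Longrightarrow> h (g x) = f x"
    using permutation_matching_injections[of K f g k] f(1) g(1) K finite_subset[OF _ assms(1), of K]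
    by blast
  define c where "c = (\<lambda>x. if x \<in> D then f x else h (g x))"
  have cK: "c x = f x" if "x \<in> D \<union> K" for x using that h(2) K by (auto simp: c_def)
  have cg: "c x = h (g x)" if "x \<in> V - D" for x using that by (auto simp: c_def)
  have hin: "h x \<in> {..<k}" if "x < k" for x using h(1) that bij_betwE by blast
  have "c ` V \<subseteq> {..<k}"
    using f(1) g(1) hin by (auto simp: c_def)
  moreover have "c u \<noteq> c v" if uv: "u \<in> V" "v \<in> V" "E u v" for u v
  proof (cases "u \<in> D \<or> v \<in> D")
    case True
    then have "u \<in> D \<union> K" "v \<in> D \<union> K"
      using uv \<open>symp E\<close> by (auto simp: K_def boundary_def dest: sympD)
    then show ?thesis using cK f(2) uv(3) by simp
  next
    case False
    then have "g u \<noteq> g v" "g u < k" "g v < k" using g uv by auto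
    then have "h (g u) \<noteq> h (g v)" using h(1) by (auto simp: bij_betw_def inj_on_def)
    then show ?thesis using cg False uv by simp
  qed
  ultimately show ?thesis unfolding colourable_def by blast
qed

text \<open>
Strict monotonicity of \<open>\<beta>\<close> pays for the extra colour of a stable set that lowers the clique number.
\<close>

theorem colourable_by_reduction:
  assumes "finite V" "symp E" "irreflp E" "strict_mono \<beta>"
    and irreducible: "\<And>W. W \<subseteq> V \<Longrightarrow> W \<noteq> {} \<Longrightarrow> atom E W \<Longrightarrow> \<not> peelable E W \<Longrightarrow>
          colourable E W (\<beta> (omega E W))"
  shows "colourable E V (\<beta> (omega E V))"
  using assms(1) irreducible
proof (induction "card V" arbitrary: V rule: less_induct)
  case less
  have step: "colourable E U (\<beta> (omega E U))" if "U \<subset> V" for U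
  proof (rule less.hyps)
    show "card U < card V" using that less.prems(1) by (rule psubset_card_mono[rotated])
    show "finite U" using that less.prems(1) by (meson finite_subset psubset_imp_subset)
    show "colourable E W (\<beta> (omega E W))"
      if "W \<subseteq> U" "W \<noteq> {}" "atom E W" "\<not> peelable E W" for W
      using less.prems(2)[OF _ that(2-4)] that(1) \<open>U \<subset> V\<close> by simp
  qed
  have step_le: "colourable E U (\<beta> (omega E V))" if "U \<subset> V" for U
  proof (rule colourable_mono[OF step[OF that]])
    show "\<beta> (omega E U) \<le> \<beta> (omega E V)"
      using omega_mono[of V U E] that less.prems(1) \<open>strict_mono \<beta>\<close>
      by (simp add: strict_mono_less_eq psubset_imp_subset)
  qed
  consider "V = {}" | "V \<noteq> {}" "\<not> atom E V" | "V \<noteq> {}" "peelable E V"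
    | "V \<noteq> {}" "atom E V" "\<not> peelable E V" by blast
  then show ?case
  proof cases
    case 1 then show ?thesis by (simp add: colourable_def)
  next
    case 2
    then obtain D where D: "D \<subseteq> V" "D \<noteq> {}" "pairwise E (boundary E V D)" "D \<union> boundary E V D \<noteq> V"
      unfolding atom_def by blast
    have "D \<union> boundary E V D \<subset> V" "V - D \<subset> V" using D by (auto simp: boundary_def)
    with D show ?thesis
      using colourable_glue[OF less.prems(1) \<open>symp E\<close> D(1,3)] step_le by blast
  next
    case 3
    then obtain S where S: "S \<subseteq> V" "pairwise (\<lambda>u v. \<not> E u v) S" "omega E (V - S) < omega E V"
      unfolding peelable_def by blast
    let ?k = "\<beta> (omega E (V - S))"
    have "S \<noteq> {}" using S(3) by auto
    then have "colourable E (V - S) ?k" using step[of "V - S"] S(1) by blast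
    then obtain c where c: "c ` (V - S) \<subseteq> {..<?k}"
      "\<forall>u\<in>V - S. \<forall>v\<in>V - S. E u v \<longrightarrow> c u \<noteq> c v"
      unfolding colourable_def by blast
    have "c u < ?k" if "u \<in> V" "u \<notin> S" for u using c(1) that by auto
    then have *: "c u \<noteq> ?k" if "u \<in> V" "u \<notin> S" for u using that by (metis less_irrefl)
    have lt: "?k < \<beta> (omega E V)" using S(3) \<open>strict_mono \<beta>\<close> by (simp add: strict_mono_less)
    define c' where "c' = (\<lambda>x. if x \<in> S then ?k else c x)"
    have "c' ` V \<subseteq> {..<\<beta> (omega E V)}" using c(1) lt by (force simp: c'_def)
    moreover have "c' u \<noteq> c' v" if "u \<in> V" "v \<in> V" "E u v" for u v
    proof -
      have "u \<noteq> v" using that(3) \<open>irreflp E\<close> by (auto dest: irreflpD)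
      then have "\<not> (u \<in> S \<and> v \<in> S)" using that(3) S(2) by (auto simp: pairwise_def)
      then show ?thesis using that c(2) *[of u] *[of v] by (auto simp: c'_def)
    qed
    ultimately show ?thesis unfolding colourable_def by blast
  next
    case 4 then show ?thesis using less.prems(2) by blast
  qed
qed

section \<open>Reachability and holes\<close>

definition reach :: "('a \<Rightarrow> 'a \<Rightarrow> bool) \<Rightarrow> 'a set \<Rightarrow> 'a \<Rightarrow> 'a set" where
  "reach E M x = {y. (x, y) \<in> {(u, v). E u v \<and> u \<in> M \<and> v \<in> M}\<^sup>*}"

lemma reach_refl [simp]: "x \<in> reach E M x" by (simp add: reach_def)

lemma reach_step:
  assumes "y \<in> reach E M x" "E y z" "y \<in> M" "z \<in> M" shows "z \<in> reach E M x"
  using assms unfolding reach_def by (auto intro: rtrancl_into_rtrancl)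

lemma reach_induct [consumes 1, case_names base step]:
  assumes "y \<in> reach E M x" "P x"
    and "\<And>u v. u \<in> reach E M x \<Longrightarrow> E u v \<Longrightarrow> u \<in> M \<Longrightarrow> v \<in> M \<Longrightarrow> P u \<Longrightarrow> P v"
  shows "P y"
proof -
  have "(x, y) \<in> {(u, v). E u v \<and> u \<in> M \<and> v \<in> M}\<^sup>*" using assms(1) by (simp add: reach_def)
  then show ?thesis
    by (induction rule: rtrancl_induct) (use assms(2,3) in \<open>auto simp: reach_def\<close>)
qed

lemma reach_subset:
  assumes "x \<in> M" "y \<in> reach E M x" shows "y \<in> M"
  using assms(2) by (induction rule: reach_induct) (use assms(1) in auto)

text \<open>
A shortest walk is an induced path, since an equality or an edge between two of its vertices that
are not consecutive would be a shortcut.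
\<close>

lemma shortest_walk:
  assumes "(a, b) \<in> R\<^sup>*"
  shows "\<exists>f n. f 0 = a \<and> f n = b \<and> (\<forall>i<n. (f i, f (Suc i)) \<in> R) \<and>
    (\<forall>i j. i < j \<longrightarrow> j \<le> n \<longrightarrow> f i \<noteq> f j) \<and>
    (\<forall>i j. Suc i < j \<longrightarrow> j \<le> n \<longrightarrow> (f i, f j) \<notin> R)"
proof -
  define n where "n = (LEAST n. (a, b) \<in> R ^^ n)"
  have "\<exists>n. (a, b) \<in> R ^^ n" using assms rtrancl_power[of "(a, b)" R] by simp
  then have n: "(a, b) \<in> R ^^ n" unfolding n_def by (rule LeastI_ex)
  have n_le: "n \<le> m" if "(a, b) \<in> R ^^ m" for m unfolding n_def using that by (rule Least_le)
  obtain f where f: "f 0 = a" "f n = b" "\<And>i. i < n \<Longrightarrow> (f i, f (Suc i)) \<in> R"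
    using n unfolding relpow_fun_conv by auto
  have seg: "(f i, f j) \<in> R ^^ (j - i)" if "i \<le> j" "j \<le> n" for i j
    unfolding relpow_fun_conv
    by (rule exI[of _ "\<lambda>k. f (i + k)"]) (use f(3) that in auto)
  have jump: "j \<le> i + k" if "i < j" "j \<le> n" "(f i, f j) \<in> R ^^ k" for i j k
  proof -
    have "(a, f i) \<in> R ^^ i" "(f j, b) \<in> R ^^ (n - j)"
      using seg[of 0 i] seg[of j n] f(1,2) that by auto
    then have "(a, b) \<in> R ^^ (i + k + (n - j))"
      using that(3) unfolding relpow_add by blast
    then show ?thesis using n_le that by fastforce
  qed
  have "f i \<noteq> f j" if "i < j" "j \<le> n" for i j using jump[OF that, of 0] that by auto
  moreover have "(f i, f j) \<notin> R" if "Suc i < j" "j \<le> n" for i j using jump[of i j 1] that by auto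
  ultimately show ?thesis using f by blast
qed

text \<open>
Holes are indexed periodically by the integers, so that rotating a hole is a shift of the index
and no index needs reduction. The length is at least five because four-cycles are excluded throughout.
\<close>

definition hole :: "('a \<Rightarrow> 'a \<Rightarrow> bool) \<Rightarrow> int \<Rightarrow> (int \<Rightarrow> 'a) \<Rightarrow> bool" where
  "hole E n c \<longleftrightarrow> n \<ge> 5 \<and> (\<forall>i j. (c i = c j \<longleftrightarrow> n dvd i - j) \<and>
     (E (c i) (c j) \<longleftrightarrow> n dvd i - j - 1 \<or> n dvd i - j + 1))"

lemma dvd_small: "(n::int) dvd k \<longleftrightarrow> k = 0" if "\<bar>k\<bar> < n"
  using that zdvd_imp_le[of n "\<bar>k\<bar>"] by fastforce

lemma hole_if_cyclic:
  fixes f :: "nat \<Rightarrow> 'a"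
  assumes "n \<ge> 5" "\<And>u v. E u v \<Longrightarrow> E v u" "\<And>u. \<not> E u u"
    and inj: "\<And>i j. i < j \<Longrightarrow> j < n \<Longrightarrow> f i \<noteq> f j"
    and adj: "\<And>i j. i < j \<Longrightarrow> j < n \<Longrightarrow> E (f i) (f j) \<longleftrightarrow> j = Suc i \<or> i = 0 \<and> Suc j = n"
  shows "hole E (int n) (\<lambda>i. f (nat (i mod int n)))"
proof -
  have key: "(f (nat (i mod int n)) = f (nat (j mod int n)) \<longleftrightarrow> int n dvd i - j) \<and>
     (E (f (nat (i mod int n))) (f (nat (j mod int n))) \<longleftrightarrow>
       int n dvd i - j - 1 \<or> int n dvd i - j + 1)" for i j :: int
  proof -
    define a b where "a = nat (i mod int n)" and "b = nat (j mod int n)"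
    have a: "int a = i mod int n" and b: "int b = j mod int n"
      using assms(1) by (auto simp: a_def b_def)
    have ab: "a < n" "b < n" using a b assms(1) by (metis of_nat_0_less_iff of_nat_less_iff
        pos_mod_bound less_le_trans zero_less_numeral)+
    have eq: "int n dvd i - j + k \<longleftrightarrow> int n dvd int a - int b + k" for k
    proof -
      have "i - j + k = int a - int b + k + int n * (i div int n - j div int n)"
        unfolding a b by (simp add: minus_div_mult_eq_mod[symmetric] algebra_simps)
      then show ?thesis by (metis dvd_add_left_iff dvd_triv_left)
    qed
    have eq0: "int n dvd i - j \<longleftrightarrow> int a = int b"
      using eq[of 0] dvd_small[of "int a - int b" "int n"] ab by auto
    have eq1: "int n dvd i - j - 1 \<longleftrightarrow> a = Suc b \<or> a = 0 \<and> Suc b = n"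
    proof -
      have "int n dvd i - j - 1 \<longleftrightarrow> int n dvd int a - int b - 1" using eq[of "-1"] by simp
      also have "\<dots> \<longleftrightarrow> a = Suc b \<or> a = 0 \<and> Suc b = n"
      proof (cases "a = 0 \<and> Suc b = n")
        case True then have "int a - int b - 1 = - int n" by linarith
        then show ?thesis using True by (metis dvd_minus_iff dvd_refl)
      next
        case False
        then have "\<bar>int a - int b - 1\<bar> < int n" using ab by linarith
        then show ?thesis using False dvd_small[of "int a - int b - 1" "int n"] by fastforce
      qed
      finally show ?thesis .
    qed
    have eq2: "int n dvd i - j + 1 \<longleftrightarrow> b = Suc a \<or> b = 0 \<and> Suc a = n"
    proof -
      have "int n dvd i - j + 1 \<longleftrightarrow> int n dvd int a - int b + 1" using eq[of 1] by simp
      also have "\<dots> \<longleftrightarrow> b = Suc a \<or> b = 0 \<and> Suc a = n"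
      proof (cases "b = 0 \<and> Suc a = n")
        case True then have "int a - int b + 1 = int n" by linarith
        then show ?thesis using True by (metis dvd_refl)
      next
        case False
        then have "\<bar>int a - int b + 1\<bar> < int n" using ab by linarith
        then show ?thesis using False dvd_small[of "int a - int b + 1" "int n"] by fastforce
      qed
      finally show ?thesis .
    qed
    have "f a = f b \<longleftrightarrow> a = b" using inj[of a b] inj[of b a] ab by (metis nat_neq_iff)
    moreover have "E (f a) (f b) \<longleftrightarrow>
        (a = Suc b \<or> a = 0 \<and> Suc b = n) \<or> (b = Suc a \<or> b = 0 \<and> Suc a = n)"
    proof (cases a b rule: linorder_cases)
      case less then show ?thesis using adj[OF less] ab assms(1) by auto
    next
      case equal then show ?thesis using assms(1,3) by auto
    next
      case greater
      have "E (f a) (f b) = E (f b) (f a)" using assms(2) by blast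
      then show ?thesis using adj[OF greater] ab assms(1) greater by auto
    qed
    ultimately show ?thesis unfolding eq0 eq1 eq2 a_def[symmetric] b_def[symmetric] by simp
  qed
  then show ?thesis unfolding hole_def using assms(1) by simp
qed

lemma hole_shift: "hole E n c \<Longrightarrow> hole E n (\<lambda>i. c (i + k))"
  unfolding hole_def by simp

context
  fixes E :: "'a \<Rightarrow> 'a \<Rightarrow> bool" and n :: int and c :: "int \<Rightarrow> 'a"
  assumes hole: "hole E n c"
begin

lemma hole_eq: "c i = c j \<longleftrightarrow> n dvd i - j" and hole_len: "n \<ge> 5"
  and hole_adj: "E (c i) (c j) \<longleftrightarrow> n dvd i - j - 1 \<or> n dvd i - j + 1"
  using hole unfolding hole_def by blast+

text \<open>
Among indices within a window of the hole, the divisibility conditions become plain equations.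
\<close>

lemma hole_near:
  assumes "\<bar>i - j\<bar> < n - 1"
  shows "c i = c j \<longleftrightarrow> i = j" "E (c i) (c j) \<longleftrightarrow> i = j + 1 \<or> j = i + 1"
  unfolding hole_eq hole_adj
  using assms dvd_small[of "i - j" n] dvd_small[of "i - j - 1" n] dvd_small[of "i - j + 1" n]
  by auto

end

section \<open>Twin-free graphs without \<open>C\<^sub>4\<close> and bulls are triangle-free\<close>

locale c4_bull_free =
  fixes V :: "'a set" and E :: "'a \<Rightarrow> 'a \<Rightarrow> bool"
  assumes finite_V: "finite V"
    and sym: "E u v \<Longrightarrow> E v u"
    and irrefl: "\<not> E u u"
    and in_V: "E u v \<Longrightarrow> u \<in> V"
    and no_C4: "E a b \<Longrightarrow> E b c \<Longrightarrow> E c d \<Longrightarrow> E d a \<Longrightarrow> a \<noteq> c \<Longrightarrow> b \<noteq> d \<Longrightarrow> E a c \<or> E b d"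
    and no_bull: "E x y \<Longrightarrow> E y z \<Longrightarrow> E x z \<Longrightarrow> E x p \<Longrightarrow> E y q \<Longrightarrow>
      \<not> E p y \<Longrightarrow> \<not> E p z \<Longrightarrow> \<not> E q x \<Longrightarrow> \<not> E q z \<Longrightarrow> E p q"
begin

text \<open>
Let \<open>K\<close> be the component of \<open>x\<close> after deletion of \<open>v\<close> and its neighbours. The boundary of \<open>K\<close> consists of
neighbours of \<open>v\<close>, and it is not a clique in an atom. Two non-adjacent vertices of the boundary are
joined by a shortest path through \<open>K\<close>, and this path closes up at \<open>v\<close>.
\<close>

lemma hole_through_vertex:
  assumes "atom E V" "v \<in> V" "x \<in> V" "x \<noteq> v" "\<not> E v x"
  obtains n c where "hole E n c" "c 0 = v"
proof -
  define B where "B = {y \<in> V. y \<noteq> v \<and> \<not> E v y}"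
  define K where "K = reach E B x"
  have xB: "x \<in> B" using assms by (simp add: B_def)
  have KB: "K \<subseteq> B" unfolding K_def using reach_subset[OF xB] by blast
  have bd: "E v w" if w: "w \<in> boundary E V K" for w
  proof -
    obtain d where d: "d \<in> K" "E d w" "w \<in> V" "w \<notin> K" using w by (auto simp: boundary_def)
    then have "w \<notin> B" using reach_step[of d E B x w] KB by (auto simp: K_def)
    moreover have "w \<noteq> v" using d KB sym by (auto simp: B_def)
    ultimately show ?thesis using d(3) by (auto simp: B_def)
  qed
  have "v \<notin> K \<union> boundary E V K" using bd irrefl KB by (auto simp: B_def)
  moreover have "K \<subseteq> V" "x \<in> K" using KB by (auto simp: K_def B_def)
  ultimately have "\<not> pairwise E (boundary E V K)"
    using atomD[OF assms(1), of K] assms(2) by blast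
  then obtain a b where ab: "a \<in> boundary E V K" "b \<in> boundary E V K" "a \<noteq> b" "\<not> E a b"
    unfolding pairwise_def by blast
  obtain da db where d: "da \<in> K" "E da a" "a \<notin> K" "db \<in> K" "E db b" "b \<notin> K"
    using ab(1,2) by (auto simp: boundary_def)
  define A where "A = K \<union> {a, b}"
  define R where "R = {(u, v). E u v \<and> u \<in> A \<and> v \<in> A}"
  have symR: "sym R" using sym by (auto simp: R_def sym_def)
  have toK: "(x, k) \<in> R\<^sup>*" if "k \<in> K" for k
    using that unfolding K_def
  proof (induction rule: reach_induct)
    case (step u w)
    then have "u \<in> K" "w \<in> K" using reach_step[of u E B x w] by (auto simp: K_def)
    then show ?case using step by (auto simp: R_def A_def intro: rtrancl_into_rtrancl)
  qed simp
  have "(x, a) \<in> R\<^sup>*" "(x, b) \<in> R\<^sup>*"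
    using toK[OF d(1)] toK[OF d(4)] d by (auto simp: R_def A_def intro: rtrancl_into_rtrancl)
  moreover have "(a, x) \<in> R\<^sup>*" using calculation(1) symR by (meson sym_rtrancl symD)
  ultimately have "(a, b) \<in> R\<^sup>*" by simp
  then obtain f n where f: "f 0 = a" "f n = b" "\<And>i. i < n \<Longrightarrow> (f i, f (Suc i)) \<in> R"
    "\<And>i j. i < j \<Longrightarrow> j \<le> n \<Longrightarrow> f i \<noteq> f j"
    "\<And>i j. Suc i < j \<Longrightarrow> j \<le> n \<Longrightarrow> (f i, f j) \<notin> R"
    using shortest_walk[of a b R] by blast
  have fA: "f i \<in> A" if "i \<le> n" for i
    using f(3)[of i] f(2) that by (cases "i = n") (auto simp: R_def A_def)
  have inner: "f i \<in> K" if "0 < i" "i < n" for i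
    using f(4)[of 0 i] f(4)[of i n] f(1,2) fA[of i] that by (auto simp: A_def)
  have Kv: "\<not> E v k" "k \<noteq> v" if "k \<in> K" for k using that KB by (auto simp: B_def)
  have va: "E v a" "E v b" using bd ab by auto
  have "n \<noteq> 0" using f(1,2) ab(3) by metis
  moreover have "n \<noteq> 1" using f(1,2) f(3)[of 0] ab(4) by (auto simp: R_def)
  moreover have "n \<noteq> 2"
  proof
    assume n: "n = 2"
    have "E a (f 1)" "E (f 1) b" using f(1,2) f(3)[of 0] f(3)[of 1] n
      by (auto simp: R_def numeral_2_eq_2)
    moreover have "f 1 \<in> K" using inner[of 1] n by simp
    ultimately show False using no_C4[of v a "f 1" b] va sym Kv ab(3,4) by metis
  qed
  ultimately have n3: "n \<ge> 3" by simp
  define g where "g = (\<lambda>i. if i = 0 then v else f (i - 1))"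
  have vf: "f i \<noteq> v" if "i \<le> n" for i
    using that va fA[of i] Kv irrefl by (auto simp: A_def)
  have adjv: "E v (f i) \<longleftrightarrow> i = 0 \<or> i = n" if "i \<le> n" for i
    using va f(1,2) inner[of i] Kv that by (cases "i = 0 \<or> i = n") auto
  have adjf: "E (f i) (f j) \<longleftrightarrow> j = Suc i" if "i < j" "j \<le> n" for i j
    using f(3)[of i] f(5)[of i j] fA[of i] fA[of j] that
    by (cases "j = Suc i") (auto simp: R_def)
  have "hole E (int (n + 2)) (\<lambda>i. g (nat (i mod int (n + 2))))"
  proof (rule hole_if_cyclic)
    show "g i \<noteq> g j" if "i < j" "j < n + 2" for i j
      using that vf[of "j - 1"] f(4)[of "i - 1" "j - 1"]
      by (cases i; cases j) (auto simp: g_def)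
    show "E (g i) (g j) \<longleftrightarrow> j = Suc i \<or> i = 0 \<and> Suc j = n + 2" if "i < j" "j < n + 2" for i j
    proof (cases "i = 0")
      case True then show ?thesis using that adjv[of "j - 1"] by (cases j) (auto simp: g_def)
    next
      case False then show ?thesis using that adjf[of "i - 1" "j - 1"]
        by (cases i; cases j) (auto simp: g_def)
    qed
  qed (use n3 sym irrefl in auto)
  then show ?thesis by (rule that) (simp add: g_def)
qed

text \<open>
Otherwise \<open>a\<close>, \<open>x\<close>, \<open>x'\<close> with the pendants \<open>u\<close> and \<open>y\<close> is a bull, or \<open>a\<close>, \<open>u\<close>, \<open>y\<close>, \<open>x\<close> is a four-cycle.
So an outside neighbour \<open>y\<close> of one vertex of \<open>N(a)\<close> is adjacent to a whole component of \<open>N(a)\<close>, provided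
that some vertex of \<open>N(a)\<close> lies outside this component.
\<close>

lemma spread_along_edge:
  assumes "E a x" "E a x'" "E a u" "E x x'" "\<not> E u x" "\<not> E u x'"
    and "\<not> E a y" "y \<noteq> a" "E y x"
  shows "E y x'"
proof (rule ccontr)
  assume n: "\<not> E y x'"
  have "E u y"
    using no_bull[of a x x' u y] assms n sym by blast
  then show False using no_C4[of a u y x] assms sym by metis
qed

text \<open>
Let \<open>x\<close> and \<open>x'\<close> be interchangeable in the middle of a path \<open>r q _ q' r'\<close>. A neighbour \<open>z\<close> of
\<open>x\<close> alone would have to be adjacent to \<open>q\<close>, because otherwise there is a bull with pendants \<open>r\<close> and \<open>z\<close>
or a four-cycle \<open>z r q x\<close>, and likewise to \<open>q'\<close>. Then \<open>z q x' q'\<close> is a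
four-cycle.
\<close>

lemma clone_half:
  assumes "E x x'" "E x q" "E x' q" "E x q'" "E x' q'" "\<not> E q q'" "q \<noteq> q'"
    and "E q r" "\<not> E x r" "\<not> E x' r" "E q' r'" "\<not> E x r'" "\<not> E x' r'"
    and "E x z" "z \<noteq> x'"
  shows "E x' z"
proof (rule ccontr)
  assume n: "\<not> E x' z"
  have *: "E z s" if "E x s" "E x' s" "E s t" "\<not> E x t" "\<not> E x' t" for s t
  proof (rule ccontr)
    assume zs: "\<not> E z s"
    have "E t z" using no_bull[of s x x' t z] that assms(1,14) n zs sym by blast
    then show False using no_C4[of z t s x] that zs assms(1,14) n sym by metis
  qed
  have "E z q" "E z q'" using *[of q r] *[of q' r'] assms by blast+
  then show False using no_C4[of z q x' q'] assms n sym by metis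
qed

definition twins :: "'a \<Rightarrow> 'a \<Rightarrow> bool" where
  "twins x y \<longleftrightarrow> E x y \<and> (\<forall>z. z \<noteq> x \<longrightarrow> z \<noteq> y \<longrightarrow> (E x z \<longleftrightarrow> E y z))"

text \<open>
Adjacency to four consecutive vertices propagates backwards around the hole: a missing next
vertex would give a bull, or a four-cycle if the hole has length five.
\<close>

lemma four_consecutive_complete:
  assumes h: "hole E n c" and p: "p \<notin> range c"
    and "E p (c i)" "E p (c (i + 1))" "E p (c (i + 2))" "E p (c (i + 3))"
  shows "E p (c j)"
proof -
  have n5: "n \<ge> 5" by (rule hole_len[OF h])
  have step: "E p (c (i - 1))"
    if "E p (c i)" "E p (c (i + 1))" "E p (c (i + 2))" "E p (c (i + 3))" for i
  proof (cases "n = 5")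
    case True
    then have eq: "c (i + 4) = c (i - 1)" by (simp add: hole_eq[OF h])
    have "E (c (i + 3)) (c (i + 4))" using hole_near[OF h, of "i + 3" "i + 4"] n5 by simp
    moreover have "E (c (i - 1)) (c i)" using hole_near[OF h, of "i - 1" i] n5 by simp
    moreover have "\<not> E (c (i + 3)) (c i)" "c (i + 3) \<noteq> c i"
      using hole_near[OF h, of "i + 3" i] n5 by simp_all
    ultimately show ?thesis
      using no_C4[of p "c (i + 3)" "c (i - 1)" "c i"] that sym p eq by (metis rangeI)
  next
    case False
    have "E (c i) (c (i + 1))" "E (c i) (c (i - 1))" "\<not> E (c (i - 1)) (c (i + 1))"
      "\<not> E (c (i + 3)) (c i)" "\<not> E (c (i + 3)) (c (i + 1))" "\<not> E (c (i - 1)) (c (i + 3))"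
      using hole_near[OF h, of i "i + 1"] hole_near[OF h, of i "i - 1"]
        hole_near[OF h, of "i - 1" "i + 1"] hole_near[OF h, of "i + 3" i]
        hole_near[OF h, of "i + 3" "i + 1"] hole_near[OF h, of "i - 1" "i + 3"] n5 False by auto
    then show ?thesis
      using no_bull[of "c i" p "c (i + 1)" "c (i - 1)" "c (i + 3)"] that sym by metis
  qed
  have all: "E p (c (i - int k)) \<and> E p (c (i - int k + 1)) \<and> E p (c (i - int k + 2)) \<and>
      E p (c (i - int k + 3))" for k
  proof (induction k)
    case 0 then show ?case using assms by simp
  next
    case (Suc k)
    then show ?case using step[of "i - int k"] by (simp add: algebra_simps)
  qed
  \<comment> \<open>any index can be moved below \<open>i\<close> by full turns around the hole\<close>
  have le: "j - n * \<bar>j - i\<bar> \<le> i" 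
  proof -
    define d where "d = \<bar>j - i\<bar>"
    have "1 * d \<le> n * d" by (rule mult_right_mono) (use n5 in \<open>auto simp: d_def\<close>)
    moreover have "j - i \<le> d" by (simp add: d_def)
    ultimately show ?thesis unfolding d_def[symmetric] by linarith
  qed
  have "c j = c (j - n * \<bar>j - i\<bar>)" by (simp add: hole_eq[OF h])
  moreover have "j - n * \<bar>j - i\<bar> = i - int (nat (i - (j - n * \<bar>j - i\<bar>)))" using le by simp
  ultimately show ?thesis using all by metis
qed

text \<open>
Adjacency to exactly two consecutive vertices is a bull, exactly three make \<open>p\<close> a twin of the
middle one, and four propagate to the whole hole.
\<close>

lemma complete_or_clone:
  assumes h: "hole E n c" and p: "p \<notin> range c" and "E p (c i)" "E p (c (i + 1))"
  shows "(\<forall>j. E p (c j)) \<or> (\<exists>j. twins p (c j))"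
proof -
  have n5: "n \<ge> 5" by (rule hole_len[OF h])
  have triple: ?thesis if "E p (c (k - 1))" "E p (c k)" "E p (c (k + 1))" for k
  proof (cases "E p (c (k - 2)) \<or> E p (c (k + 2))")
    case True
    then show ?thesis
    proof
      assume *: "E p (c (k - 2))"
      have "E p (c j)" for j
        by (rule four_consecutive_complete[OF h p, of "k - 2"]) (use that * in \<open>auto simp: algebra_simps\<close>)
      then show ?thesis by blast
    next
      assume *: "E p (c (k + 2))"
      have "E p (c j)" for j
        by (rule four_consecutive_complete[OF h p, of "k - 1"]) (use that * in \<open>auto simp: algebra_simps\<close>)
      then show ?thesis by blast
    qed
  next
    case False
    have near: "E (c k) (c (k - 1))" "E (c k) (c (k + 1))" "\<not> E (c (k - 1)) (c (k + 1))"
      "c (k - 1) \<noteq> c (k + 1)" "E (c (k - 1)) (c (k - 2))" "E (c (k + 1)) (c (k + 2))"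
      "\<not> E (c k) (c (k - 2))" "\<not> E (c k) (c (k + 2))"
      using hole_near[OF h, of k "k - 1"] hole_near[OF h, of k "k + 1"]
        hole_near[OF h, of "k - 1" "k + 1"] hole_near[OF h, of "k - 1" "k - 2"]
        hole_near[OF h, of "k + 1" "k + 2"] hole_near[OF h, of k "k - 2"]
        hole_near[OF h, of k "k + 2"] n5 by auto
    have "E (c k) z" if "E p z" "z \<noteq> c k" for z
      by (rule clone_half[of p "c k" "c (k - 1)" "c (k + 1)" "c (k - 2)" "c (k + 2)" z])
        (use that False near \<open>E p (c (k - 1))\<close> \<open>E p (c k)\<close> \<open>E p (c (k + 1))\<close> in auto)
    moreover have "E p z" if "E (c k) z" "z \<noteq> p" for z
      by (rule clone_half[of "c k" p "c (k - 1)" "c (k + 1)" "c (k - 2)" "c (k + 2)" z])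
        (use that False near \<open>E p (c (k - 1))\<close> \<open>E p (c k)\<close> \<open>E p (c (k + 1))\<close> sym in auto)
    ultimately have "twins p (c k)" using that(2) unfolding twins_def by blast
    then show ?thesis by blast
  qed
  have "E (c i) (c (i + 1))" "E (c i) (c (i - 1))" "E (c (i + 1)) (c (i + 2))"
    "\<not> E (c (i - 1)) (c (i + 1))" "\<not> E (c (i + 2)) (c i)" "\<not> E (c (i - 1)) (c (i + 2))"
    using hole_near[OF h, of i "i + 1"] hole_near[OF h, of i "i - 1"]
      hole_near[OF h, of "i + 1" "i + 2"] hole_near[OF h, of "i - 1" "i + 1"]
      hole_near[OF h, of "i + 2" i] hole_near[OF h, of "i - 1" "i + 2"] n5 by auto
  then have "E p (c (i - 1)) \<or> E p (c (i + 2))"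
    using no_bull[of "c i" "c (i + 1)" p "c (i - 1)" "c (i + 2)"] assms(3,4) sym by blast
  then show ?thesis
    using triple[of i] triple[of "i + 1"] assms(3,4) by (auto simp: algebra_simps)
qed

text \<open>
The vertices complete to the hole form a clique \<open>A\<close>. If \<open>a \<in> A\<close> misses a vertex, let \<open>L\<close> be the component
of the hole in \<open>N(a) - A\<close>. By \<open>spread_along_edge\<close> no vertex outside \<open>N(a)\<close>, other than \<open>a\<close>, has a
neighbour in \<open>L\<close>. So the boundary of \<open>L\<close> lies in the clique \<open>A\<close>, against the atom property.
\<close>

lemma complete_to_hole_universal:
  assumes "atom E V" and h: "hole E n c" and a: "\<And>i. E a (c i)"
    and "y \<in> V" "y \<noteq> a"
  shows "E a y"
proof (rule ccontr)
  assume nay: "\<not> E a y"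
  have n5: "n \<ge> 5" by (rule hole_len[OF h])
  define A where "A = {z \<in> V. \<forall>i. E z (c i)}"
  have c02: "\<not> E (c 0) (c 2)" "c 0 \<noteq> c 2" using hole_near[OF h, of 0 2] n5 by auto
  have A: "E u v" if "u \<in> A" "v \<in> A" "u \<noteq> v" for u v
    using no_C4[of u "c 0" v "c 2"] that c02 sym unfolding A_def by blast
  have aA: "a \<in> A" using a in_V by (auto simp: A_def)
  have far: "\<not> E z (c i)" if z: "\<not> E a z" "z \<noteq> a" for z i
  proof
    assume zi: "E z (c i)"
    have fwd: "E z (c (j + 1))" if "E z (c j)" for j
      using spread_along_edge[of a "c j" "c (j + 1)" "c (j + 3)" z] a z that
        hole_near[OF h, of j "j + 1"] hole_near[OF h, of "j + 3" j]
        hole_near[OF h, of "j + 3" "j + 1"] n5 by auto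
    have "E z (c (i + 2))" using fwd[OF fwd[OF zi]] by (simp add: algebra_simps)
    then show False
      using no_C4[of z "c i" a "c (i + 2)"] zi a z sym hole_near[OF h, of i "i + 2"] n5 by auto
  qed
  define M where "M = {z \<in> V. E a z \<and> z \<notin> A}"
  define L where "L = reach E M (c 0)"
  have c0M: "c 0 \<in> M" using a[of 0] irrefl[of "c 0"] in_V sym by (auto simp: M_def A_def)
  have LM: "L \<subseteq> M" unfolding L_def using reach_subset[OF c0M] by blast
  have unseen: "\<not> E z l" if "l \<in> L" "\<not> E a z" "z \<noteq> a" for l z
    using that(1) unfolding L_def
  proof (induction rule: reach_induct)
    case base show ?case using far that by blast
  next
    case (step l' l)
    show ?case
    proof
      assume zl: "E z l"
      have al: "E a l" "E a l'" using step by (auto simp: M_def)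
      have lC: "\<not> E l (c i)" for i
      proof
        assume li: "E l (c i)"
        have "E l (c j)" if "\<not> E (c j) (c i)" for j
          using spread_along_edge[of a l "c i" "c j" z] al li zl far[of z i] that a
            \<open>\<not> E a z\<close> \<open>z \<noteq> a\<close> sym by blast
        moreover from this have "E l (c j)" if "E (c j) (c i)" for j
        proof -
          \<comment> \<open>the other neighbour \<open>c d\<close> of \<open>c j\<close> on the hole closes a four-cycle with \<open>l\<close>\<close>
          define d where "d = 2 * j - i"
          have "n dvd j - i - 1 \<or> n dvd j - i + 1" using that hole_adj[OF h] by blast
          then have "n dvd d - i - 2 \<or> n dvd d - i + 2"
          proof
            assume "n dvd j - i - 1"
            then have "n dvd 2 * (j - i - 1)" by (rule dvd_mult)
            then show ?thesis by (simp add: d_def algebra_simps)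
          next
            assume "n dvd j - i + 1"
            then have "n dvd 2 * (j - i + 1)" by (rule dvd_mult)
            then show ?thesis by (simp add: d_def algebra_simps)
          qed
          then have "c d = c (i + 2) \<or> c d = c (i - 2)"
            by (simp add: hole_eq[OF h] algebra_simps)
          then have nd: "\<not> E (c d) (c i)" "c d \<noteq> c i"
            using hole_near[OF h, of "i + 2" i] hole_near[OF h, of "i - 2" i] n5 by auto
          have "E l (c d)" using calculation nd(1) by blast
          moreover have "E (c j) (c d)"
          proof -
            have "j - d = i - j" by (simp add: d_def)
            then show ?thesis using sym[OF that] unfolding hole_adj[OF h] by (simp only:)
          qed
          moreover have "l \<noteq> c j" using zl far[of z j] \<open>\<not> E a z\<close> \<open>z \<noteq> a\<close> by auto
          moreover have "\<not> E (c i) (c d)" "E (c i) (c j)" using nd(1) that sym by blast+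
          ultimately show ?thesis using no_C4[of l "c i" "c j" "c d"] li nd(2) sym by metis
        qed
        ultimately have "l \<in> A" using al sym in_V unfolding A_def by blast
        then show False using step by (simp add: M_def)
      qed
      obtain j where "\<not> E l' (c j)" using step by (auto simp: M_def A_def)
      then have "E z l'"
        using spread_along_edge[of a l l' "c j" z] al lC[of j] a zl step(2) that sym by blast
      then show False using step by blast
    qed
  qed
  have bdA: "w \<in> A" if w: "w \<in> boundary E V L" for w
  proof (cases "w = a")
    case False
    obtain d where d: "d \<in> L" "E d w" "w \<in> V" "w \<notin> L" using w by (auto simp: boundary_def)
    have "E a w" using unseen[OF d(1), of w] d(2) False sym by blast
    then show ?thesis using d reach_step[of d E M "c 0" w] LM by (auto simp: L_def M_def)
  qed (simp add: aA)
  have "L \<union> boundary E V L = V"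
  proof (rule atomD[OF assms(1)])
    show "L \<subseteq> V" using LM by (auto simp: M_def)
    show "L \<noteq> {}" by (metis L_def empty_iff reach_refl)
    show "pairwise E (boundary E V L)" using bdA A by (simp add: pairwise_def)
  qed
  moreover have "y \<notin> L" "y \<notin> A" using LM nay A aA \<open>y \<noteq> a\<close> by (auto simp: M_def)
  ultimately show False using \<open>y \<in> V\<close> bdA by blast
qed

text \<open>
Take a hole through \<open>v\<close>. Its neighbour \<open>a\<close> of \<open>v\<close> is isolated in \<open>N(v)\<close>, because a common neighbour of
\<open>v\<close> and \<open>a\<close> would be a twin of a hole vertex or complete to the hole. So every other component \<open>D\<close> of
\<open>N(v)\<close> is a homogeneous set by \<open>spread_along_edge\<close>. If \<open>D\<close> is a clique, its vertices are twins; if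
not, the neighbourhood of \<open>D\<close> is a clique since there is no induced four-cycle, and it cuts \<open>D\<close> off from \<open>a\<close>.
\<close>

theorem twin_free_triangle_free:
  assumes "atom E V" and nouniv: "\<And>v. v \<in> V \<Longrightarrow> \<exists>x\<in>V. x \<noteq> v \<and> \<not> E v x"
    and twin_free: "\<And>x y. \<not> twins x y"
    and "E v y" "E v y'" "E y y'"
  shows False
proof -
  have vV: "v \<in> V" using in_V assms(4) by blast
  obtain x where "x \<in> V" "x \<noteq> v" "\<not> E v x" using nouniv[OF vV] by blast
  then obtain n c where h: "hole E n c" and cv: "c 0 = v"
    using hole_through_vertex[OF assms(1) vV] by metis
  have n5: "n \<ge> 5" by (rule hole_len[OF h])
  define a where "a = c 1"
  have va: "E v a" using hole_near[OF h, of 0 1] n5 cv by (simp add: a_def)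
  have isolated: "\<not> E p a" if "E v p" for p
  proof
    assume pa: "E p a"
    show False
    proof (cases "p \<in> range c")
      case True
      then obtain j where j: "p = c j" by blast
      have "n dvd j + 1 \<or> n dvd j - 1" "n dvd j - 2 \<or> n dvd j"
        using sym[OF that] pa hole_adj[OF h, of j 0] hole_adj[OF h, of j 1]
        unfolding j a_def cv[symmetric] by auto
      then have "n dvd (j + 1) - (j - 2) \<or> n dvd (j + 1) - j \<or> n dvd (j - 1) - (j - 2) \<or>
          n dvd (j - 1) - j"
        by (metis dvd_diff)
      then show False using n5 dvd_small[of 3 n] dvd_small[of 1 n] dvd_small[of "-1" n] by auto
    next
      case False
      then have "\<forall>j. E p (c j)"
        using complete_or_clone[OF h False, of 0] sym[OF that] pa twin_free
        by (auto simp: cv a_def)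
      then show False
        using complete_to_hole_universal[OF assms(1) h, of p] nouniv[OF in_V[OF pa]] by metis
    qed
  qed
  define N where "N = {z \<in> V. E v z}"
  define D where "D = reach E N y"
  have yN: "y \<in> N" "y' \<in> N" using assms(4,5) in_V[OF sym[OF assms(4)]] in_V[OF sym[OF assms(5)]]
    by (auto simp: N_def)
  have DN: "D \<subseteq> N" unfolding D_def using reach_subset[OF yN(1)] by blast
  have DV: "D \<subseteq> V" using DN by (auto simp: N_def)
  have yD: "y \<in> D" "y' \<in> D" using reach_step[of y E N y y'] assms(6) yN by (auto simp: D_def)
  have "d \<noteq> a" if "d \<in> D" for d
    using that unfolding D_def
    by (induction rule: reach_induct)
      (use isolated assms(5) sym[OF assms(6)] in \<open>auto simp: N_def\<close>)
  then have aD: "a \<notin> D" by blast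
  have hom: "E w d \<longleftrightarrow> E w y" if "d \<in> D" "\<not> E v w" "w \<noteq> v" for d w
    using that(1) unfolding D_def
  proof (induction rule: reach_induct)
    case (step s t)
    have "E w s \<longleftrightarrow> E w t"
      using spread_along_edge[of v s t a w] spread_along_edge[of v t s a w] step va
        isolated[of s] isolated[of t] that sym unfolding N_def by blast
    then show ?case using step by blast
  qed simp
  have bd: "E w d" if w: "w \<in> boundary E V D" "d \<in> D" for w d
  proof (cases "w = v")
    case False
    obtain e where e: "e \<in> D" "E e w" "w \<in> V" "w \<notin> D" using w by (auto simp: boundary_def)
    have "\<not> E v w" using reach_step[of e E N y w] e DN by (auto simp: D_def N_def)
    then show ?thesis using hom[OF e(1)] hom[OF w(2)] e(2) False sym by blast
  qed (use w DN in \<open>auto simp: N_def\<close>)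
  have "a \<notin> boundary E V D" using bd[of a y] yD isolated[OF assms(4)] sym by blast
  then have "\<not> pairwise E (boundary E V D)"
    using atomD[OF assms(1) DV] aD yD va in_V sym by blast
  then obtain b b' where b: "b \<in> boundary E V D" "b' \<in> boundary E V D" "b \<noteq> b'" "\<not> E b b'"
    unfolding pairwise_def by blast
  have clique: "E d d'" if "d \<in> D" "d' \<in> D" "d \<noteq> d'" for d d'
    using no_C4[of b d b' d'] b bd that sym by blast
  have trans: "E t z" if "E s z" "s \<in> D" "t \<in> D" "z \<noteq> t" for s t z
  proof (cases "z \<in> D")
    case True then show ?thesis using clique that by blast
  next
    case False
    then have "z \<in> boundary E V D" using that in_V[OF sym[OF that(1)]] by (auto simp: boundary_def)
    then show ?thesis using bd that(3) sym by blast
  qed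
  have "twins y y'" unfolding twins_def using trans yD assms(6) by blast
  then show False using twin_free by blast
qed

end

section \<open>Odd holes\<close>

lemma relpow_sym:
  assumes "sym R" "(a, b) \<in> R ^^ n" shows "(b, a) \<in> R ^^ n"
  using assms(2)
proof (induction n arbitrary: b)
  case (Suc n)
  then obtain y where "(a, y) \<in> R ^^ n" "(y, b) \<in> R" by auto
  then show ?case using Suc.IH assms(1) by (meson relpow_Suc_I2 symD)
qed simp

text \<open>
A shortest closed walk of odd length is induced: a repeated vertex or a chord would split it into
two closed walks, one of which is odd and shorter. Without odd closed walks, the parity of a walk from
a fixed root of the component is a proper two-colouring.
\<close>

lemma bipartite_or_odd_hole:
  fixes E :: "'a \<Rightarrow> 'a \<Rightarrow> bool"
  assumes sym: "\<And>u v. E u v \<Longrightarrow> E v u"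
    and no_tri: "\<And>u v w. E u v \<Longrightarrow> E v w \<Longrightarrow> E u w \<Longrightarrow> False"
  shows "(\<exists>f::'a \<Rightarrow> bool. \<forall>u v. E u v \<longrightarrow> f u \<noteq> f v) \<or> (\<exists>n c. odd n \<and> hole E n c)"
proof -
  define R where "R = {(u, v). E u v}"
  have symR: "sym R" using sym by (auto simp: R_def sym_def)
  have irr: "\<not> E u u" for u using no_tri by blast
  show ?thesis
  proof (cases "\<exists>n. odd n \<and> (\<exists>u. (u, u) \<in> R ^^ n)")
    case True
    define n where "n = (LEAST n. odd n \<and> (\<exists>u. (u, u) \<in> R ^^ n))"
    have "odd n \<and> (\<exists>u. (u, u) \<in> R ^^ n)" unfolding n_def using True by (rule LeastI_ex)
    then obtain u where n: "odd n" "(u, u) \<in> R ^^ n" by blast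
    have n_le: "n \<le> m" if "odd m" "(v, v) \<in> R ^^ m" for m v
      unfolding n_def by (rule Least_le) (use that in blast)
    obtain f where f: "f 0 = u" "f n = u" "\<And>i. i < n \<Longrightarrow> (f i, f (Suc i)) \<in> R"
      using n(2) unfolding relpow_fun_conv by auto
    have seg: "(f i, f j) \<in> R ^^ (j - i)" if "i \<le> j" "j \<le> n" for i j
      unfolding relpow_fun_conv
      by (rule exI[of _ "\<lambda>k. f (i + k)"]) (use f(3) that in auto)
    have shortcut: "n \<le> j - i + k \<or> j - i \<le> k" if "i < j" "j \<le> n" "(f i, f j) \<in> R ^^ k" for i j k
    proof -
      have "(f j, f i) \<in> R ^^ k" using that(3) symR by (rule relpow_sym[rotated])
      then have 1: "(f i, f i) \<in> R ^^ (j - i + k)"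
        using seg[of i j] that unfolding relpow_add by auto
      have "(f j, f i) \<in> R ^^ (n - j + i)"
        using seg[of j n] seg[of 0 i] that f(1,2) unfolding relpow_add by auto
      then have 2: "(f j, f j) \<in> R ^^ (n - j + i + k)"
        using that(3) unfolding relpow_add[of "n - j + i"] by auto
      show ?thesis
      proof (cases "odd (j - i + k)")
        case True then show ?thesis using n_le[OF _ 1] by simp
      next
        case False
        then have "odd (n - j + i + k)" using n(1) that by presburger
        then show ?thesis using n_le[OF _ 2] that by linarith
      qed
    qed
    have inj: "f i \<noteq> f j" if "i < j" "j < n" for i j
    proof
      assume "f i = f j"
      then have "(f i, f j) \<in> R ^^ 0" by simp
      then show False using shortcut[of i j 0] that by simp
    qed
    have adj: "E (f i) (f j) \<longleftrightarrow> j = Suc i \<or> i = 0 \<and> Suc j = n" if "i < j" "j < n" for i j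
    proof
      assume "E (f i) (f j)"
      then have "(f i, f j) \<in> R ^^ 1" by (simp add: R_def)
      then show "j = Suc i \<or> i = 0 \<and> Suc j = n" using shortcut[of i j 1] that by linarith
    next
      assume "j = Suc i \<or> i = 0 \<and> Suc j = n"
      then show "E (f i) (f j)" using f that sym by (fastforce simp: R_def)
    qed
    have "n \<noteq> 1" using f(3)[of 0] f(1,2) irr by (auto simp: R_def)
    moreover have "n \<noteq> 3"
      using f(3)[of 0] f(3)[of 1] f(3)[of 2] f(1,2) no_tri[of "f 0" "f 1" "f 2"] sym[of "f 2" "f 0"]
      by (auto simp: R_def numeral_3_eq_3 numeral_2_eq_2)
    ultimately have "n \<ge> 5" using n(1) by presburger
    then have "hole E (int n) (\<lambda>i. f (nat (i mod int n)))"
      by (rule hole_if_cyclic) (use sym irr inj adj in blast)+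
    then show ?thesis using n(1) by (metis even_of_nat_iff)
  next
    case False
    define root where "root x = (SOME y. (x, y) \<in> R\<^sup>*)" for x
    define f where "f x = (\<exists>n. even n \<and> (root x, x) \<in> R ^^ n)" for x
    have root: "(x, root x) \<in> R\<^sup>*" for x
      unfolding root_def by (rule someI[of _ x]) simp
    have "f u \<noteq> f v" if uv: "E u v" for u v
    proof -
      have R: "(u, v) \<in> R" "(v, u) \<in> R" using uv sym by (auto simp: R_def)
      then have "(\<lambda>y. (u, y) \<in> R\<^sup>*) = (\<lambda>y. (v, y) \<in> R\<^sup>*)"
        by (intro ext) (meson converse_rtrancl_into_rtrancl)
      then have req: "root u = root v" unfolding root_def by simp
      obtain k where "(u, root u) \<in> R ^^ k" using root rtrancl_power by blast
      then have k: "(root u, u) \<in> R ^^ k" using relpow_sym[OF symR] by blast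
      then have k': "(root v, v) \<in> R ^^ Suc k" using R(1) req by auto
      show ?thesis
      proof
        assume eq: "f u = f v"
        show False
        proof (cases "f u")
          case True
          then obtain a b where ab: "even a" "(root u, u) \<in> R ^^ a" "even b" "(root v, v) \<in> R ^^ b"
            using eq unfolding f_def by blast
          have "(root v, v) \<in> R ^^ Suc a" using ab(2) R(1) req by auto
          moreover have "(v, root v) \<in> R ^^ b" using ab(4) relpow_sym[OF symR] by blast
          ultimately have "(root v, root v) \<in> R ^^ (Suc a + b)" unfolding relpow_add by blast
          then show False using \<open>\<not> (\<exists>n. odd n \<and> _ n)\<close> ab by (metis even_Suc even_add)
        next
          case False
          then have "odd k" "odd (Suc k)" using k k' eq unfolding f_def by blast+
          then show False by simp
        qed
      qed
    qed
    then show ?thesis by blast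
  qed
qed

section \<open>Graphs of girth at least five\<close>

text \<open>
The vertices in these two definitions are automatically distinct, except for the two leaves of the
fork, because the listed adjacencies tell them apart.
\<close>

definition P7_free :: "('a \<Rightarrow> 'a \<Rightarrow> bool) \<Rightarrow> bool" where
  "P7_free E \<longleftrightarrow> \<not> (\<exists>a b c d e f g.
     E a b \<and> E b c \<and> E c d \<and> E d e \<and> E e f \<and> E f g \<and>
     \<not> E a c \<and> \<not> E a d \<and> \<not> E a e \<and> \<not> E a f \<and> \<not> E a g \<and> \<not> E b d \<and> \<not> E b e \<and> \<not> E b f \<and> \<not> E b g \<and>
     \<not> E c e \<and> \<not> E c f \<and> \<not> E c g \<and> \<not> E d f \<and> \<not> E d g \<and> \<not> E e g)"

definition fork_free :: "('a \<Rightarrow> 'a \<Rightarrow> bool) \<Rightarrow> bool" where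
  "fork_free E \<longleftrightarrow> \<not> (\<exists>x l l' p q r.
     E x l \<and> E x l' \<and> l \<noteq> l' \<and> E x p \<and> E p q \<and> E q r \<and> \<not> E x q \<and> \<not> E x r \<and> \<not> E p r \<and>
     \<not> E l l' \<and> \<not> E l p \<and> \<not> E l q \<and> \<not> E l r \<and> \<not> E l' p \<and> \<not> E l' q \<and> \<not> E l' r)"

text \<open>
The Petersen graph is the Kneser graph on the two-element subsets of \<open>{0, 1, 2, 3, 4}\<close>, where
disjoint pairs are adjacent.
\<close>

definition petersen_hom :: "('a \<Rightarrow> 'a \<Rightarrow> bool) \<Rightarrow> 'a set \<Rightarrow> ('a \<Rightarrow> int set) \<Rightarrow> bool" where
  "petersen_hom E V T \<longleftrightarrow> (\<forall>v\<in>V. T v \<subseteq> {0..<5} \<and> card (T v) = 2) \<and>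
     (\<forall>u v. E u v \<longrightarrow> T u \<inter> T v = {})"

locale girth5 =
  fixes V :: "'a set" and E :: "'a \<Rightarrow> 'a \<Rightarrow> bool"
  assumes finite_V: "finite V"
    and sym: "E u v \<Longrightarrow> E v u"
    and in_V: "E u v \<Longrightarrow> u \<in> V"
    and no_tri: "E a b \<Longrightarrow> E b c \<Longrightarrow> E a c \<Longrightarrow> False"
    and no_C4: "E a b \<Longrightarrow> E b c \<Longrightarrow> E c d \<Longrightarrow> E d a \<Longrightarrow> a \<noteq> c \<Longrightarrow> b \<noteq> d \<Longrightarrow> False"
    and atom: "atom E V"
begin

lemma irrefl: "\<not> E u u"
  using no_tri by blast

text \<open>
Girth at least five rules out every adjacency between vertices of the fork at distance two or three,
except for those between the leaves and the far end \<open>r\<close>. The next lemma does the same for paths.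
\<close>

lemma no_fork:
  assumes "fork_free E" "E x l" "E x l'" "l \<noteq> l'" "E x p" "p \<noteq> l" "p \<noteq> l'"
    and "E p q" "q \<noteq> x" "E q r" "r \<noteq> p"
  shows "E l r \<or> E l' r"
proof -
  have "\<not> E x q" "\<not> E x r" "\<not> E p r" "\<not> E l l'" "\<not> E l p" "\<not> E l' p" "\<not> E l q" "\<not> E l' q"
    using no_tri[of x p q] no_tri[of p q r] no_C4[of x p q r] no_tri[of x l l'] no_tri[of x l p]
      no_tri[of x l' p] no_C4[of l x p q] no_C4[of l' x p q] assms sym by blast+
  then show ?thesis using assms unfolding fork_free_def by blast
qed

lemma no_P7:
  assumes "P7_free E" "E a b" "E b c" "E c d" "E d e" "E e f" "E f g"
    and "a \<noteq> c" "b \<noteq> d" "c \<noteq> e" "d \<noteq> f" "e \<noteq> g"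
    and "\<not> E a e" "\<not> E a f" "\<not> E a g" "\<not> E b f" "\<not> E b g" "\<not> E c g"
  shows False
proof -
  have "\<not> E a c" "\<not> E b d" "\<not> E c e" "\<not> E d f" "\<not> E e g"
    using no_tri[of a b c] no_tri[of b c d] no_tri[of c d e] no_tri[of d e f] no_tri[of e f g]
      assms by blast+
  moreover have "\<not> E a d" "\<not> E b e" "\<not> E c f" "\<not> E d g"
    using no_C4[of a b c d] no_C4[of b c d e] no_C4[of c d e f] no_C4[of d e f g]
      assms sym by blast+
  ultimately show ?thesis using assms unfolding P7_free_def by blast
qed

lemma off_hole_near:
  assumes h: "hole E n c" and y: "y \<notin> range c" "E y (c i)" and ij: "\<bar>i - j\<bar> \<le> 2"
  shows "E y (c j) \<longleftrightarrow> j = i"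
proof -
  have n5: "n \<ge> 5" by (rule hole_len[OF h])
  have "False" if "E y (c j)" "j \<noteq> i"
  proof (cases "\<bar>i - j\<bar> = 1")
    case True
    then have "E (c i) (c j)" using hole_near[OF h, of i j] n5 by auto
    then show False using no_tri y(2) that(1) by blast
  next
    case False
    define k where "k = (if j = i + 2 then i + 1 else i - 1)"
    have "j = i + 2 \<or> j = i - 2" using False ij that(2) by linarith
    then have "E (c i) (c k)" "E (c k) (c j)" "c i \<noteq> c j"
      using hole_near[OF h, of i k] hole_near[OF h, of k j] hole_near[OF h, of i j] n5
      by (auto simp: k_def)
    then show False using no_C4[of y "c i" "c k" "c j"] y that(1) sym by blast
  qed
  then show ?thesis using y(2) by blast
qed

lemma hole_in_V: "hole E n c \<Longrightarrow> c i \<in> V"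
  using hole_near[of E n c i "i + 1"] hole_len[of E n c] in_V[of "c i" "c (i + 1)"] by auto

text \<open>
Connectedness of atoms.
\<close>

lemma closed_is_everything:
  assumes "D \<subseteq> V" "x \<in> D" "\<And>d w. d \<in> D \<Longrightarrow> E d w \<Longrightarrow> w \<in> D"
  shows "D = V"
proof -
  have "boundary E V D = {}" using assms(3) by (auto simp: boundary_def)
  then show ?thesis using atomD[OF atom assms(1)] assms(2) by auto
qed

text \<open>
If \<open>y\<close> is adjacent to \<open>c i\<close>, the fork centred at \<open>c i\<close> with leaves \<open>y\<close> and \<open>c (i - 1)\<close> forces
\<open>y\<close> to be adjacent to \<open>c (i + 3)\<close>. Then leaving \<open>c i\<close> through \<open>y\<close> towards \<open>c (i + 3)\<close> and \<open>c (i + 4)\<close> gives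
another fork.
\<close>

lemma fork_free_long_hole:
  assumes f: "fork_free E" and h: "hole E n c" and n7: "n \<ge> 7"
  shows "range c = V"
proof -
  have "\<not> E y (c i)" if y: "y \<notin> range c" for y i
  proof
    assume yi: "E y (c i)"
    have adj: "E (c i) (c (i + 1))" "E (c i) (c (i - 1))" "E (c (i + 1)) (c (i + 2))"
      "E (c (i + 2)) (c (i + 3))" "E (c (i + 3)) (c (i + 4))"
      "\<not> E (c (i - 1)) (c (i + 3))" "\<not> E (c (i - 1)) (c (i + 4))" "\<not> E (c (i + 1)) (c (i + 4))"
      "c (i + 2) \<noteq> c i" "c (i - 1) \<noteq> c (i + 1)" "c (i + 3) \<noteq> c i" "c (i + 3) \<noteq> c (i + 1)"
      using hole_near[OF h, of i "i + 1"] hole_near[OF h, of i "i - 1"]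
        hole_near[OF h, of "i + 1" "i + 2"] hole_near[OF h, of "i + 2" "i + 3"]
        hole_near[OF h, of "i + 3" "i + 4"] hole_near[OF h, of "i - 1" "i + 3"]
        hole_near[OF h, of "i - 1" "i + 4"] hole_near[OF h, of "i + 1" "i + 4"]
        hole_near[OF h, of "i + 2" i] hole_near[OF h, of "i - 1" "i + 1"]
        hole_near[OF h, of "i + 3" i] hole_near[OF h, of "i + 3" "i + 1"] n7 by auto
    have yc: "y \<noteq> c j" for j using y by blast
    have "E y (c (i + 3)) \<or> E (c (i - 1)) (c (i + 3))"
      by (rule no_fork[OF f, of "c i" y "c (i - 1)" "c (i + 1)" "c (i + 2)"])
        (use adj yi sym[OF yi] yc in \<open>auto dest: yc[THEN notE]\<close>)
    then have y3: "E y (c (i + 3))" using adj by blast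
    have "E (c (i + 1)) (c (i + 4)) \<or> E (c (i - 1)) (c (i + 4))"
      by (rule no_fork[OF f, of "c i" "c (i + 1)" "c (i - 1)" y "c (i + 3)"])
        (use adj yi sym[OF yi] y3 yc in \<open>auto dest: yc[THEN notE] yc[symmetric, THEN notE]\<close>)
    then show False using adj by blast
  qed
  then show ?thesis
    using sym hole_in_V[OF h] by (intro closed_is_everything[of _ "c 0"]) blast+
qed

end

section \<open>Holes of length five and the Petersen graph\<close>

text \<open>
The ten pairs of the Petersen graph: \<open>outer_pair i\<close> for \<open>i = 0, \<dots>, 4\<close> is a five-cycle, and
\<open>inner_pair i\<close> is the third neighbour of \<open>outer_pair i\<close>. Inner pairs are adjacent if their indices differ
by two.
\<close>

definition outer_pair :: "int \<Rightarrow> int set" where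
  "outer_pair i = {(2 * i) mod 5, (2 * i + 1) mod 5}"

definition inner_pair :: "int \<Rightarrow> int set" where
  "inner_pair i = {(2 * i + 2) mod 5, (2 * i + 4) mod 5}"

lemma mod5_disjoint: "{a mod 5, b mod 5} \<inter> {x mod 5, y mod (5::int)} = {}"
  if "\<not> 5 dvd a - x" "\<not> 5 dvd a - y" "\<not> 5 dvd b - x" "\<not> 5 dvd b - y"
  using that by (auto simp: mod_eq_dvd_iff)

lemma mod5_pair: "{a mod 5, b mod 5} \<subseteq> {0..<5} \<and> card {a mod 5, b mod 5} = 2"
  if "\<not> 5 dvd a - (b::int)"
  using that by (auto simp: mod_eq_dvd_iff card_insert_if)

context girth5 begin

lemma two_unique: "z \<noteq> z' \<Longrightarrow> E a z \<Longrightarrow> E a z' \<Longrightarrow> E b z \<Longrightarrow> E b z' \<Longrightarrow> a = b"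
  using no_C4[of a z b z'] sym by blast

text \<open>
The pairs are assigned by a relation, so that each vertex may be treated according to its role
without choosing an index for it first.
\<close>

lemma petersen_hom_if_labelled:
  fixes P :: "'a \<Rightarrow> int set \<Rightarrow> bool"
  assumes "\<And>v. v \<in> V \<Longrightarrow> \<exists>X. P v X" and "\<And>v X. P v X \<Longrightarrow> X \<subseteq> {0..<5} \<and> card X = 2"
    and "\<And>u v X Y. E u v \<Longrightarrow> P u X \<Longrightarrow> P v Y \<Longrightarrow> X \<inter> Y = {}"
  shows "\<exists>T. petersen_hom E V T"
proof -
  obtain T where T: "\<And>v. v \<in> V \<Longrightarrow> P v (T v)" using assms(1) by metis
  have "petersen_hom E V T"
    unfolding petersen_hom_def
  proof (intro conjI ballI allI impI)
    show "T v \<subseteq> {0..<5}" "card (T v) = 2" if "v \<in> V" for v using assms(2)[OF T[OF that]] by auto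
    show "T u \<inter> T v = {}" if "E u v" for u v
      by (rule assms(3)[OF that T[OF in_V[OF that]] T[OF in_V[OF sym[OF that]]]])
  qed
  then show ?thesis by blast
qed

context
  fixes c :: "int \<Rightarrow> 'a"
  assumes h: "hole E 5 c"
begin

lemma C5_attach_unique:
  assumes "y \<notin> range c" "E y (c i)" "E y (c j)" shows "5 dvd i - j"
proof -
  \<comment> \<open>the index congruent to \<open>j\<close> that is nearest to \<open>i\<close>\<close>
  define k where "k = i + (j - i + 2) mod 5 - 2"
  have k: "5 dvd k - j" "\<bar>i - k\<bar> \<le> 2"
    unfolding k_def by presburger+
  then have "c k = c j" by (simp add: hole_eq[OF h])
  then have "k = i" using off_hole_near[OF h assms(1,2) k(2)] assms(3) by simp
  then show ?thesis using k(1) by simp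
qed

lemma C5_attach_adjacent:
  assumes "a \<notin> range c" "b \<notin> range c" "E a (c i)" "E b (c j)" "E a b"
  shows "5 dvd i - j - 2 \<or> 5 dvd i - j + 2"
proof (rule ccontr)
  assume "\<not> ?thesis"
  then have "5 dvd i - j \<or> 5 dvd i - j - 1 \<or> 5 dvd i - j + 1" by presburger
  then have "c i = c j \<or> E (c i) (c j)" by (auto simp: hole_eq[OF h] hole_adj[OF h])
  then show False
    using no_tri[of a b "c i"] no_C4[of a "c i" "c j" b] assms sym by (metis rangeI)
qed

text \<open>
A path \<open>c i, a, z, z'\<close> that leaves the hole for good gives a fork centred at \<open>c i\<close>, and it continues
along the hole to a \<open>P\<^sub>7\<close>. So the vertices at distance two from the hole form a stable set and no vertex
is farther away.
\<close>

lemma C5_beyond_attached: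
  assumes free: "fork_free E \<or> P7_free E"
    and a: "a \<notin> range c" "E a (c i)" and z: "z \<notin> range c" "\<And>i. \<not> E z (c i)"
    and "E a z" "E z z'"
  shows "\<exists>j. E z' (c j)"
proof (rule ccontr)
  assume no: "\<not> ?thesis"
  have near: "E (c i) (c (i + 1))" "E (c i) (c (i - 1))" "E (c (i + 1)) (c (i + 2))"
    "E (c (i + 2)) (c (i + 3))" "c (i + 1) \<noteq> c (i - 1)" "c i \<noteq> c (i + 2)"
    "c (i + 1) \<noteq> c (i + 3)"
    by (simp_all add: hole_adj[OF h] hole_eq[OF h])
  have an: "\<not> E a (c (i + 1))" "\<not> E a (c (i + 2))" "\<not> E a (c (i + 3))"
    using C5_attach_unique[OF a(1) a(2), of "i + 1"] C5_attach_unique[OF a(1) a(2), of "i + 2"]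
      C5_attach_unique[OF a(1) a(2), of "i + 3"] by auto
  have ne: "z' \<noteq> a" "a \<noteq> c j" "z \<noteq> c j" "z' \<noteq> c j" for j
    using no a z assms(6,7) sym[OF assms(7)] by auto
  show False
    using free
  proof
    assume "fork_free E"
    then have "E (c (i + 1)) z' \<or> E (c (i - 1)) z'"
      by (rule no_fork[of "c i" _ _ a z]) (use near sym[OF a(2)] ne ne(2,3)[symmetric] assms(6,7) in auto)
    then show False using no sym by blast
  next
    assume "P7_free E"
    then show False
      by (rule no_P7[of z' z a "c i" "c (i + 1)" "c (i + 2)" "c (i + 3)"])
        (use near a(2) an ne assms(6,7) sym no z in auto)
  qed
qed

lemma C5_covers:
  assumes free: "fork_free E \<or> P7_free E" and "v \<in> V" "v \<notin> range c" "\<And>i. \<not> E v (c i)"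
  shows "\<exists>a i. E v a \<and> E a (c i)"
proof -
  define D where "D = {z \<in> V. z \<in> range c \<or> (\<exists>i. E z (c i)) \<or> (\<exists>a i. E z a \<and> E a (c i))}"
  have "D = V"
  proof (rule closed_is_everything)
    show "c 0 \<in> D" using hole_in_V[OF h] by (auto simp: D_def)
    fix d w assume d: "d \<in> D" "E d w"
    show "w \<in> D"
    proof (cases "d \<in> range c \<or> (\<exists>i. E d (c i)) \<or> w \<in> range c")
      case True
      then show ?thesis using d(2) in_V[OF sym[OF d(2)]] sym[OF d(2)] by (auto simp: D_def)
    next
      case False
      then obtain a i where a: "E d a" "E a (c i)" using d(1) by (auto simp: D_def)
      have "a \<notin> range c" using a(1) False by auto
      then have "\<exists>j. E w (c j)"
        using C5_beyond_attached[OF free _ a(2), of d w] False a(1) sym d(2) by blast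
      then show ?thesis using in_V by (auto simp: D_def)
    qed
  qed (auto simp: D_def)
  then show ?thesis using assms(2-4) by (auto simp: D_def)
qed

text \<open>
Attachments two apart on the hole would give a fork, or, along the longer side of the hole,
a hole of length seven.
\<close>

lemma C5_second_level:
  assumes free: "fork_free E \<or> P7_free E \<and> (\<forall>c. \<not> hole E 7 c)"
    and z: "z \<notin> range c" "\<And>i. \<not> E z (c i)"
    and a: "E z a" "E a (c i)" and b: "E z b" "E b (c j)"
  shows "\<not> 5 dvd i - j - 2"
proof
  assume d: "5 dvd i - j - 2"
  have aR: "a \<notin> range c" "b \<notin> range c" using a b z by auto
  have ab: "a \<noteq> b" using d C5_attach_unique[OF aR(1) a(2), of j] b(2) by (auto; presburger)
  have nab: "\<not> E a b" using no_tri a b by blast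
  have an: "E a (c k) \<longleftrightarrow> 5 dvd k - i" for k
    using C5_attach_unique[OF aR(1) _ a(2), of k] a(2) hole_eq[OF h, of k i] by metis
  have bn: "E b (c k) \<longleftrightarrow> 5 dvd k - j" for k
    using C5_attach_unique[OF aR(2) _ b(2), of k] b(2) hole_eq[OF h, of k j] by metis
  show False
    using free
  proof
    assume f: "fork_free E"
    have "E (c (i + 1)) b \<or> E (c (i - 1)) b"
    proof (rule no_fork[OF f, of "c i" _ _ a z])
      show "E (c i) (c (i + 1))" "E (c i) (c (i - 1))" "c (i + 1) \<noteq> c (i - 1)"
        by (simp_all add: hole_adj[OF h] hole_eq[OF h])
      show "E (c i) a" "E a z" "E z b" using a b sym by blast+
      show "a \<noteq> c (i + 1)" "a \<noteq> c (i - 1)" "z \<noteq> c i" "b \<noteq> a" using aR z ab by auto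
    qed
    then have "5 dvd (i + 1) - j \<or> 5 dvd (i - 1) - j" using bn sym by blast
    then show False using d by presburger
  next
    assume p: "P7_free E \<and> (\<forall>c. \<not> hole E 7 c)"
    let ?f = "\<lambda>k. [z, a, c i, c (i + 1), c (i + 2), c (i + 3), b] ! k"
    have ce: "c k = c l \<longleftrightarrow> 5 dvd k - l" "E (c k) (c l) \<longleftrightarrow> 5 dvd k - l - 1 \<or> 5 dvd k - l + 1" for k l
      by (simp_all add: hole_adj[OF h] hole_eq[OF h])
    have cb: "E (c k) b \<longleftrightarrow> 5 dvd k - j" for k using bn sym by blast
    have bk: "\<not> E (c i) b" "\<not> E (c (i + 1)) b" "\<not> E (c (i + 2)) b" "E (c (i + 3)) b"
      unfolding cb using d by presburger+
    have "hole E (int 7) (\<lambda>k. ?f (nat (k mod int 7)))"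
    proof (rule hole_if_cyclic)
      show "?f k \<noteq> ?f l" if "k < l" "l < 7" for k l
      proof -
        have "k \<in> {0,1,2,3,4,5}" "l \<in> {1,2,3,4,5,6}" using that by auto
        then show ?thesis using that z aR ab a b irrefl
          by (elim insertE emptyE) (auto simp: ce)
      qed
      show "E (?f k) (?f l) \<longleftrightarrow> l = Suc k \<or> k = 0 \<and> Suc l = 7" if "k < l" "l < 7" for k l
      proof -
        have "k \<in> {0,1,2,3,4,5}" "l \<in> {1,2,3,4,5,6}" using that by auto
        then show ?thesis using that z a b nab bk
          by (elim insertE emptyE) (auto simp: ce an)
      qed
    qed (use sym irrefl in auto)
    then show False using p by simp
  qed
qed

text \<open>
The hole goes to the outer cycle and the neighbours of \<open>c i\<close> go to \<open>inner_pair i\<close>. A vertex \<open>z\<close>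
at distance two only has neighbours attached at \<open>c i\<close> and \<open>c (i + 1)\<close> for some \<open>i\<close>, and the pairs
\<open>inner_pair i\<close> and \<open>inner_pair (i + 1)\<close> have the common neighbour \<open>inner_pair (i + 3)\<close>.
\<close>

lemma C5_petersen_hom:
  assumes free: "fork_free E \<or> P7_free E \<and> (\<forall>c. \<not> hole E 7 c)"
  shows "\<exists>T. petersen_hom E V T"
proof -
  have free': "fork_free E \<or> P7_free E" using free by blast
  define far where "far z \<longleftrightarrow> z \<notin> range c \<and> (\<forall>i. \<not> E z (c i))" for z
  define label where "label v X \<longleftrightarrow> (\<exists>i. v = c i \<and> X = outer_pair i) \<or>
    (\<exists>i. v \<notin> range c \<and> E v (c i) \<and> X = inner_pair i) \<or>
    (\<exists>i. far v \<and> X = inner_pair (i + 3) \<and>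
       (\<forall>a j. E v a \<longrightarrow> E a (c j) \<longrightarrow> 5 dvd j - i \<or> 5 dvd j - i - 1))" for v X
  have label_out: "label (c i) (outer_pair i)" for i
    unfolding label_def by (rule disjI1, rule exI[of _ i]) simp
  have label_mid: "label v (inner_pair i)" if "v \<notin> range c" "E v (c i)" for v i
    unfolding label_def by (rule disjI2, rule disjI1, rule exI[of _ i]) (use that in simp)
  have label_far: "label v (inner_pair (i + 3))"
    if "far v" "\<And>a j. E v a \<Longrightarrow> E a (c j) \<Longrightarrow> 5 dvd j - i \<or> 5 dvd j - i - 1" for v i
    unfolding label_def by (rule disjI2, rule disjI2, rule exI[of _ i]) (use that in simp)
  show ?thesis
  proof (rule petersen_hom_if_labelled[of label])
    fix v assume v: "v \<in> V"
    show "\<exists>X. label v X"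
    proof (cases "far v")
      case False
      then have "v \<in> range c \<or> (\<exists>i. v \<notin> range c \<and> E v (c i))" unfolding far_def by blast
      then show ?thesis using label_out label_mid by (elim disjE exE conjE imageE) blast+
    next
      case True
      then have f: "v \<notin> range c" "\<And>i. \<not> E v (c i)" by (auto simp: far_def)
      obtain a i where a: "E v a" "E a (c i)" using C5_covers[OF free' v f] by blast
      have diff: "\<not> 5 dvd k - j - 2" if "E v a" "E a (c k)" "E v b" "E b (c j)" for a b k j
        by (rule C5_second_level[OF free f that])
      have close: "5 dvd k - j \<or> 5 dvd k - j - 1 \<or> 5 dvd j - k - 1"
        if "E v a" "E a (c k)" "E v b" "E b (c j)" for a b k j
        using diff[OF that] diff[OF that(3,4,1,2)] by presburger
      \<comment> \<open>start the pair of consecutive positions at \<open>i - 1\<close> if that occurs, and at \<open>i\<close> otherwise\<close>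
      show ?thesis
      proof (cases "\<exists>b j. E v b \<and> E b (c j) \<and> 5 dvd i - j - 1")
        case True
        then obtain b j where b: "E v b" "E b (c j)" "5 dvd i - j - 1" by blast
        have "5 dvd k - j \<or> 5 dvd k - j - 1" if "E v d" "E d (c k)" for d k
          using close[OF that a] close[OF that b(1,2)] b(3) by presburger
        then show ?thesis using label_far[OF \<open>far v\<close>, of j] by blast
      next
        case False
        then have "5 dvd k - i \<or> 5 dvd k - i - 1" if "E v d" "E d (c k)" for d k
          using close[OF that a] that by blast
        then show ?thesis using label_far[OF \<open>far v\<close>, of i] by blast
      qed
    qed
  next
    show "X \<subseteq> {0..<5} \<and> card X = 2" if "label v X" for v X
    proof -
      have "outer_pair i \<subseteq> {0..<5} \<and> card (outer_pair i) = 2"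
        "inner_pair i \<subseteq> {0..<5} \<and> card (inner_pair i) = 2" for i
        unfolding outer_pair_def inner_pair_def by (rule mod5_pair; presburger)+
      then show ?thesis using that unfolding label_def by auto
    qed
  next
    fix u v X Y assume uv: "E u v" "label u X" "label v Y"
    have oo: "outer_pair i \<inter> outer_pair j = {}" if "5 dvd i - j - 1 \<or> 5 dvd i - j + 1" for i j
      unfolding outer_pair_def using that by (intro mod5_disjoint; presburger)
    have oi: "outer_pair i \<inter> inner_pair i = {}" "inner_pair i \<inter> outer_pair i = {}" for i
      unfolding outer_pair_def inner_pair_def by (intro mod5_disjoint; presburger)+
    have ii: "inner_pair i \<inter> inner_pair j = {}" if "5 dvd i - j - 2 \<or> 5 dvd i - j + 2" for i j
      unfolding inner_pair_def using that by (intro mod5_disjoint; presburger)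
    have outer_cong: "outer_pair i = outer_pair j" if "5 dvd i - j" for i j
    proof -
      have "5 dvd 2 * i - 2 * j" "5 dvd (2 * i + 1) - (2 * j + 1)" using that by presburger+
      then have "(2 * i) mod 5 = (2 * j) mod 5" "(2 * i + 1) mod 5 = (2 * j + 1) mod 5"
        by (simp_all only: mod_eq_dvd_iff)
      then show ?thesis by (simp add: outer_pair_def)
    qed
    have out: "X = outer_pair i" if "label (c i) X" for i X
    proof -
      have "\<exists>j. c i = c j \<and> X = outer_pair j" using that unfolding label_def far_def by blast
      then show ?thesis using outer_cong hole_eq[OF h] by metis
    qed
    have mid: "\<exists>i. E v (c i) \<and> X = inner_pair i" if "label v X" "v \<notin> range c" "\<not> far v" for v X
      using that unfolding label_def by blast
    have frr: "\<exists>i. X = inner_pair (i + 3) \<and> (\<forall>a j. E v a \<longrightarrow> E a (c j) \<longrightarrow> 5 dvd j - i \<or> 5 dvd j - i - 1)"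
      if "label v X" "far v" for v X
      using that unfolding label_def far_def by blast
    have one: "X \<inter> Y = {}" if uv': "u = c i" "E u v" "label u X" "label v Y" for u v X Y i
    proof (cases "v \<in> range c")
      case True
      then obtain j where "v = c j" by blast
      then show ?thesis using that out oo hole_adj[OF h] by metis
    next
      case False
      then have "\<not> far v" using that sym by (auto simp: far_def)
      then obtain j where j: "E v (c j)" "Y = inner_pair j" using mid[OF uv'(4) False] by blast
      have "5 dvd i - j" using C5_attach_unique[OF False _ j(1), of i] that sym by blast
      then show ?thesis using out[of i X] that outer_cong[of i j] oi j by simp
    qed
    have two: "X \<inter> Y = {}"
      if uv': "far u" "v \<notin> range c" "E u v" "label u X" "label v Y" for u v X Y
    proof -
      obtain i where i: "X = inner_pair (i + 3)"
        "\<forall>a j. E u a \<longrightarrow> E a (c j) \<longrightarrow> 5 dvd j - i \<or> 5 dvd j - i - 1"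
        using frr[OF uv'(4,1)] by blast
      have u: "u \<in> V" "u \<notin> range c" "\<And>i. \<not> E u (c i)" using that in_V by (auto simp: far_def)
      obtain a k where a: "E u a" "E a (c k)" using C5_covers[OF free' u] by blast
      have "a \<notin> range c" using a u by auto
      then have "\<exists>j. E v (c j)"
        using C5_beyond_attached[OF free' _ a(2) u(2,3) _ that(3)] a sym by blast
      then obtain j where j: "E v (c j)" "Y = inner_pair j"
        using mid[OF uv'(5,2)] unfolding far_def by blast
      have "5 dvd j - i \<or> 5 dvd j - i - 1" using i(2) j(1) that(3) by blast
      then show ?thesis unfolding i(1) j(2) by (intro ii; presburger)
    qed
    show "X \<inter> Y = {}"
    proof (cases "u \<in> range c \<or> v \<in> range c")
      case True
      then show ?thesis using one[of u _ v X Y] one[of v _ u Y X] uv sym by (metis Int_commute imageE)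
    next
      case False
      show ?thesis
      proof (cases "far u \<or> far v")
        case True
        then show ?thesis
          using two[of u v X Y] two[of v u Y X] uv False sym by (metis Int_commute)
      next
        case nf: False
        then obtain i j where "E u (c i)" "X = inner_pair i" "E v (c j)" "Y = inner_pair j"
          using mid uv False by metis
        then show ?thesis using C5_attach_adjacent[of u v i j] ii False uv by simp
      qed
    qed
  qed
qed

end

end

section \<open>Holes of length seven in \<open>P\<^sub>7\<close>-free graphs\<close>

context girth5 begin

text \<open>
Every vertex off the hole with a neighbour on it turns out to be adjacent to exactly \<open>c k\<close> and \<open>c (k + 3)\<close>
for some \<open>k\<close> (a satellite at position \<open>k\<close>); all others off the hole are remote.
\<close>

definition satellite :: "(int \<Rightarrow> 'a) \<Rightarrow> 'a \<Rightarrow> int \<Rightarrow> bool" where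
  "satellite c y k \<longleftrightarrow> y \<notin> range c \<and> E y (c k) \<and> E y (c (k + 3))"

definition remote :: "(int \<Rightarrow> 'a) \<Rightarrow> 'a \<Rightarrow> bool" where
  "remote c z \<longleftrightarrow> z \<notin> range c \<and> (\<forall>i. \<not> E z (c i))"

context
  fixes c :: "int \<Rightarrow> 'a"
  assumes P7: "P7_free E" and h: "hole E 7 c"
begin

lemma C7_eq: "c i = c j \<longleftrightarrow> 7 dvd i - j"
  and C7_adj: "E (c i) (c j) \<longleftrightarrow> 7 dvd i - j - 1 \<or> 7 dvd i - j + 1"
  using hole_eq[OF h] hole_adj[OF h] by auto

lemma satellite_cong: "7 dvd k - l \<Longrightarrow> satellite c y k \<longleftrightarrow> satellite c y l"
  using C7_eq[of k l] C7_eq[of "k + 3" "l + 3"] by (simp add: satellite_def)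

lemma C7_attached_not_near:
  assumes "y \<notin> range c" "E y (c i)" "E y (c j)"
  shows "7 dvd j - i \<or> 7 dvd j - i - 3 \<or> 7 dvd j - i + 3"
proof (rule ccontr)
  assume n: "\<not> ?thesis"
  \<comment> \<open>the index congruent to \<open>j\<close> that lies within distance two of \<open>i\<close>\<close>
  define k where "k = i + (j - i + 2) mod 7 - 2"
  have "7 dvd k - j" unfolding k_def by presburger
  moreover have "\<bar>i - k\<bar> \<le> 2" using n unfolding k_def by presburger
  ultimately have "c k = c j" "\<bar>i - k\<bar> \<le> 2" by (simp_all add: C7_eq)
  then have "k = i" using off_hole_near[OF h assms(1,2), of k] assms(3) by simp
  then show False using n \<open>7 dvd k - j\<close> by presburger
qed

lemma satellite_nbrs:
  assumes "satellite c y k" shows "E y (c j) \<longleftrightarrow> 7 dvd j - k \<or> 7 dvd j - k - 3"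
proof
  assume j: "E y (c j)"
  have y: "y \<notin> range c" "E y (c k)" "E y (c (k + 3))" using assms by (auto simp: satellite_def)
  show "7 dvd j - k \<or> 7 dvd j - k - 3"
    using C7_attached_not_near[OF y(1,2) j] C7_attached_not_near[OF y(1,3) j] by presburger
next
  assume "7 dvd j - k \<or> 7 dvd j - k - 3"
  then have "c j = c k \<or> c j = c (k + 3)" by (simp add: C7_eq algebra_simps)
  then show "E y (c j)" using assms by (auto simp: satellite_def)
qed

text \<open>
Otherwise \<open>y\<close> followed by six consecutive vertices of the hole is an induced \<open>P\<^sub>7\<close>.
\<close>

lemma C7_attached_satellite:
  assumes y: "y \<notin> range c" "E y (c i)" shows "\<exists>k. satellite c y k"
proof (rule ccontr)
  assume no: "\<not> ?thesis"
  have ne: "y \<noteq> c j" for j using y by blast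
  have far: "\<not> E y (c (i + 3))" "\<not> E y (c (i + 4))"
  proof -
    show "\<not> E y (c (i + 3))" using no y by (auto simp: satellite_def)
    have "c (i + 4 + 3) = c i" by (simp add: C7_eq)
    then show "\<not> E y (c (i + 4))" using no y unfolding satellite_def by metis
  qed
  have "\<not> E y (c (i + 5))"
    using C7_attached_not_near[OF y, of "i + 5"] by auto
  with far show False
    by (intro no_P7[OF P7, of y "c i" "c (i + 1)" "c (i + 2)" "c (i + 3)" "c (i + 4)" "c (i + 5)"])
      (use y ne in \<open>auto simp: C7_eq C7_adj\<close>)
qed

lemma satellite_unique:
  assumes "satellite c y k" "satellite c y' l" "7 dvd k - l" shows "y = y'"
proof (rule two_unique[of "c k" "c (k + 3)"])
  have "satellite c y' k" using assms satellite_cong by blast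
  then show "E y' (c k)" "E y' (c (k + 3))" by (auto simp: satellite_def)
  show "E y (c k)" "E y (c (k + 3))" using assms(1) by (auto simp: satellite_def)
  show "c k \<noteq> c (k + 3)" by (simp add: C7_eq)
qed

lemma satellites_nonadjacent:
  assumes s: "satellite c y k" "satellite c y' l" shows "\<not> E y y'"
proof
  assume e: "E y y'"
  have y: "E y (c k)" "E y (c (k + 3))" "E y' (c l)" "E y' (c (l + 3))"
    "y \<notin> range c" "y' \<notin> range c"
    using s by (auto simp: satellite_def)
  have "False" if "E y (c i)" "E y' (c j)" "c i = c j \<or> E (c i) (c j)" for i j
    using no_tri[of y y' "c i"] no_C4[of y "c i" "c j" y'] e y(5,6) that sym by (metis rangeI)
  moreover have "(c k = c l \<or> E (c k) (c l)) \<or> (c k = c (l + 3) \<or> E (c k) (c (l + 3))) \<or>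
      (c (k + 3) = c l \<or> E (c (k + 3)) (c l))"
    unfolding C7_eq C7_adj by presburger
  ultimately show False using y by blast
qed

text \<open>
The induced path is \<open>y, c k, c (k + 1), c (k + 2), y', c (k + 5), c (k + 4)\<close>.
\<close>

lemma satellites_distance:
  assumes s: "satellite c y k" "satellite c y' l" shows "\<not> 7 dvd l - k - 2"
proof
  assume d: "7 dvd l - k - 2"
  have s2: "satellite c y' (k + 2)" using s(2) satellite_cong[of l "k + 2"] d by (simp add: algebra_simps)
  have y': "E y' (c j) \<longleftrightarrow> 7 dvd j - (k + 2) \<or> 7 dvd j - (k + 2) - 3" "y' \<noteq> c j" for j
    using satellite_nbrs[OF s2] s2 by (auto simp: satellite_def)
  have y: "E y (c j) \<longleftrightarrow> 7 dvd j - k \<or> 7 dvd j - k - 3" "y \<noteq> c j" for j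
    using satellite_nbrs[OF s(1)] s(1) by (auto simp: satellite_def)
  have "E (c j) y' \<longleftrightarrow> E y' (c j)" for j using sym by blast
  then show False
    by (intro no_P7[OF P7, of y "c k" "c (k + 1)" "c (k + 2)" y' "c (k + 5)" "c (k + 4)"])
      (use satellites_nonadjacent[OF s] y y'(1) y'(2) y'(2)[symmetric] in \<open>auto simp: C7_eq C7_adj\<close>)
qed

lemma C7_beyond_satellite:
  assumes y: "satellite c y k" and z: "remote c z" and "E y z" "E z z'"
  shows "\<exists>l. satellite c z' l"
proof (rule ccontr)
  assume no: "\<not> ?thesis"
  have z'1: "z' \<notin> range c" using z assms(4) by (auto simp: remote_def)
  then have z'2: "\<not> E z' (c i)" for i using C7_attached_satellite no by blast
  have "E y (c j) \<longleftrightarrow> 7 dvd j - k \<or> 7 dvd j - k - 3" for j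
    using satellite_nbrs[OF y] .
  moreover have "y \<noteq> z'" using no y by blast
  moreover have "y \<noteq> c j" "z \<noteq> c j" "z' \<noteq> c j" for j
    using y z z'1 by (auto simp: satellite_def remote_def)
  ultimately show False
    by (intro no_P7[OF P7, of z' z y "c k" "c (k - 1)" "c (k - 2)" "c (k - 3)"])
      (use z z'2 sym[OF assms(3)] sym[OF assms(4)] in \<open>auto simp: C7_eq C7_adj remote_def\<close>)
qed

text \<open>
The neighbours of a remote vertex that is adjacent to a satellite are satellites, so connectedness
leaves no other remote vertices.
\<close>

lemma C7_structure:
  assumes v: "v \<in> V"
  obtains i where "v = c i" | k where "satellite c v k" | y k where "remote c v" "E v y" "satellite c y k"
proof -
  define D where "D = {z \<in> V. \<not> remote c z \<or> (\<exists>y k. E z y \<and> satellite c y k)}"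
  have "D = V"
  proof (rule closed_is_everything)
    show "c 0 \<in> D" using hole_in_V[OF h] by (auto simp: D_def remote_def)
    fix d w assume d: "d \<in> D" "E d w"
    have w: "w \<in> V" using in_V sym d(2) by blast
    show "w \<in> D"
    proof (cases "remote c w")
      case rw: True
      show ?thesis
      proof (cases "remote c d")
        case True
        then obtain y k where y: "E d y" "satellite c y k" using d(1) by (auto simp: D_def)
        have "\<exists>l. satellite c w l" using C7_beyond_satellite[OF y(2) True sym[OF y(1)] d(2)] .
        then show ?thesis using rw by (auto simp: satellite_def remote_def)
      next
        case False
        have "d \<notin> range c" using rw sym[OF d(2)] by (auto simp: remote_def)
        then have "\<exists>k. satellite c d k" using False C7_attached_satellite by (auto simp: remote_def)
        then show ?thesis using sym[OF d(2)] w unfolding D_def by blast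
      qed
    qed (simp add: D_def w)
  qed (auto simp: D_def)
  then have "\<not> remote c v \<or> (\<exists>y k. E v y \<and> satellite c y k)" using v by (auto simp: D_def)
  then show ?thesis
    using that C7_attached_satellite unfolding remote_def by (metis imageE)
qed

lemma remote_nbr:
  assumes "remote c z" "E z w" shows "\<exists>l. satellite c w l"
proof -
  have "z \<in> V" using in_V assms(2) .
  then obtain y k where "E z y" "satellite c y k"
    by (rule C7_structure) (use assms(1) in \<open>auto simp: remote_def satellite_def\<close>)
  then show ?thesis using C7_beyond_satellite[OF _ assms(1) sym assms(2)] by blast
qed

text \<open>
The position differences \<open>0\<close> and \<open>\<plusminus>3\<close> would close a four-cycle through the hole and \<open>z\<close>, and
\<open>\<plusminus>2\<close> never occurs among satellites.
\<close>

lemma remote_two_satellites: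
  assumes z: "remote c z" and y: "E z y" "satellite c y k" and y': "E z y'" "satellite c y' l"
    and "y \<noteq> y'"
  shows "7 dvd l - k - 1 \<or> 7 dvd l - k + 1"
proof -
  have "\<not> 7 dvd k - l" using satellite_unique y y' assms(6) by blast
  moreover have "\<not> 7 dvd l - k - 2" "\<not> 7 dvd k - l - 2"
    using satellites_distance y y' by blast+
  moreover have "False" if "E y (c i)" "E y' (c i)" for i
    using two_unique[of y y' z "c i"] assms(6) y(1) y'(1) that sym z by (auto simp: remote_def)
  then have "\<not> 7 dvd l - k - 3" "\<not> 7 dvd k - l - 3"
    using satellite_nbrs[OF y(2), of l] satellite_nbrs[OF y'(2), of k] y(2) y'(2)
    unfolding satellite_def by blast+
  ultimately show ?thesis by presburger
qed

lemma remote_nbrs_card: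
  assumes z: "remote c z" shows "card {y. E z y} \<le> 2"
proof (rule ccontr)
  assume "\<not> ?thesis"
  then have "3 \<le> card {y. E z y}" by simp
  then obtain T where "T \<subseteq> {y. E z y}" "card T = 3"
    using obtain_subset_with_card_n by metis
  then obtain a b d where abd: "E z a" "E z b" "E z d" "a \<noteq> b" "b \<noteq> d" "a \<noteq> d"
    unfolding card_3_iff by auto
  obtain i j k where s: "satellite c a i" "satellite c b j" "satellite c d k"
    using remote_nbr[OF z] abd(1-3) by metis
  show False
    using remote_two_satellites[OF z abd(1) s(1) abd(2) s(2) abd(4)]
      remote_two_satellites[OF z abd(2) s(2) abd(3) s(3) abd(5)]
      remote_two_satellites[OF z abd(1) s(1) abd(3) s(3) abd(6)] by presburger
qed

text \<open>
Positions modulo seven may only differ by \<open>0\<close>, \<open>\<plusminus>1\<close> and \<open>\<plusminus>3\<close>. A set with these differences is, up to rotation,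
contained in \<open>{0, 1, 4}\<close>.
\<close>

lemma satellite_positions:
  "\<exists>s. \<forall>y k. satellite c y k \<longrightarrow> 7 dvd k - s \<or> 7 dvd k - s - 1 \<or> 7 dvd k - s - 4"
proof -
  have d: "\<not> 7 dvd k - l - 2 \<and> \<not> 7 dvd k - l + 2" if "satellite c y k" "satellite c y' l" for y y' k l
    using satellites_distance[OF that] satellites_distance[OF that(2,1)] by presburger
  consider y y' k where "satellite c y k" "satellite c y' (k + 1)"
    | y y' k where "satellite c y k" "satellite c y' (k + 3)"
      "\<And>w w' l. satellite c w l \<Longrightarrow> \<not> satellite c w' (l + 1)"
    | y k where "satellite c y k" "\<And>w w' l. satellite c w l \<Longrightarrow> \<not> satellite c w' (l + 1)"
      "\<And>w w' l. satellite c w l \<Longrightarrow> \<not> satellite c w' (l + 3)"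
    | "\<And>y k. \<not> satellite c y k"
    by blast
  then show ?thesis
  proof cases
    case 1
    have "7 dvd l - k \<or> 7 dvd l - k - 1 \<or> 7 dvd l - k - 4" if "satellite c w l" for w l
      using d[OF that 1(1)] d[OF that 1(2)] by presburger
    then show ?thesis by blast
  next
    case 2
    have "7 dvd l - (k - 1) \<or> 7 dvd l - (k - 1) - 1 \<or> 7 dvd l - (k - 1) - 4" if "satellite c w l" for w l
    proof -
      have "\<not> 7 dvd l - k - 1" "\<not> 7 dvd l - k + 1" "\<not> 7 dvd l - (k + 3) - 1" "\<not> 7 dvd l - (k + 3) + 1"
        using 2(3)[OF 2(1), of w] 2(3)[OF that, of y] 2(3)[OF 2(2), of w] 2(3)[OF that, of y'] 2(1,2) that
          satellite_cong[of l "k + 1" w] satellite_cong[of "l + 1" k y]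
          satellite_cong[of l "k + 3 + 1" w] satellite_cong[of "l + 1" "k + 3" y']
        by (auto simp: algebra_simps)
      then show ?thesis using d[OF that 2(1)] d[OF that 2(2)] by presburger
    qed
    then show ?thesis by blast
  next
    case 3
    have "7 dvd l - k" if "satellite c w l" for w l
    proof -
      have "\<not> 7 dvd l - k - 1" "\<not> 7 dvd l - k + 1" "\<not> 7 dvd l - k - 3" "\<not> 7 dvd l - k + 3"
        using 3(2)[OF 3(1), of w] 3(2)[OF that, of y] 3(3)[OF 3(1), of w] 3(3)[OF that, of y] 3(1) that
          satellite_cong[of l "k + 1" w] satellite_cong[of "l + 1" k y]
          satellite_cong[of l "k + 3" w] satellite_cong[of "l + 3" k y]
        by (auto simp: algebra_simps)
      then show ?thesis using d[OF that 3(1)] by presburger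
    qed
    then show ?thesis by blast
  next
    case 4 then show ?thesis by blast
  qed
qed

text \<open>
A remote vertex sees satellites at positions \<open>0\<close> and \<open>1\<close> only, or at position \<open>4\<close> only. In the
former case it goes to \<open>{0, 2}\<close>, which avoids \<open>{3, 4}\<close> and \<open>{1, 4}\<close>; in the latter to \<open>{0, 1}\<close>, which
avoids \<open>{2, 4}\<close>.
\<close>

lemma C7_petersen_hom_aligned:
  assumes pos: "\<And>y k. satellite c y k \<Longrightarrow> 7 dvd k \<or> 7 dvd k - 1 \<or> 7 dvd k - 4"
  shows "\<exists>T. petersen_hom E V T"
proof -
  \<comment> \<open>a closed walk of length seven in the Petersen graph whose vertices \<open>0\<close> and \<open>3\<close>, \<open>1\<close> and \<open>4\<close>,
    and \<open>4\<close> and \<open>7 = 0\<close> have the common neighbours \<open>{3, 4}\<close>, \<open>{1, 4}\<close> and \<open>{2, 4}\<close>\<close>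
  let ?C = "\<lambda>i::int. [{0,1},{2,3},{0,4},{1,2},{0,3},{1,2},{3,4::int}] ! nat (i mod 7)"
  define S where "S k X \<longleftrightarrow> (7 dvd k \<and> X = {3,4}) \<or> (7 dvd k - 1 \<and> X = {1,4}) \<or>
    (7 dvd k - 4 \<and> X = {2,4})" for k :: int and X :: "int set"
  define R :: "'a \<Rightarrow> int set" where
    "R v = (if \<exists>y k. E v y \<and> satellite c y k \<and> 7 dvd k - 4 then {0, 1} else {0, 2})" for v
  define label where "label v X \<longleftrightarrow> (\<exists>i. v = c i \<and> X = ?C i) \<or>
    (\<exists>k. satellite c v k \<and> S k X) \<or> (remote c v \<and> X = R v)" for v X
  have mod7: "i mod 7 = 0 \<or> i mod 7 = 1 \<or> i mod 7 = 2 \<or> i mod 7 = 3 \<or> i mod 7 = 4 \<or>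
      i mod 7 = 5 \<or> i mod 7 = 6" for i :: int by presburger
  have sat: "v \<notin> range c" "\<not> remote c v" if "satellite c v k" for v k
    using that by (auto simp: satellite_def remote_def)
  have label_c: "X = ?C i" if lab: "label (c i) X" for i X
  proof -
    obtain j where j: "c i = c j" "X = ?C j"
      using lab sat unfolding label_def remote_def by blast
    have "i mod 7 = j mod 7" using j(1) by (simp add: C7_eq mod_eq_dvd_iff)
    then show ?thesis using j(2) by simp
  qed
  have label_s: "\<exists>k. satellite c v k \<and> S k X" if "label v X" "satellite c v l" for v X l
    using that sat[OF that(2)] unfolding label_def by blast
  have label_r: "X = R v" if "label v X" "remote c v" for v X
  proof -
    have "v \<notin> range c" using that(2) by (simp add: remote_def)
    then show ?thesis using that sat unfolding label_def by blast
  qed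
  have cc: "?C i \<inter> ?C j = {}" if "E (c i) (c j)" for i j
  proof -
    have suc: "?C k \<inter> ?C l = {}" if "7 dvd k - l - 1" for k l
    proof -
      have "k mod 7 = (l + 1) mod 7" using that by (simp add: mod_eq_dvd_iff diff_diff_eq)
      also have "\<dots> = (if l mod 7 = 6 then 0 else l mod 7 + 1)" by presburger
      finally show ?thesis using mod7[of l] by (elim disjE) simp_all
    qed
    have "7 dvd i - j - 1 \<or> 7 dvd j - i - 1" using that unfolding C7_adj by presburger
    then show ?thesis using suc[of i j] suc[of j i] by (metis Int_commute)
  qed
  have cs: "?C i \<inter> X = {}" if iv: "E (c i) v" "satellite c v l" "label v X" for i v l X
  proof -
    obtain k where k: "satellite c v k" "S k X" using label_s[OF iv(3,2)] by blast
    have m: "7 dvd i - k \<or> 7 dvd i - k - 3" using satellite_nbrs[OF k(1)] sym[OF iv(1)] by blast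
    have "i mod 7 = 0 \<or> i mod 7 = 3" if "7 dvd k" using m that by presburger
    moreover have "i mod 7 = 1 \<or> i mod 7 = 4" if "7 dvd k - 1" using m that by presburger
    moreover have "i mod 7 = 4 \<or> i mod 7 = 0" if "7 dvd k - 4" using m that by presburger
    ultimately show ?thesis using k(2) unfolding S_def by (elim disjE conjE) auto
  qed
  have rs: "X \<inter> Y = {}" if uv: "E u v" "remote c u" "label u X" "label v Y" for u v X Y
  proof -
    obtain l where l: "satellite c v l" using remote_nbr[OF uv(2,1)] by blast
    obtain k where k: "satellite c v k" "S k Y" using label_s[OF uv(4) l] by blast
    have no: "\<not> (7 dvd l - 4)" if "E u y" "satellite c y l" "7 dvd k \<or> 7 dvd k - 1" for y l
    proof (cases "y = v")
      case True
      then have "E v (c l)" "E v (c (l + 3))" using that(2) by (auto simp: satellite_def)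
      then have "7 dvd l - k \<or> 7 dvd l - k - 3" "7 dvd l + 3 - k \<or> 7 dvd l + 3 - k - 3"
        using satellite_nbrs[OF k(1)] by blast+
      then show ?thesis using that(3) by presburger
    next
      case False
      then show ?thesis
        using remote_two_satellites[OF \<open>remote c u\<close> \<open>E u v\<close> k(1) that(1,2)] that(3) by presburger
    qed
    show ?thesis
    proof (cases "7 dvd k - 4")
      case True
      then have "X = {0, 1}" using label_r[OF uv(3,2)] k(1) \<open>E u v\<close> unfolding R_def by meson
      moreover have "\<not> 7 dvd k" "\<not> 7 dvd k - 1" using True by presburger+
      then have "Y = {2, 4}" using k(2) unfolding S_def by blast
      ultimately show ?thesis by simp
    next
      case False
      then have k': "(7 dvd k \<and> Y = {3,4}) \<or> (7 dvd k - 1 \<and> Y = {1,4})"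
        using k(2) unfolding S_def by blast
      then have "X = {0, 2}" using label_r[OF uv(3,2)] no unfolding R_def by meson
      then show ?thesis using k' by auto
    qed
  qed
  have rc: "\<not> E u (c i)" if "remote c u" for u i using that by (simp add: remote_def)
  show ?thesis
  proof (rule petersen_hom_if_labelled[of label])
    fix v assume "v \<in> V"
    then show "\<exists>X. label v X"
    proof (cases rule: C7_structure)
      case 1 then show ?thesis unfolding label_def by blast
    next
      case (2 k)
      have "\<exists>X. S k X" using pos[OF 2] unfolding S_def by blast
      then show ?thesis using 2 unfolding label_def by blast
    next
      case 3 then show ?thesis unfolding label_def by blast
    qed
  next
    show "X \<subseteq> {0..<5} \<and> card X = 2" if "label v X" for v X
    proof -
      have "?C i \<subseteq> {0..<5} \<and> card (?C i) = 2" for i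
        using mod7[of i] by (elim disjE) simp_all
      moreover have "X \<subseteq> {0..<5} \<and> card X = 2" if "S k X" for k using that by (auto simp: S_def)
      ultimately show ?thesis using that unfolding label_def R_def by (auto split: if_splits)
    qed
  next
    fix u v X Y assume uv: "E u v" "label u X" "label v Y"
    have V: "u \<in> V" "v \<in> V" using uv(1) in_V sym by blast+
    from V(1) show "X \<inter> Y = {}"
    proof (cases rule: C7_structure)
      case u: (1 i)
      from V(2) show ?thesis
      proof (cases rule: C7_structure)
        case (1 j) then show ?thesis using u uv label_c cc by metis
      next
        case (2 l) then show ?thesis using u uv label_c cs by metis
      next
        case 3 then show ?thesis using u uv rc sym by metis
      qed
    next
      case u: (2 k)
      from V(2) show ?thesis
      proof (cases rule: C7_structure)
        case (1 j) then show ?thesis using u uv label_c cs sym by (metis Int_commute)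
      next
        case (2 l) then show ?thesis using satellites_nonadjacent u uv by blast
      next
        case 3 then show ?thesis using rs[OF sym[OF uv(1)] _ uv(3,2)] by blast
      qed
    next
      case 3 then show ?thesis using rs[OF uv(1) _ uv(2,3)] by blast
    qed
  qed
qed

end

theorem C7_petersen_hom:
  assumes P7: "P7_free E" and h: "hole E 7 c"
  shows "\<exists>T. petersen_hom E V T"
proof -
  obtain s where s: "\<forall>y k. satellite c y k \<longrightarrow> 7 dvd k - s \<or> 7 dvd k - s - 1 \<or> 7 dvd k - s - 4"
    using satellite_positions[OF P7 h] by blast
  have h': "hole E 7 (\<lambda>i. c (i + s))" using hole_shift[OF h] .
  show ?thesis
  proof (rule C7_petersen_hom_aligned[OF P7 h'])
    fix y k assume y: "satellite (\<lambda>i. c (i + s)) y k"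
    have "range (\<lambda>i. c (i + s)) = range c"
      by (auto simp: image_iff) (metis diff_add_cancel)
    then have "satellite c y (k + s)" using y by (simp add: satellite_def algebra_simps)
    then show "7 dvd k \<or> 7 dvd k - 1 \<or> 7 dvd k - 4" using s by force
  qed
qed

end

section \<open>Colouring weighted graphs\<close>

text \<open>
A colouring of the clique blowup in which \<open>v\<close> is replaced by \<open>w v\<close> vertices, read off on the
original graph.
\<close>

definition multicolouring ::
  "('a \<Rightarrow> 'a \<Rightarrow> bool) \<Rightarrow> 'a set \<Rightarrow> ('a \<Rightarrow> nat) \<Rightarrow> nat \<Rightarrow> ('a \<Rightarrow> nat set) \<Rightarrow> bool" where
  "multicolouring E V w b S \<longleftrightarrow> (\<forall>v\<in>V. S v \<subseteq> {..<b} \<and> w v \<le> card (S v)) \<and>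
     (\<forall>u v. E u v \<longrightarrow> S u \<inter> S v = {})"

definition block :: "nat \<Rightarrow> nat \<Rightarrow> nat \<Rightarrow> nat set" where
  "block h k j = {k * h..<k * h + j}"

lemma block_disjoint:
  assumes "k \<noteq> l" "i \<le> h" "j \<le> h" shows "block h k i \<inter> block h l j = {}"
proof -
  have "k * h + h \<le> l * h \<or> l * h + h \<le> k * h"
  proof (cases "k < l")
    case True
    then have "Suc k * h \<le> l * h" by (intro mult_le_mono1) simp
    then show ?thesis by simp
  next
    case False
    then have "Suc l * h \<le> k * h" using assms(1) by (intro mult_le_mono1) simp
    then show ?thesis by simp
  qed
  then show ?thesis using assms(2,3) by (auto simp: block_def)
qed

lemma block_bound: "k < 5 \<Longrightarrow> j \<le> h \<Longrightarrow> x \<in> block h k j \<Longrightarrow> x < 5 * h"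
proof -
  assume "k < 5" "j \<le> h" "x \<in> block h k j"
  then have "Suc k * h \<le> 5 * h" by (intro mult_le_mono1) simp
  then have "k * h + h \<le> 5 * h" unfolding mult_Suc by linarith
  moreover have "x < k * h + j" using \<open>x \<in> block h k j\<close> by (simp add: block_def)
  ultimately show "x < 5 * h" using \<open>j \<le> h\<close> by linarith
qed

lemma block_mono: "i \<le> j \<Longrightarrow> block h k i \<subseteq> block h k j"
  by (auto simp: block_def)

lemma card_block [simp]: "card (block h k j) = j" and finite_block [simp]: "finite (block h k j)"
  by (auto simp: block_def)

lemma complement_of_pair:
  assumes "p < q" "q < (5::nat)"
  shows "\<exists>r s t. r < s \<and> s < t \<and> t < 5 \<and>
    (\<forall>k<5. k \<noteq> p \<longrightarrow> k \<noteq> q \<longrightarrow> k = r \<or> k = s \<or> k = t)"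
proof -
  have "q = 1 \<or> q = 2 \<or> q = 3 \<or> q = 4" "p = 0 \<or> p = 1 \<or> p = 2 \<or> p = 3" using assms by auto
  then have "(\<forall>k<5. k \<noteq> p \<longrightarrow> k \<noteq> q \<longrightarrow> k = 2 \<or> k = 3 \<or> k = 4) \<or>
    (\<forall>k<5. k \<noteq> p \<longrightarrow> k \<noteq> q \<longrightarrow> k = 1 \<or> k = 3 \<or> k = 4) \<or>
    (\<forall>k<5. k \<noteq> p \<longrightarrow> k \<noteq> q \<longrightarrow> k = 1 \<or> k = 2 \<or> k = 4) \<or>
    (\<forall>k<5. k \<noteq> p \<longrightarrow> k \<noteq> q \<longrightarrow> k = 1 \<or> k = 2 \<or> k = 3) \<or>
    (\<forall>k<5. k \<noteq> p \<longrightarrow> k \<noteq> q \<longrightarrow> k = 0 \<or> k = 3 \<or> k = 4) \<or>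
    (\<forall>k<5. k \<noteq> p \<longrightarrow> k \<noteq> q \<longrightarrow> k = 0 \<or> k = 2 \<or> k = 4) \<or>
    (\<forall>k<5. k \<noteq> p \<longrightarrow> k \<noteq> q \<longrightarrow> k = 0 \<or> k = 2 \<or> k = 3) \<or>
    (\<forall>k<5. k \<noteq> p \<longrightarrow> k \<noteq> q \<longrightarrow> k = 0 \<or> k = 1 \<or> k = 4) \<or>
    (\<forall>k<5. k \<noteq> p \<longrightarrow> k \<noteq> q \<longrightarrow> k = 0 \<or> k = 1 \<or> k = 3) \<or>
    (\<forall>k<5. k \<noteq> p \<longrightarrow> k \<noteq> q \<longrightarrow> k = 0 \<or> k = 1 \<or> k = 2)"
    using assms(1) by (elim disjE) (simp_all add: numeral_eq_Suc less_Suc_eq)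
  then show ?thesis
    by (elim disjE; intro exI conjI; (assumption | simp))
qed

text \<open>
Write \<open>h = m div 2\<close> and reserve five blocks of \<open>h\<close> colours, and for odd \<open>m\<close> three extra colours.
A vertex of weight at most \<open>m\<close> with pair \<open>{p, q}\<close>, \<open>p < q\<close>, takes the first colours of the blocks \<open>p\<close> and \<open>q\<close>,
half of its weight from each, rounded up in block \<open>p\<close> and down in block \<open>q\<close>. If its weight exceeds the two
blocks, which requires \<open>m\<close> to be odd, it also takes one extra colour according to the proper three-colouring
\<open>min p 2\<close> of the Petersen graph. A heavier vertex \<open>v\<close> takes all colours not used by its neighbours. These have
weight at most \<open>l = 2 m - w v\<close> and use three blocks; as the largest of the three is never the smaller member
of a pair, they occupy at most \<open>l + \<lceil>l/2\<rceil>\<close> colours, and enough remain because \<open>l < m\<close>.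
\<close>

lemma multicolouring_if_petersen_hom:
  assumes hom: "petersen_hom E V T"
    and sym: "\<And>u v. E u v \<Longrightarrow> E v u" and in_V: "\<And>u v. E u v \<Longrightarrow> u \<in> V"
    and edge: "\<And>u v. E u v \<Longrightarrow> w u + w v \<le> 2 * m" and vertex: "\<And>v. v \<in> V \<Longrightarrow> w v \<le> 2 * m"
  shows "\<exists>S. multicolouring E V w (2 * m + (m + 1) div 2) S"
proof -
  define h where "h = m div 2"
  define b where "b = 2 * m + (m + 1) div 2"
  have b: "5 * h \<le> b" "m > 2 * h \<Longrightarrow> b = 5 * h + 3" "m = 2 * h \<or> m = 2 * h + 1"
    unfolding b_def h_def by linarith+
  have "\<exists>p q. p < q \<and> q < 5 \<and> T v = {int p, int q}" if v: "v \<in> V" for v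
  proof -
    have T: "T v \<subseteq> {0..<5}" "card (T v) = 2" using hom v by (auto simp: petersen_hom_def)
    then obtain x y where xy: "T v = {x, y}" "x \<noteq> y" unfolding card_2_iff by blast
    have "x < y \<or> y < x" using xy(2) by linarith
    then show ?thesis
    proof
      assume "x < y"
      then show ?thesis using T xy by (intro exI[of _ "nat x"] exI[of _ "nat y"]) auto
    next
      assume "y < x"
      then show ?thesis using T xy by (intro exI[of _ "nat y"] exI[of _ "nat x"]) auto
    qed
  qed
  then obtain P Q where PQ: "P v < Q v" "Q v < 5" "T v = {int (P v), int (Q v)}" if "v \<in> V" for v
    by metis
  have disj: "P u \<noteq> P v" "P u \<noteq> Q v" "Q u \<noteq> P v" "Q u \<noteq> Q v" if "E u v" for u v
  proof -
    have "T u \<inter> T v = {}" using hom that by (auto simp: petersen_hom_def)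
    then show "P u \<noteq> P v" "P u \<noteq> Q v" "Q u \<noteq> P v" "Q u \<noteq> Q v"
      using PQ(3)[OF in_V[OF that]] PQ(3)[OF in_V[OF sym[OF that]]] by auto
  qed
  define L where "L v = block h (P v) (min h ((w v + 1) div 2)) \<union> block h (Q v) (w v div 2)" for v
  define X where "X v = (if w v > 2 * h then {5 * h + min (P v) 2} else {})" for v
  define S where "S v = (if w v \<le> m then L v \<union> X v else {..<b} - (\<Union>u\<in>{u. E v u}. L u))" for v
  have half: "w v div 2 \<le> h" if "w v \<le> m" for v using that by (simp add: h_def div_le_mono)
  have L5: "x < 5 * h" if "x \<in> L v" "v \<in> V" "w v \<le> m" for x v
    using that block_bound[of "P v" _ h x] block_bound[of "Q v" _ h x] PQ[of v] half[of v]
    unfolding L_def by (metis Un_iff less_trans min.cobounded1)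
  have Xb: "X v \<subseteq> {5 * h..<b}" if "w v \<le> m" for v
    using that b by (auto simp: X_def)
  have Ldisj: "L u \<inter> L v = {}" if "E u v" "w u \<le> m" "w v \<le> m" for u v
    using disj[OF that(1)] half[OF that(2)] half[OF that(3)]
    unfolding L_def Int_Un_distrib Int_Un_distrib2 by (simp add: block_disjoint)
  have Xdisj: "X u \<inter> X v = {}" if "E u v" for u v
    using disj[OF that] PQ[OF in_V[OF that]] PQ[OF in_V[OF sym[OF that]]]
    by (auto simp: X_def min_def split: if_splits)
  have cardL: "card (L v) = min h ((w v + 1) div 2) + w v div 2" if "v \<in> V" "w v \<le> m" for v
  proof -
    have "block h (P v) (min h ((w v + 1) div 2)) \<inter> block h (Q v) (w v div 2) = {}"
      by (rule block_disjoint) (use PQ(1)[OF that(1)] half[OF that(2)] in auto)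
    then show ?thesis unfolding L_def by (simp add: card_Un_disjoint)
  qed
  have light: "w v \<le> card (L v \<union> X v)" if "v \<in> V" "w v \<le> m" for v
  proof (cases "w v > 2 * h")
    case True
    then have "w v = 2 * h + 1" using b(3) that(2) by linarith
    moreover have "L v \<inter> X v = {}" using L5[OF _ that] Xb[OF that(2)] by fastforce
    then have "card (L v \<union> X v) = card (L v) + card (X v)"
      by (intro card_Un_disjoint) (auto simp: L_def X_def)
    ultimately show ?thesis using cardL[OF that] True by (simp add: X_def)
  next
    case False
    then show ?thesis using cardL[OF that] by (auto simp: X_def min_def; linarith)
  qed
  have heavy: "w v \<le> card ({..<b} - (\<Union>u\<in>{u. E v u}. L u))" if v: "v \<in> V" "w v > m" for v
  proof -
    define l where "l = 2 * m - w v"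
    have pq: "P v < Q v" "Q v < 5" using PQ[OF v(1)] by auto
    obtain r s t where rst: "r < s" "s < t" "t < 5"
      "\<forall>k<5. k \<noteq> P v \<longrightarrow> k \<noteq> Q v \<longrightarrow> k = r \<or> k = s \<or> k = t"
      using complement_of_pair[OF pq] by (elim exE conjE)
    define U where "U = block h r ((l + 1) div 2) \<union> block h s ((l + 1) div 2) \<union> block h t (l div 2)"
    have "L u \<subseteq> U" if "E v u" for u
    proof -
      have wu: "w u \<le> l" using edge[OF that] by (simp add: l_def)
      have u: "u \<in> V" using in_V sym that by blast
      have "P u = r \<or> P u = s \<or> P u = t" "Q u = r \<or> Q u = s \<or> Q u = t"
        using rst(4)[rule_format, of "P u"] rst(4)[rule_format, of "Q u"] disj[OF that] PQ[OF u]
        by auto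
      then have pos: "P u = r \<or> P u = s" "Q u = s \<or> Q u = t" using PQ(1)[OF u] rst by auto
      have mono: "block h k (min h ((w u + 1) div 2)) \<subseteq> block h k ((l + 1) div 2)"
        "block h k (w u div 2) \<subseteq> block h k (l div 2)"
        "block h k (w u div 2) \<subseteq> block h k ((l + 1) div 2)" for k
        using wu by (intro block_mono; simp add: min_def; linarith)+
      have "block h (P u) ((l + 1) div 2) \<subseteq> U" using pos(1) by (auto simp: U_def)
      moreover have "block h (Q u) (w u div 2) \<subseteq> U"
      proof (cases "Q u = s")
        case True then show ?thesis using mono(3)[of s] by (auto simp: U_def)
      next
        case False then show ?thesis using mono(2)[of t] pos(2) by (auto simp: U_def)
      qed
      ultimately show ?thesis using mono(1)[of "P u"] unfolding L_def by blast
    qed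
    then have sub: "{..<b} - U \<subseteq> {..<b} - (\<Union>u\<in>{u. E v u}. L u)" by blast
    have "card U \<le> (l + 1) div 2 + (l + 1) div 2 + l div 2"
      unfolding U_def by (intro order_trans[OF card_Un_le] add_mono) simp_all
    moreover have "b - card U \<le> card ({..<b} - U)"
      using diff_card_le_card_Diff[of U "{..<b}"] by (simp add: U_def)
    ultimately have "b \<le> card ({..<b} - U) + ((l + 1) div 2 + (l + 1) div 2 + l div 2)"
      by linarith
    moreover have "w v + ((l + 1) div 2 + (l + 1) div 2 + l div 2) \<le> b"
      using v(2) vertex[OF v(1)] unfolding b_def l_def by linarith
    ultimately have "w v \<le> card ({..<b} - U)" by linarith
    also have "\<dots> \<le> card ({..<b} - (\<Union>u\<in>{u. E v u}. L u))" by (rule card_mono[OF _ sub]) simp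
    finally show ?thesis .
  qed
  have mixed: "S u \<inter> S v = {}" if "E u v" "w u > m" for u v
  proof -
    have "w v < m" using edge[OF that(1)] that(2) by linarith
    then have "S v = L v" using b(3) by (auto simp: S_def X_def)
    then show ?thesis using that by (auto simp: S_def)
  qed
  have "multicolouring E V w b S"
    unfolding multicolouring_def
  proof (intro conjI ballI allI impI)
    show "S v \<subseteq> {..<b}" if "v \<in> V" for v
    proof (cases "w v \<le> m")
      case True
      have "L v \<subseteq> {..<b}" using L5[OF _ that True] b(1) by fastforce
      moreover have "X v \<subseteq> {..<b}" using Xb[OF True] by auto
      ultimately show ?thesis using True by (simp add: S_def)
    qed (auto simp: S_def)
    show "w v \<le> card (S v)" if "v \<in> V" for v
      using light[OF that] heavy[OF that] by (simp add: S_def)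
    show "S u \<inter> S v = {}" if "E u v" for u v
    proof (cases "w u \<le> m \<and> w v \<le> m")
      case True
      have uV: "u \<in> V" "v \<in> V" using that in_V sym by blast+
      have "L u \<inter> X v = {}" "X u \<inter> L v = {}"
        using L5[OF _ uV(1)] L5[OF _ uV(2)] Xb[of u] Xb[of v] True by fastforce+
      then show ?thesis using True Ldisj[OF that] Xdisj[OF that] by (auto simp: S_def)
    next
      case False
      then show ?thesis using mixed[OF that] mixed[OF sym[OF that]] by (metis Int_commute not_le)
    qed
  qed
  then show ?thesis unfolding b_def by blast
qed

lemma mod_add_one:
  fixes n :: int
  assumes "n > 0" shows "(j + 1) mod n = (if j mod n = n - 1 then 0 else j mod n + 1)"
proof -
  have "(j + 1) mod n = (j mod n + 1) mod n" by (simp add: mod_simps)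
  moreover have "0 \<le> j mod n" "j mod n < n" using assms by simp_all
  ultimately show ?thesis by (cases "j mod n = n - 1") simp_all
qed

text \<open>
At even positions the palette is an interval of length \<open>m\<close> that moves by at most \<open>r\<close> at a time, from
\<open>{0..<m}\<close> at \<open>0\<close> to \<open>{m..<2 m}\<close> at \<open>2 k\<close>, which takes at most \<open>k\<close> moves. Two consecutive intervals
together occupy at most \<open>m + r\<close> colours, which leaves \<open>m\<close> for the position between them.
\<close>

lemma odd_cycle_palette:
  fixes k m r :: nat
  assumes "m \<le> k * r"
  obtains F :: "int \<Rightarrow> nat set"
  where "\<And>i. F i \<subseteq> {..<2 * m + r}" "\<And>i. card (F i) = m"
    "\<And>i j. int (2 * k + 1) dvd i - j \<Longrightarrow> F i = F j"
    "\<And>i j. int (2 * k + 1) dvd i - j - 1 \<Longrightarrow> F i \<inter> F j = {}"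
proof -
  define b where "b = 2 * m + r"
  define t where "t j = min (j * r) m" for j
  have t: "t 0 = 0" "t k = m" "t j \<le> t (Suc j)" "t (Suc j) \<le> t j + r" "t j \<le> m" for j
    using assms by (auto simp: t_def)
  have "\<exists>A. A \<subseteq> {..<b} - {t j..<t (Suc j) + m} \<and> card A = m" for j
  proof -
    have "m \<le> card ({..<b} - {t j..<t (Suc j) + m})"
      using diff_card_le_card_Diff[of "{t j..<t (Suc j) + m}" "{..<b}"] t(3,4)[of j]
      by (simp add: b_def)
    then show ?thesis using obtain_subset_with_card_n by metis
  qed
  then obtain A where A: "A j \<subseteq> {..<b} - {t j..<t (Suc j) + m}" "card (A j) = m" for j by metis
  define G where "G i = (if even i then {t (i div 2)..<t (i div 2) + m} else A (i div 2))" for i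
  have G: "G i \<subseteq> {..<b}" "card (G i) = m" for i
    using A[of "i div 2"] t(5)[of "i div 2"] by (auto simp: G_def b_def)
  have step: "G (Suc i) \<inter> G i = {}" for i
  proof (cases "even i")
    case True
    have "G i \<subseteq> {t (i div 2)..<t (Suc (i div 2)) + m}" using True t(3)[of "i div 2"] by (auto simp: G_def)
    moreover have "G (Suc i) = A (i div 2)" using True by (simp add: G_def)
    ultimately show ?thesis using A(1)[of "i div 2"] by blast
  next
    case False
    have "G (Suc i) = {t (Suc (i div 2))..<t (Suc (i div 2)) + m}" using False by (simp add: G_def)
    then have "G (Suc i) \<subseteq> {t (i div 2)..<t (Suc (i div 2)) + m}" using t(3)[of "i div 2"] by auto
    moreover have "G i = A (i div 2)" using False by (simp add: G_def)
    ultimately show ?thesis using A(1)[of "i div 2"] by blast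
  qed
  have wrap: "G 0 \<inter> G (2 * k) = {}" using t(1,2) by (auto simp: G_def)
  let ?n = "int (2 * k + 1)"
  define F where "F i = G (nat (i mod ?n))" for i
  show ?thesis
  proof (rule that[of F])
    show "F i \<subseteq> {..<2 * m + r}" "card (F i) = m" for i
      using G by (auto simp: F_def b_def)
    show "F i = F j" if "?n dvd i - j" for i j
    proof -
      have "i mod ?n = j mod ?n" using that by (simp only: mod_eq_dvd_iff)
      then show ?thesis by (simp add: F_def)
    qed
    show "F i \<inter> F j = {}" if "?n dvd i - j - 1" for i j
    proof -
      have "i mod ?n = (j + 1) mod ?n" using that by (simp only: mod_eq_dvd_iff diff_diff_eq)
      also have "\<dots> = (if j mod ?n = ?n - 1 then 0 else j mod ?n + 1)"
        by (rule mod_add_one) simp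
      finally have eq: "i mod ?n = (if j mod ?n = ?n - 1 then 0 else j mod ?n + 1)" .
      show ?thesis
      proof (cases "j mod ?n = ?n - 1")
        case True
        then have "nat (i mod ?n) = 0" using eq by (metis nat_0)
        moreover have "nat (j mod ?n) = 2 * k" unfolding True by simp
        ultimately show ?thesis using wrap unfolding F_def by metis
      next
        case False
        then have "i mod ?n = 1 + j mod ?n" using eq by (metis add.commute)
        moreover have "0 \<le> j mod ?n" by (rule pos_mod_sign) simp
        ultimately have "nat (i mod ?n) = Suc (nat (j mod ?n))"
          using Suc_nat_eq_nat_zadd1 by metis
        then show ?thesis using step unfolding F_def by metis
      qed
    qed
  qed
qed

lemma multicolouring_odd_cycle:
  assumes h: "hole E (int (2 * k + 1)) c" and V: "V = range c" and in_V: "\<And>u v. E u v \<Longrightarrow> u \<in> V \<and> v \<in> V"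
    and w: "\<And>v. v \<in> V \<Longrightarrow> w v = m" and "m \<le> k * r"
  shows "\<exists>S. multicolouring E V w (2 * m + r) S"
proof -
  obtain F where F: "\<And>i. F i \<subseteq> {..<2 * m + r}" "\<And>i. card (F i) = m"
    "\<And>i j. int (2 * k + 1) dvd i - j \<Longrightarrow> F i = F j"
    "\<And>i j. int (2 * k + 1) dvd i - j - 1 \<Longrightarrow> F i \<inter> F j = {}"
    using odd_cycle_palette[OF assms(5)] by blast
  define ix where "ix v = (SOME i. v = c i)" for v
  have ix: "v = c (ix v)" if "v \<in> V" for v
    unfolding ix_def by (rule someI_ex) (use that V in auto)
  have "F (ix u) \<inter> F (ix v) = {}" if "E u v" for u v
  proof -
    have uv: "u = c (ix u)" "v = c (ix v)" using ix in_V[OF that] by blast+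
    have "E (c (ix u)) (c (ix v))" using that uv by simp
    then have "int (2 * k + 1) dvd ix u - ix v - 1 \<or> int (2 * k + 1) dvd ix v - ix u - 1"
      unfolding hole_adj[OF h]
    proof
      assume "int (2 * k + 1) dvd ix u - ix v + 1"
      then have "int (2 * k + 1) dvd - (ix u - ix v + 1)" by (simp only: dvd_minus_iff)
      then show ?thesis by (simp add: algebra_simps)
    qed blast
    then show ?thesis using F(4)[of "ix u" "ix v"] F(4)[of "ix v" "ix u"] by (metis Int_commute)
  qed
  then have "multicolouring E V w (2 * m + r) (\<lambda>v. F (ix v))"
    using F(1,2) w by (simp add: multicolouring_def)
  then show ?thesis by blast
qed

lemma colourable_if_multicolouring:
  assumes "finite W" and cl: "\<And>v. v \<in> R \<Longrightarrow> w v = card {x \<in> W. r x = v}"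
    and r: "\<And>x. x \<in> W \<Longrightarrow> r x \<in> R"
    and adj: "\<And>x y. x \<in> W \<Longrightarrow> y \<in> W \<Longrightarrow> r x \<noteq> r y \<Longrightarrow> E x y \<Longrightarrow> E' (r x) (r y)"
    and irr: "\<And>x. \<not> E x x" and S: "multicolouring E' R w b S"
  shows "colourable E W b"
proof -
  have "\<exists>g. g ` {x \<in> W. r x = v} \<subseteq> S v \<and> inj_on g {x \<in> W. r x = v}" if v: "v \<in> R" for v
  proof (rule card_le_inj)
    show "finite {x \<in> W. r x = v}" using assms(1) by simp
    show "finite (S v)" using S v unfolding multicolouring_def by (meson finite_lessThan finite_subset)
    have "w v \<le> card (S v)" using S v by (simp add: multicolouring_def)
    then show "card {x \<in> W. r x = v} \<le> card (S v)" unfolding cl[OF v] .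
  qed
  then obtain g where g: "g v ` {x \<in> W. r x = v} \<subseteq> S v" "inj_on (g v) {x \<in> W. r x = v}"
    if "v \<in> R" for v by metis
  define c where "c x = g (r x) x" for x
  have cS: "c x \<in> S (r x)" if "x \<in> W" for x using g(1)[OF r[OF that]] that by (auto simp: c_def)
  have "c ` W \<subseteq> {..<b}" using cS r S unfolding multicolouring_def by blast
  moreover have "c x \<noteq> c y" if xy: "x \<in> W" "y \<in> W" "E x y" for x y
  proof (cases "r x = r y")
    case True
    have "x \<noteq> y" using irr xy(3) by blast
    then show ?thesis using g(2)[OF r[OF xy(1)]] xy True unfolding c_def inj_on_def by auto
  next
    case False
    then have "S (r x) \<inter> S (r y) = {}" using adj xy S by (auto simp: multicolouring_def)
    then show ?thesis using cS xy by fastforce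
  qed
  ultimately show ?thesis unfolding colourable_def by blast
qed

context girth5 begin

lemma satellite_position_unique:
  assumes "P7_free E" "hole E 7 c" "satellite c y k" "satellite c y l" shows "7 dvd k - l"
proof -
  have "E y (c l)" "E y (c (l + 3))" using assms(4) by (auto simp: satellite_def)
  then have "7 dvd l - k \<or> 7 dvd l - k - 3" "7 dvd l + 3 - k \<or> 7 dvd l + 3 - k - 3"
    using satellite_nbrs[OF assms(1-3)] by blast+
  then show ?thesis by presburger
qed

text \<open>
More than \<open>2 m\<close> colours leave one for every satellite, which has two neighbours on the hole. A remote
vertex then avoids at most two colours, as it has at most two neighbours.
\<close>

lemma C7_multicolouring:
  assumes P7: "P7_free E" and h: "hole E 7 c"
    and w: "\<And>i. w (c i) = m" and ws: "\<And>y k. satellite c y k \<Longrightarrow> w y \<le> 1"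
    and wr: "\<And>z. remote c z \<Longrightarrow> z \<in> V \<Longrightarrow> w z + 1 \<le> 2 * m"
    and m: "1 \<le> m" "m \<le> 3 * r"
  shows "\<exists>S. multicolouring E V w (2 * m + r) S"
proof -
  define b where "b = 2 * m + r"
  have b: "2 * m + 1 \<le> b" using m by (simp add: b_def)
  have seven: "int (2 * 3 + 1) = 7" by simp
  obtain F :: "int \<Rightarrow> nat set" where F: "\<And>i. F i \<subseteq> {..<b}" "\<And>i. card (F i) = m"
    "\<And>i j. 7 dvd i - j \<Longrightarrow> F i = F j" "\<And>i j. 7 dvd i - j - 1 \<Longrightarrow> F i \<inter> F j = {}"
    using odd_cycle_palette[OF m(2)] unfolding seven b_def by blast
  have finF: "finite (F i)" for i using F(1) finite_subset by blast
  have "\<exists>a. a < b \<and> (\<forall>k. satellite c y k \<longrightarrow> a \<notin> F k \<union> F (k + 3))" for y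
  proof (cases "\<exists>k. satellite c y k")
    case True
    then obtain k where k: "satellite c y k" by blast
    have "card (F k \<union> F (k + 3)) \<le> 2 * m" using card_Un_le[of "F k" "F (k + 3)"] F(2) by simp
    then have "card (F k \<union> F (k + 3)) < card {..<b}" using b by simp
    then have "\<not> {..<b} \<subseteq> F k \<union> F (k + 3)" using card_mono finF by (metis finite_UnI not_le)
    then obtain a where a: "a < b" "a \<notin> F k \<union> F (k + 3)" by blast
    have "F l = F k" "F (l + 3) = F (k + 3)" if "satellite c y l" for l
      using satellite_position_unique[OF P7 h that k] by (auto intro!: F(3))
    then show ?thesis using a by metis
  next
    case False
    then show ?thesis using b by (intro exI[of _ 0]) auto
  qed
  then obtain A where A: "\<And>y. A y < b" "\<And>y k. satellite c y k \<Longrightarrow> A y \<notin> F k \<union> F (k + 3)"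
    by metis
  define ix where "ix v = (SOME i. v = c i)" for v
  have ix: "v = c (ix v)" if "v \<in> range c" for v
    unfolding ix_def by (rule someI_ex) (use that in auto)
  define S where "S v = (if v \<in> range c then F (ix v) else if remote c v then {..<b} - A ` {y. E v y}
    else {A v})" for v
  have S_hole: "S (c i) = F i" for i
  proof -
    have "7 dvd ix (c i) - i" using ix[of "c i"] hole_eq[OF h, of "ix (c i)" i] by simp
    then show ?thesis using F(3) by (simp add: S_def)
  qed
  have S_sat: "S y = {A y}" if "satellite c y k" for y k
    using that by (auto simp: S_def satellite_def remote_def)
  have S_rem: "S z = {..<b} - A ` {y. E z y}" if "remote c z" for z
    using that by (simp add: S_def remote_def)
  have hole_hole: "F i \<inter> F j = {}" if "E (c i) (c j)" for i j
  proof -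
    have "7 dvd i - j - 1 \<or> 7 dvd j - i - 1" using that unfolding hole_adj[OF h] by presburger
    then show ?thesis using F(4)[of i j] F(4)[of j i] by blast
  qed
  have sat_hole: "A y \<notin> F i" if "satellite c y k" "E y (c i)" for y k i
  proof -
    have "7 dvd i - k \<or> 7 dvd i - (k + 3)"
      using satellite_nbrs[OF P7 h that(1), of i] that(2) by (simp add: algebra_simps)
    then have "F i = F k \<or> F i = F (k + 3)" using F(3) by blast
    then show ?thesis using A(2)[OF that(1)] by auto
  qed
  have "multicolouring E V w b S"
    unfolding multicolouring_def
  proof (intro conjI ballI allI impI)
    fix v assume "v \<in> V"
    then have "S v \<subseteq> {..<b} \<and> w v \<le> card (S v)"
    proof (cases rule: C7_structure[OF P7 h, consumes 1, case_names on_hole satellite remote])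
      case (on_hole i) then show ?thesis using S_hole F(1,2) w by simp
    next
      case (satellite k) then show ?thesis using S_sat[OF satellite] A(1) ws[OF satellite] by simp
    next
      case (remote y k)
      have c2: "card {y. E v y} \<le> 2" using remote_nbrs_card[OF P7 h remote(1)] .
      have fin: "finite {y. E v y}"
        by (rule finite_subset[OF _ finite_V]) (use in_V sym in blast)
      have "card (A ` {y. E v y}) \<le> 2" using c2 card_image_le[OF fin, of A] by linarith
      moreover have "b - card (A ` {y. E v y}) \<le> card (S v)"
        using diff_card_le_card_Diff[of "A ` {y. E v y}" "{..<b}"] fin S_rem[OF remote(1)] by simp
      ultimately have "b - 2 \<le> card (S v)" by linarith
      then show ?thesis using S_rem[OF remote(1)] wr[OF remote(1) \<open>v \<in> V\<close>] b by auto
    qed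
    then show "S v \<subseteq> {..<b}" "w v \<le> card (S v)" by blast+
  next
    fix u v assume uv: "E u v"
    have V: "u \<in> V" "v \<in> V" using uv in_V sym by blast+
    have rem: "S x \<inter> S y = {}" if xy: "remote c x" "E x y" for x y
    proof -
      obtain k where "satellite c y k" using remote_nbr[OF P7 h xy] by blast
      then show ?thesis using S_sat S_rem[OF xy(1)] xy(2) by auto
    qed
    have sh: "S x \<inter> S (c i) = {}" if "satellite c x k" "E x (c i)" for x k i
      using S_sat[OF that(1)] S_hole sat_hole[OF that] by auto
    from V(1) show "S u \<inter> S v = {}"
    proof (cases rule: C7_structure[OF P7 h, consumes 1, case_names on_hole satellite remote])
      case u: (on_hole i)
      from V(2) show ?thesis
      proof (cases rule: C7_structure[OF P7 h, consumes 1, case_names on_hole satellite remote])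
        case (on_hole j) then show ?thesis using u uv S_hole hole_hole by metis
      next
        case (satellite k) then show ?thesis using u sh[OF satellite] sym[OF uv] by (metis Int_commute)
      next
        case remote then show ?thesis using rem sym[OF uv] by (metis Int_commute)
      qed
    next
      case u: (satellite k)
      from V(2) show ?thesis
      proof (cases rule: C7_structure[OF P7 h, consumes 1, case_names on_hole satellite remote])
        case (on_hole j) then show ?thesis using sh[OF u] uv by metis
      next
        case (satellite l) then show ?thesis using satellites_nonadjacent[OF P7 h u satellite] uv by blast
      next
        case remote then show ?thesis using rem sym[OF uv] by (metis Int_commute)
      qed
    next
      case remote then show ?thesis using rem uv by blast
    qed
  qed
  then show ?thesis unfolding b_def by blast
qed

end

section \<open>Irreducible graphs as blowups\<close>

text \<open>
A graph to which neither reduction applies, given by an adjacency relation that may extend beyond its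
vertex set \<open>W\<close>.
\<close>

locale irreducible =
  fixes W :: "'a set" and E :: "'a \<Rightarrow> 'a \<Rightarrow> bool"
  assumes fin: "finite W" and nonempty: "W \<noteq> {}"
    and symE: "E u v \<Longrightarrow> E v u" and irreflE: "\<not> E u u"
    and C4E: "E a b \<Longrightarrow> E b c \<Longrightarrow> E c d \<Longrightarrow> E d a \<Longrightarrow> a \<noteq> c \<Longrightarrow> b \<noteq> d \<Longrightarrow> E a c \<or> E b d"
    and bullE: "E x y \<Longrightarrow> E y z \<Longrightarrow> E x z \<Longrightarrow> E x p \<Longrightarrow> E y q \<Longrightarrow>
      \<not> E p y \<Longrightarrow> \<not> E p z \<Longrightarrow> \<not> E q x \<Longrightarrow> \<not> E q z \<Longrightarrow> E p q"
    and atomW: "atom E W" and not_peelable: "\<not> peelable E W"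
begin

text \<open>
Closed neighbourhoods within \<open>W\<close>. Vertices are true twins if and only if these agree; every class of
twins is represented by one vertex, and \<open>E'\<close> is the adjacency of the representatives, restricted
to them.
\<close>

definition nbh :: "'a \<Rightarrow> 'a set" where "nbh x = insert x {y \<in> W. E x y}"

definition rep :: "'a \<Rightarrow> 'a" where "rep x = (SOME y. y \<in> W \<and> nbh y = nbh x)"

definition R :: "'a set" where "R = rep ` W"

definition weight :: "'a \<Rightarrow> nat" where "weight v = card {x \<in> W. rep x = v}"

definition E' :: "'a \<Rightarrow> 'a \<Rightarrow> bool" where "E' u v \<longleftrightarrow> E u v \<and> u \<in> R \<and> v \<in> R"

lemma rep: "x \<in> W \<Longrightarrow> rep x \<in> W" "x \<in> W \<Longrightarrow> nbh (rep x) = nbh x"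
  using someI[of "\<lambda>y. y \<in> W \<and> nbh y = nbh x" x] unfolding rep_def by blast+

lemma rep_eq_iff: "x \<in> W \<Longrightarrow> y \<in> W \<Longrightarrow> rep x = rep y \<longleftrightarrow> nbh x = nbh y"
proof -
  assume "x \<in> W" "y \<in> W"
  then have n: "nbh (rep x) = nbh x" "nbh (rep y) = nbh y" using rep(2) by auto
  show ?thesis
  proof
    assume "rep x = rep y" then show "nbh x = nbh y" using n by simp
  next
    assume "nbh x = nbh y" then show "rep x = rep y" unfolding rep_def by simp
  qed
qed

lemma rep_rep: "x \<in> W \<Longrightarrow> rep (rep x) = rep x"
  using rep_eq_iff[of "rep x" x] rep by blast

lemma R: "v \<in> R \<Longrightarrow> v \<in> W" "v \<in> R \<Longrightarrow> rep v = v" "x \<in> W \<Longrightarrow> rep x \<in> R"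
  using rep rep_rep by (auto simp: R_def)

lemma twin_adjacent: "x \<in> W \<Longrightarrow> y \<in> W \<Longrightarrow> rep x = rep y \<Longrightarrow> x \<noteq> y \<Longrightarrow> E x y"
  using rep_eq_iff[of x y] symE[of y x] by (auto simp: nbh_def)

lemma adjacent_transfer:
  assumes "x \<in> W" "y \<in> W" "x' \<in> W" "y' \<in> W" "rep x = rep x'" "rep y = rep y'" "rep x \<noteq> rep y" "E x y"
  shows "E x' y'"
proof -
  have n: "nbh x = nbh x'" "nbh y = nbh y'" using rep_eq_iff assms by blast+
  have "y \<in> nbh x" using assms by (simp add: nbh_def)
  then have "y \<in> nbh x'" using n by simp
  then have "E x' y" using assms by (auto simp: nbh_def)
  then have "x' \<in> nbh y" using symE assms by (simp add: nbh_def)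
  then have "x' \<in> nbh y'" using n by simp
  then show ?thesis using assms symE by (auto simp: nbh_def)
qed

lemma E'_rep: "x \<in> W \<Longrightarrow> y \<in> W \<Longrightarrow> rep x \<noteq> rep y \<Longrightarrow> E' (rep x) (rep y) \<longleftrightarrow> E x y"
  using adjacent_transfer[of x y "rep x" "rep y"] adjacent_transfer[of "rep x" "rep y" x y] rep R(3)
    rep_rep unfolding E'_def by metis

text \<open>
A universal vertex belongs to every maximum clique, so it could be peeled off.
\<close>

lemma no_universal_vertex:
  assumes u: "u \<in> W" shows "\<exists>x\<in>W. x \<noteq> u \<and> \<not> E u x"
proof (rule ccontr)
  assume "\<not> ?thesis"
  then have adj: "E u x" if "x \<in> W" "x \<noteq> u" for x using that by blast
  obtain K where K: "K \<subseteq> W - {u}" "pairwise E K" "card K = omega E (W - {u})"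
    by (rule omega_attained[of "W - {u}"]) (use fin in auto)
  have "pairwise E (insert u K)" using K(1,2) adj symE by (auto simp: pairwise_insert)
  then have "card (insert u K) \<le> omega E W" by (rule card_le_omega[OF fin, rotated]) (use u K in auto)
  moreover have "card (insert u K) = Suc (card K)"
    using K(1) finite_subset[of K W] fin by (subst card_insert_disjoint) auto
  ultimately have "omega E (W - {u}) < omega E W" using K(3) by simp
  then have "peelable E W" unfolding peelable_def using u by (intro exI[of _ "{u}"]) auto
  then show False using not_peelable by blast
qed

lemma atom_R: "atom E' R"
  unfolding atom_def
proof (intro allI impI)
  fix D assume D: "D \<subseteq> R" "D \<noteq> {}" "pairwise E' (boundary E' R D)"
  define D' where "D' = {x \<in> W. rep x \<in> D}"
  have bd: "rep x \<in> boundary E' R D" if x: "x \<in> boundary E W D'" for x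
  proof -
    obtain d where d: "x \<in> W" "rep x \<notin> D" "d \<in> W" "rep d \<in> D" "E d x"
      using x by (auto simp: boundary_def D'_def)
    then have "E' (rep d) (rep x)" using E'_rep[of d x] by metis
    then show ?thesis using d R(3) by (auto simp: boundary_def)
  qed
  have "D' \<union> boundary E W D' = W"
  proof (rule atomD[OF atomW])
    show "D' \<subseteq> W" by (auto simp: D'_def)
    obtain d where d: "d \<in> D" "d \<in> R" using D(1,2) by blast
    then have "d \<in> D'" using R(1,2)[of d] by (simp add: D'_def)
    then show "D' \<noteq> {}" by blast
    show "pairwise E (boundary E W D')"
      unfolding pairwise_def
    proof (intro ballI impI)
      fix x y assume xy: "x \<in> boundary E W D'" "y \<in> boundary E W D'" "x \<noteq> y"
      have W: "x \<in> W" "y \<in> W" using xy by (auto simp: boundary_def)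
      show "E x y"
      proof (cases "rep x = rep y")
        case True then show ?thesis using twin_adjacent W xy(3) by blast
      next
        case False
        then have "E' (rep x) (rep y)" using bd xy D(3) unfolding pairwise_def by blast
        then show ?thesis using E'_rep W False by blast
      qed
    qed
  qed
  then have all: "v \<in> D' \<or> v \<in> boundary E W D'" if "v \<in> W" for v using that by blast
  have "v \<in> D \<union> boundary E' R D" if "v \<in> R" for v
    using all[OF R(1)[OF that]] bd[of v] R(2)[OF that] by (auto simp: D'_def)
  then show "D \<union> boundary E' R D = R" using D(1) by (auto simp: boundary_def)
qed

sublocale reduced: c4_bull_free R E'
proof
  show "finite R" using fin by (simp add: R_def)
  show "E' v u" if "E' u v" for u v using that symE by (auto simp: E'_def)
  show "\<not> E' u u" for u using irreflE by (simp add: E'_def)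
  show "u \<in> R" if "E' u v" for u v using that by (simp add: E'_def)
  show "E' a c \<or> E' b d" if "E' a b" "E' b c" "E' c d" "E' d a" "a \<noteq> c" "b \<noteq> d" for a b c d
    using C4E[of a b c d] that by (auto simp: E'_def)
  show "E' p q" if "E' x y" "E' y z" "E' x z" "E' x p" "E' y q" "\<not> E' p y" "\<not> E' p z"
    "\<not> E' q x" "\<not> E' q z" for x y z p q
    using bullE[of x y z p q] that by (auto simp: E'_def)
qed

lemma no_twins: "\<not> reduced.twins u v"
proof
  assume t: "reduced.twins u v"
  then have uv: "E u v" "u \<in> R" "v \<in> R" by (auto simp: reduced.twins_def E'_def)
  have half: "nbh x \<subseteq> nbh y" if t: "reduced.twins x y" "x \<in> R" "y \<in> R" "E x y" for x y
  proof
    fix z assume z: "z \<in> nbh x"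
    show "z \<in> nbh y"
    proof (cases "z = x \<or> z = y")
      case True then show ?thesis using t R symE by (auto simp: nbh_def)
    next
      case False
      then have zW: "z \<in> W" "E x z" using z by (auto simp: nbh_def)
      have xy: "x \<in> W" "y \<in> W" "rep x = x" "rep y = y" using t R by blast+
      show ?thesis
      proof (cases "rep z = x \<or> rep z = y")
        case True
        then have "nbh z = nbh x \<or> nbh z = nbh y" using rep_eq_iff[of z] xy zW by metis
        then show ?thesis
        proof
          assume "nbh z = nbh x"
          moreover have "y \<in> nbh x" using t(4) xy by (simp add: nbh_def)
          ultimately have "y \<in> nbh z" by simp
          then show ?thesis using zW symE by (auto simp: nbh_def)
        qed (auto simp: nbh_def)
      next
        case zr: False
        then have "E' x (rep z)" using E'_rep[of x z] xy zW by metis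
        then have "E' y (rep z)" using t(1) zr by (auto simp: reduced.twins_def)
        then show ?thesis using E'_rep[of y z] xy zW zr by (auto simp: nbh_def)
      qed
    qed
  qed
  have "reduced.twins v u" using t reduced.sym by (auto simp: reduced.twins_def)
  then have "nbh u = nbh v" using half[OF t uv(2,3,1)] half[of v u] uv symE by blast
  then have "rep u = rep v" using rep_eq_iff R uv by blast
  then have "u = v" using R uv by metis
  then show False using uv irreflE by blast
qed

lemma reduced_no_universal: "v \<in> R \<Longrightarrow> \<exists>x\<in>R. x \<noteq> v \<and> \<not> E' v x"
proof -
  assume v: "v \<in> R"
  then have vW: "v \<in> W" "rep v = v" using R by blast+
  obtain x where x: "x \<in> W" "x \<noteq> v" "\<not> E v x" using no_universal_vertex[OF vW(1)] by blast
  then have "rep x \<noteq> v" using twin_adjacent[of v x] vW by auto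
  moreover from this have "\<not> E' v (rep x)" using E'_rep[of v x] vW x by metis
  ultimately show ?thesis using R(3)[OF x(1)] by blast
qed

lemma reduced_triangle_free: "E' a b \<Longrightarrow> E' b c \<Longrightarrow> E' a c \<Longrightarrow> False"
  using reduced.twin_free_triangle_free[OF atom_R reduced_no_universal no_twins, of a b c] by blast

sublocale core: girth5 R E'
proof
  show "finite R" by (rule reduced.finite_V)
  show "False" if "E' a b" "E' b c" "E' a c" for a b c using reduced_triangle_free that .
  show "False" if "E' a b" "E' b c" "E' c d" "E' d a" "a \<noteq> c" "b \<noteq> d" for a b c d
    using reduced.no_C4[of a b c d] reduced_triangle_free[of a b c] reduced_triangle_free[of b c d] that
    by blast
qed (use reduced.sym reduced.in_V atom_R in auto)

end

context irreducible begin

lemma weight_pos: "v \<in> R \<Longrightarrow> 1 \<le> weight v"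
  using R[of v] fin by (auto simp: weight_def Suc_le_eq card_gt_0_iff)

lemma classes_clique:
  assumes "pairwise E' T" "T \<subseteq> R"
  shows "pairwise E {x \<in> W. rep x \<in> T}"
  unfolding pairwise_def
proof (intro ballI impI)
  fix x y assume xy: "x \<in> {x \<in> W. rep x \<in> T}" "y \<in> {x \<in> W. rep x \<in> T}" "x \<noteq> y"
  show "E x y"
  proof (cases "rep x = rep y")
    case True then show ?thesis using twin_adjacent xy by blast
  next
    case False
    then have "E' (rep x) (rep y)" using xy assms(1) by (auto simp: pairwise_def)
    then show ?thesis using E'_rep False xy by blast
  qed
qed

lemma card_classes: "finite T \<Longrightarrow> card {x \<in> W. rep x \<in> T} = (\<Sum>v\<in>T. weight v)"
proof -
  assume T: "finite T"
  have "{x \<in> W. rep x \<in> T} = (\<Union>v\<in>T. {x \<in> W. rep x = v})" by auto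
  also have "card \<dots> = (\<Sum>v\<in>T. card {x \<in> W. rep x = v})"
    by (rule card_UN_disjoint) (use T fin in auto)
  finally show ?thesis by (simp add: weight_def)
qed

lemma weight_le_omega: "v \<in> R \<Longrightarrow> weight v \<le> omega E W"
  using card_le_omega[OF fin _ classes_clique[of "{v}"]] card_classes[of "{v}"] by auto

lemma weight_edge_le_omega:
  assumes "E' u v" shows "weight u + weight v \<le> omega E W"
proof -
  have uv: "u \<in> R" "v \<in> R" "u \<noteq> v" "E' v u"
    using assms core.in_V core.sym core.irrefl by blast+
  then have "pairwise E' {u, v}" using assms by (auto simp: pairwise_insert)
  then have "card {x \<in> W. rep x \<in> {u, v}} \<le> omega E W"
    using card_le_omega[OF fin _ classes_clique[of "{u, v}"]] uv by auto
  moreover have "card {x \<in> W. rep x \<in> {u, v}} = weight u + weight v"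
    using card_classes[of "{u, v}"] uv(3) by simp
  ultimately show ?thesis by simp
qed

text \<open>
A maximum clique is a union of classes of twins.
\<close>

lemma maximum_clique_hits:
  assumes K: "K \<subseteq> W" "pairwise E K" "card K = omega E W" and S: "v \<in> rep ` K"
  shows "v \<in> K"
proof (rule ccontr)
  assume v: "v \<notin> K"
  obtain x where x: "x \<in> K" "v = rep x" using S by blast
  have vW: "v \<in> W" "rep v = rep x" "x \<in> W" using x K(1) rep rep_rep by auto
  have "E v y" if y: "y \<in> K" for y
  proof (cases "rep y = rep x")
    case True
    then show ?thesis using twin_adjacent[of v y] vW y v K(1) by auto
  next
    case False
    then have "E y x" using K(2) x(1) y by (metis pairwise_def)
    then show ?thesis using adjacent_transfer[of x y v y] symE vW y K(1) False by auto
  qed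
  then have "pairwise E (insert v K)" using K(2) symE by (auto simp: pairwise_insert)
  then have "card (insert v K) \<le> omega E W" using card_le_omega[OF fin] K(1) vW by simp
  then show False using K(1,3) v fin finite_subset by fastforce
qed

text \<open>
If the graph \<open>F\<close> on the representatives of weight \<open>\<omega>/2\<close> had a two-colouring \<open>f\<close>, then one side of it
together with the heavier representatives would be a stable set \<open>S\<close> meeting every maximum clique: such a
clique covers one class or two adjacent classes, and two vertices of total weight at least \<open>\<omega>\<close> are both of weight \<open>\<omega>/2\<close>
unless one is heavier.
\<close>

lemma balanced_odd_hole:
  "\<exists>n c m. odd n \<and> hole E' n c \<and> omega E W = 2 * m \<and> (\<forall>i. weight (c i) = m)"
proof -
  let ?o = "omega E W"
  define F where "F u v \<longleftrightarrow> E' u v \<and> 2 * weight u = ?o \<and> 2 * weight v = ?o" for u v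
  have "\<not> (\<exists>f::'a \<Rightarrow> bool. \<forall>u v. F u v \<longrightarrow> f u \<noteq> f v)"
  proof
    assume "\<exists>f::'a \<Rightarrow> bool. \<forall>u v. F u v \<longrightarrow> f u \<noteq> f v"
    then obtain f :: "'a \<Rightarrow> bool" where f: "\<And>u v. F u v \<Longrightarrow> f u \<noteq> f v" by blast
    define S where "S = {v \<in> R. 2 * weight v > ?o \<or> 2 * weight v = ?o \<and> f v}"
    have "\<not> E u v" if uv: "u \<in> S" "v \<in> S" for u v
    proof
      assume "E u v"
      then have e: "E' u v" using uv by (auto simp: E'_def S_def)
      then have "2 * weight u = ?o" "2 * weight v = ?o" "f u" "f v"
        using weight_edge_le_omega[OF e] uv by (auto simp: S_def)
      then show False using f[of u v] e by (simp add: F_def)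
    qed
    then have stable: "pairwise (\<lambda>u v. \<not> E u v) S" by (simp add: pairwise_def)
    have SW: "S \<subseteq> W" using R by (auto simp: S_def)
    have "omega E (W - S) < ?o"
    proof (rule ccontr)
      assume n: "\<not> ?thesis"
      obtain K where K: "K \<subseteq> W - S" "pairwise E K" "card K = omega E (W - S)"
        by (rule omega_attained[of "W - S"]) (use fin in auto)
      have "omega E (W - S) = ?o" using n omega_mono[OF fin, of "W - S" E] by auto
      then have Ko: "card K = ?o" using K(3) by simp
      have KW: "K \<subseteq> W" using K(1) by blast
      obtain x0 where "x0 \<in> W" using nonempty by blast
      then have "1 \<le> ?o" using card_le_omega[OF fin, of "{x0}" E] by simp
      then have "K \<noteq> {}" using Ko by auto
      then obtain x where x: "x \<in> K" by blast
      have KS: "card K \<le> (\<Sum>v\<in>rep ` K. weight v)"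
      proof -
        have "K \<subseteq> {x \<in> W. rep x \<in> rep ` K}" using KW by blast
        then have "card K \<le> card {x \<in> W. rep x \<in> rep ` K}" using fin by (intro card_mono) auto
        then show ?thesis using card_classes[of "rep ` K"] finite_subset[OF KW fin] by simp
      qed
      have hit: "rep y \<notin> S" if "y \<in> K" for y
        using maximum_clique_hits[OF KW K(2) Ko, of "rep y"] that K(1) by blast
      have clq: "E' (rep y) (rep z)" if "y \<in> K" "z \<in> K" "rep y \<noteq> rep z" for y z
        using that E'_rep[of y z] K(2) KW by (metis pairwise_def subsetD)
      show False
      proof (cases "\<exists>y\<in>K. rep y \<noteq> rep x")
        case False
        then have "rep ` K = {rep x}" using x by blast
        then have "?o \<le> weight (rep x)" using KS Ko by simp
        then have "rep x \<in> S" using \<open>1 \<le> ?o\<close> R(3) x KW by (auto simp: S_def)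
        then show False using hit x by blast
      next
        case True
        then obtain y where y: "y \<in> K" "rep y \<noteq> rep x" by blast
        have "rep z = rep x \<or> rep z = rep y" if z: "z \<in> K" for z
          using reduced_triangle_free[of "rep x" "rep y" "rep z"] clq x y z by metis
        then have "rep ` K = {rep x, rep y}" using x y by blast
        then have sum: "?o \<le> weight (rep x) + weight (rep y)" using KS Ko y(2) by simp
        have e: "E' (rep x) (rep y)" using clq x y by metis
        have nS: "rep x \<notin> S" "rep y \<notin> S" using hit x y by blast+
        have RR: "rep x \<in> R" "rep y \<in> R" using R(3) x y KW by blast+
        have "2 * weight (rep x) \<le> ?o" "2 * weight (rep y) \<le> ?o" using nS RR by (auto simp: S_def)
        then have "2 * weight (rep x) = ?o" "2 * weight (rep y) = ?o" using sum by linarith+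
        then have "f (rep x) \<noteq> f (rep y)" "\<not> f (rep x)" "\<not> f (rep y)"
          using f e nS RR by (auto simp: F_def S_def)
        then show False by blast
      qed
    qed
    then have "peelable E W" using stable SW unfolding peelable_def by blast
    then show False using not_peelable by blast
  qed
  moreover have "(\<exists>f::'a \<Rightarrow> bool. \<forall>u v. F u v \<longrightarrow> f u \<noteq> f v) \<or> (\<exists>n c. odd n \<and> hole F n c)"
    by (rule bipartite_or_odd_hole) (use core.sym core.no_tri in \<open>auto simp: F_def\<close>)
  ultimately obtain n c where nc: "odd n" "hole F n c" by blast
  have wt: "2 * weight (c i) = ?o" for i
  proof -
    have "F (c i) (c (i + 1))" using hole_near[OF nc(2), of i "i + 1"] hole_len[OF nc(2)] by simp
    then show ?thesis by (simp add: F_def)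
  qed
  have "F (c i) (c j) \<longleftrightarrow> E' (c i) (c j)" for i j using wt by (simp add: F_def)
  then have "hole E' n c" using nc(2) by (simp add: hole_def)
  moreover have "?o = 2 * weight (c 0)" using wt[of 0] by simp
  moreover have "weight (c i) = weight (c 0)" for i using wt[of 0] wt[of i] by linarith
  ultimately show ?thesis using nc(1) by blast
qed

lemma colourable_if_reduced_multicolouring:
  "multicolouring E' R weight b S \<Longrightarrow> colourable E W b"
  by (rule colourable_if_multicolouring[where r = rep and w = weight and R = R and E' = E'])
    (use fin R E'_rep irreflE in \<open>auto simp: weight_def\<close>)

lemma colourable_if_petersen:
  assumes "petersen_hom E' R T" "omega E W = 2 * m"
  shows "colourable E W (2 * m + (m + 1) div 2)"
proof -
  have "\<exists>S. multicolouring E' R weight (2 * m + (m + 1) div 2) S"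
    by (rule multicolouring_if_petersen_hom[OF assms(1)])
      (use core.sym core.in_V weight_edge_le_omega weight_le_omega assms(2) in force)+
  then show ?thesis using colourable_if_reduced_multicolouring by blast
qed

lemma P7_free_reduced:
  assumes "P7_free E" shows "P7_free E'"
  unfolding P7_free_def
proof (intro notI, elim exE conjE)
  fix a b c d e f g
  assume p: "E' a b" "E' b c" "E' c d" "E' d e" "E' e f" "E' f g"
  then have "a \<in> R" "b \<in> R" "c \<in> R" "d \<in> R" "e \<in> R" "f \<in> R" "g \<in> R"
    by (auto simp: E'_def)
  moreover assume "\<not> E' a c" "\<not> E' a d" "\<not> E' a e" "\<not> E' a f" "\<not> E' a g" "\<not> E' b d" "\<not> E' b e"
    "\<not> E' b f" "\<not> E' b g" "\<not> E' c e" "\<not> E' c f" "\<not> E' c g" "\<not> E' d f" "\<not> E' d g" "\<not> E' e g"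
  ultimately show False
    using p
    by - (rule notE[OF assms[unfolded P7_free_def]], rule exI[of _ a], rule exI[of _ b],
      rule exI[of _ c], rule exI[of _ d], rule exI[of _ e], rule exI[of _ f], rule exI[of _ g],
      simp add: E'_def)
qed

lemma fork_free_reduced:
  assumes "fork_free E" shows "fork_free E'"
  unfolding fork_free_def
proof (intro notI, elim exE conjE)
  fix x l l' p q r
  assume f: "E' x l" "E' x l'" "l \<noteq> l'" "E' x p" "E' p q" "E' q r"
  then have "x \<in> R" "l \<in> R" "l' \<in> R" "p \<in> R" "q \<in> R" "r \<in> R" by (auto simp: E'_def)
  moreover assume "\<not> E' x q" "\<not> E' x r" "\<not> E' p r" "\<not> E' l l'" "\<not> E' l p" "\<not> E' l q" "\<not> E' l r"
    "\<not> E' l' p" "\<not> E' l' q" "\<not> E' l' r"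
  ultimately show False
    using f
    by - (rule notE[OF assms[unfolded fork_free_def]], rule exI[of _ x], rule exI[of _ l],
      rule exI[of _ l'], rule exI[of _ p], rule exI[of _ q], rule exI[of _ r], simp add: E'_def)
qed

text \<open>
The forms in which the excluded blowups \<open>C\<^sub>5\<^sup>2\<close> and \<open>C\<^sub>7\<^sup>4\<close> enter the argument.
\<close>

definition thin_C5 :: bool where
  "thin_C5 \<longleftrightarrow> (\<forall>c. hole E' 5 c \<longrightarrow> (\<exists>i. weight (c i) \<le> 1))"

definition thin_C7 :: bool where
  "thin_C7 \<longleftrightarrow> (\<forall>c. hole E' 7 c \<longrightarrow> (\<exists>i. weight (c i) \<le> 3))"

lemma P7_free_hole_length:
  assumes "P7_free E'" "hole E' n c" shows "n \<le> 7"
proof (rule ccontr)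
  assume "\<not> ?thesis"
  then have near: "c i = c j \<longleftrightarrow> i = j" "E' (c i) (c j) \<longleftrightarrow> i = j + 1 \<or> j = i + 1"
    if "\<bar>i - j\<bar> \<le> 6" for i j
    using hole_near[OF assms(2), of i j] that by auto
  show False
    by (rule core.no_P7[OF assms(1), of "c 0" "c 1" "c 2" "c 3" "c 4" "c 5" "c 6"])
      (simp_all add: near)
qed

text \<open>
A satellite closes a hole of length five with four vertices of the seven-hole, all of weight
\<open>m \<ge> 2\<close>, so it is the thin vertex itself.
\<close>

lemma hole_nbr_C7_weights:
  assumes P7: "P7_free E'" and h: "hole E' 7 c" and w: "\<And>i. weight (c i) = m" and m: "2 \<le> m"
    and o: "omega E W = 2 * m" and thin: thin_C5
  shows "\<And>y k. core.satellite c y k \<Longrightarrow> weight y \<le> 1"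
    and "\<And>z. core.remote c z \<Longrightarrow> z \<in> R \<Longrightarrow> weight z + 1 \<le> 2 * m"
proof -
  show "weight y \<le> 1" if y: "core.satellite c y k" for y k
  proof -
    have yn: "E' y (c j) \<longleftrightarrow> 7 dvd j - k \<or> 7 dvd j - k - 3" for j
      using core.satellite_nbrs[OF P7 h y] .
    have ne: "y \<noteq> c j" for j using y by (auto simp: core.satellite_def)
    let ?f = "\<lambda>i. [y, c k, c (k + 1), c (k + 2), c (k + 3)] ! i"
    have "hole E' (int 5) (\<lambda>i. ?f (nat (i mod int 5)))"
    proof (rule hole_if_cyclic)
      show "?f i \<noteq> ?f j" if "i < j" "j < 5" for i j
      proof -
        have "i \<in> {0,1,2,3}" "j \<in> {1,2,3,4}" using that by auto
        then show ?thesis using that ne by (elim insertE emptyE) (auto simp: hole_eq[OF h])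
      qed
      show "E' (?f i) (?f j) \<longleftrightarrow> j = Suc i \<or> i = 0 \<and> Suc j = 5" if "i < j" "j < 5" for i j
      proof -
        have "i \<in> {0,1,2,3}" "j \<in> {1,2,3,4}" using that by auto
        then show ?thesis using that by (elim insertE emptyE) (auto simp: hole_adj[OF h] yn)
      qed
    qed (use core.sym core.irrefl in auto)
    then obtain i where i: "weight (?f (nat (i mod 5))) \<le> 1"
      using thin unfolding thin_C5_def by auto
    have "nat (i mod 5) \<in> {0,1,2,3,4}" using pos_mod_bound[of 5 i] pos_mod_sign[of 5 i] by auto
    then show ?thesis using i w m by (elim insertE emptyE) auto
  qed
  show "weight z + 1 \<le> 2 * m" if z: "core.remote c z" "z \<in> R" for z
  proof -
    from z(2) have "\<exists>y. E' z y"
    proof (cases rule: core.C7_structure[OF P7 h, consumes 1, case_names on_hole satellite remote])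
      case (on_hole i) then show ?thesis using z(1) by (simp add: core.remote_def)
    next
      case (satellite k) then show ?thesis by (auto simp: core.satellite_def)
    next
      case (remote y k) then show ?thesis by blast
    qed
    then obtain y where y: "E' z y" by blast
    then have "weight z + weight y \<le> 2 * m" using weight_edge_le_omega o by metis
    moreover have "1 \<le> weight y" using weight_pos core.in_V core.sym y by blast
    ultimately show ?thesis by simp
  qed
qed

text \<open>
The odd hole has length five or seven. With thin five-holes, length five means \<open>m = 1\<close>, where the three
expressions coincide.
\<close>

lemma P7_free_bounds:
  assumes P7: "P7_free E"
  shows "\<exists>m. omega E W = 2 * m \<and> colourable E W (2 * m + (m + 1) div 2) \<and>
    (thin_C5 \<longrightarrow> colourable E W (2 * m + (m + 2) div 3)) \<and>
    (thin_C5 \<longrightarrow> thin_C7 \<longrightarrow> colourable E W (2 * m + 1))"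
proof -
  have P7': "P7_free E'" using P7 by (rule P7_free_reduced)
  obtain n c m where h: "odd n" "hole E' n c" and o: "omega E W = 2 * m" and w: "\<And>i. weight (c i) = m"
    using balanced_odd_hole by blast
  have n: "n = 5 \<or> n = 7"
    using hole_len[OF h(2)] P7_free_hole_length[OF P7' h(2)] h(1) by presburger
  have m1: "1 \<le> m" using weight_pos[OF core.hole_in_V[OF h(2)], of 0] w by simp
  have "\<exists>T. petersen_hom E' R T"
  proof (cases "\<exists>c. hole E' 7 c")
    case True then show ?thesis using core.C7_petersen_hom[OF P7'] by blast
  next
    case False
    then have "hole E' 5 c" using n h(2) by auto
    then show ?thesis using core.C5_petersen_hom P7' False by blast
  qed
  then have c1: "colourable E W (2 * m + (m + 1) div 2)" using colourable_if_petersen o by blast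
  have c2: "colourable E W (2 * m + (m + 2) div 3)" if thin: thin_C5
  proof (cases "m = 1")
    case True then show ?thesis using c1 by simp
  next
    case False
    then have m2: "2 \<le> m" using m1 by simp
    have h7: "hole E' 7 c"
    proof (rule ccontr)
      assume "\<not> ?thesis"
      then have "hole E' 5 c" using n h(2) by auto
      then show False using thin w m2 unfolding thin_C5_def by fastforce
    qed
    have "\<exists>S. multicolouring E' R weight (2 * m + (m + 2) div 3) S"
    proof (rule core.C7_multicolouring[where c = c])
      show "weight (c i) = m" for i by (rule w)
      show "weight y \<le> 1" if "core.satellite c y k" for y k
        by (rule hole_nbr_C7_weights(1)[OF P7' h7 w m2 o thin that])
      show "weight z + 1 \<le> 2 * m" if "core.remote c z" "z \<in> R" for z
        by (rule hole_nbr_C7_weights(2)[OF P7' h7 w m2 o thin that])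
    qed (use P7' h7 m1 in auto)
    then show ?thesis using colourable_if_reduced_multicolouring by blast
  qed
  have c3: "colourable E W (2 * m + 1)" if thin: thin_C5 thin_C7
  proof -
    have "m \<le> 3"
    proof (rule ccontr)
      assume m3: "\<not> ?thesis"
      from n show False
      proof
        assume "n = 5" then show False using thin(1) h(2) w m3 unfolding thin_C5_def by fastforce
      next
        assume "n = 7" then show False using thin(2) h(2) w m3 unfolding thin_C7_def by fastforce
      qed
    qed
    then have "(m + 2) div 3 = 1" using m1 by linarith
    then show ?thesis using c2[OF thin(1)] by simp
  qed
  show ?thesis using o c1 c2 c3 by blast
qed

text \<open>
A long hole is the whole graph of representatives. The last bound with \<open>k = 3\<close> needs \<open>m \<le> 3\<close>, which holds
if seven-holes are thin.
\<close>

lemma fork_free_bounds: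
  assumes ff: "fork_free E"
  shows "\<exists>m. omega E W = 2 * m \<and> colourable E W (2 * m + (m + 1) div 2) \<and>
    (thin_C5 \<longrightarrow> colourable E W (2 * m + (m + 2) div 3)) \<and>
    (thin_C5 \<longrightarrow> thin_C7 \<longrightarrow> colourable E W (2 * m + (m + 3) div 4))"
proof -
  have ff': "fork_free E'" using ff by (rule fork_free_reduced)
  obtain n c m where h: "odd n" "hole E' n c" and o: "omega E W = 2 * m" and w: "\<And>i. weight (c i) = m"
    using balanced_odd_hole by blast
  have n5: "n \<ge> 5" by (rule hole_len[OF h(2)])
  have m1: "1 \<le> m" using weight_pos[OF core.hole_in_V[OF h(2)], of 0] w by simp
  show ?thesis
  proof (cases "n = 5")
    case True
    then have h5: "hole E' 5 c" using h(2) by simp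
    then have "\<exists>T. petersen_hom E' R T" using core.C5_petersen_hom ff' by blast
    then have c1: "colourable E W (2 * m + (m + 1) div 2)" using colourable_if_petersen o by blast
    have "m = 1" if thin_C5 using that h5 w m1 unfolding thin_C5_def by (metis le_antisym)
    then show ?thesis using o c1 by (intro exI[of _ m]) auto
  next
    case False
    then have n7: "n \<ge> 7" using n5 h(1) by presburger
    obtain q where q: "n = 2 * q + 1" using h(1) by (rule oddE)
    define k where "k = nat q"
    have k: "n = int (2 * k + 1)" "3 \<le> k" using n7 q by (auto simp: k_def)
    have V: "R = range c" using core.fork_free_long_hole[OF ff' h(2) n7] by simp
    have col: "colourable E W (2 * m + r)" if "m \<le> k * r" for r
    proof -
      have "\<exists>S. multicolouring E' R weight (2 * m + r) S"
        by (rule multicolouring_odd_cycle[OF h(2)[unfolded k(1)] V _ _ that])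
          (use w V in \<open>auto simp: E'_def\<close>)
      then show ?thesis using colourable_if_reduced_multicolouring by blast
    qed
    have three: "3 * r \<le> k * r" for r using k(2) by simp
    have 1: "m \<le> k * ((m + 1) div 2)" using three[of "(m + 1) div 2"] by linarith
    have 2: "m \<le> k * ((m + 2) div 3)" using three[of "(m + 2) div 3"] by linarith
    have 3: "m \<le> k * ((m + 3) div 4)" if thin_C7
    proof (cases "k = 3")
      case True
      then have "hole E' 7 c" using h(2) k(1) by simp
      then have "m \<le> 3" using that w unfolding thin_C7_def by metis
      then show ?thesis unfolding True using m1 by linarith
    next
      case False
      then have "4 * ((m + 3) div 4) \<le> k * ((m + 3) div 4)" using k(2) by (intro mult_le_mono1) simp
      then show ?thesis by linarith
    qed
    show ?thesis using o col[OF 1] col[OF 2] col[OF 3] by blast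
  qed
qed

end

section \<open>Adjacency relations of graphs with forbidden induced subgraphs\<close>

lemma free_ofD:
  assumes "free_of \<H> G" "H \<in> \<H>" "inj_on f (verts H)" "f ` verts H \<subseteq> verts G"
    and adj: "\<And>u v. u \<in> verts H \<Longrightarrow> v \<in> verts H \<Longrightarrow> adjacent G (f u) (f v) \<longleftrightarrow> adjacent H u v"
  shows False
proof -
  define W where "W = f ` verts H"
  define g where "g = the_inv_into (verts H) f"
  have gf: "g (f u) = u" if "u \<in> verts H" for u
    using assms(3) that by (simp add: g_def the_inv_into_f_f)
  have "isomorphic (induced_subgraph G W) H"
    unfolding isomorphic_def
  proof (intro exI[of _ g] conjI ballI)
    show "bij_betw g (verts (induced_subgraph G W)) (verts H)"
      using bij_betw_the_inv_into[of f "verts H" W] assms(3)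
      by (simp add: W_def g_def induced_subgraph_def bij_betw_def)
    fix x y assume "x \<in> verts (induced_subgraph G W)" "y \<in> verts (induced_subgraph G W)"
    then obtain u v where "u \<in> verts H" "v \<in> verts H" "x = f u" "y = f v"
      by (auto simp: induced_subgraph_def W_def)
    then show "adjacent (induced_subgraph G W) x y \<longleftrightarrow> adjacent H (g x) (g y)"
      using adj gf by (auto simp: induced_subgraph_def W_def)
  qed
  then show False using assms(1,2,4) unfolding free_of_def W_def by blast
qed

lemma adjacent_path_graph: "adjacent (path_graph k) i j \<longleftrightarrow> i < k \<and> j < k \<and> (j = Suc i \<or> i = Suc j)"
  by (auto simp: path_graph_def doubleton_eq_iff)

lemma adjacent_cycle_graph:
  "adjacent (cycle_graph k) i j \<longleftrightarrow> i < k \<and> j = Suc i mod k \<or> j < k \<and> i = Suc j mod k"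
  by (auto simp: cycle_graph_def doubleton_eq_iff)

lemma adjacent_clique_blowup:
  "adjacent (clique_blowup F k) (u, i) (v, j) \<longleftrightarrow>
     u \<in> verts F \<and> v \<in> verts F \<and> i < k \<and> j < k \<and> (u = v \<and> i \<noteq> j \<or> adjacent F u v)"
  by (auto simp: clique_blowup_def doubleton_eq_iff insert_commute)

context
  fixes G :: "'a ugraph"
  assumes G: "simple_graph G"
begin

lemma adjacent_sym: "adjacent G u v \<Longrightarrow> adjacent G v u"
  by (simp add: insert_commute)

lemma adjacent_irrefl: "\<not> adjacent G u u"
  using G by (fastforce simp: simple_graph_def)

lemma adjacent_verts: "adjacent G u v \<Longrightarrow> u \<in> verts G" "adjacent G u v \<Longrightarrow> v \<in> verts G"
  using G by (auto simp: simple_graph_def)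

lemma clique_number_omega: "clique_number G = omega (adjacent G) (verts G)"
  by (simp add: clique_number_def omega_def clique_def pairwise_def)

lemma chromatic_number_le: "colourable (adjacent G) (verts G) k \<Longrightarrow> chromatic_number G \<le> k"
  unfolding chromatic_number_def colourable_def proper_colouring_def by (rule Least_le) blast

lemma free_of_listD:
  assumes free: "free_of \<H> G" "H \<in> \<H>" and V: "verts H = {..<length xs}"
    and xs: "distinct xs" "set xs \<subseteq> verts G"
    and H: "\<And>i j. adjacent H i j \<Longrightarrow> i \<noteq> j"
    and adj: "\<forall>j<length xs. \<forall>i<j. adjacent G (xs ! i) (xs ! j) \<longleftrightarrow> adjacent H i j"
  shows False
proof (rule free_ofD[OF free, of "(!) xs"])
  show "inj_on ((!) xs) (verts H)" using xs(1) V inj_on_nth by fastforce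
  show "(!) xs ` verts H \<subseteq> verts G" using xs(2) V by auto
  show "adjacent G (xs ! i) (xs ! j) \<longleftrightarrow> adjacent H i j" if "i \<in> verts H" "j \<in> verts H" for i j
  proof (cases i j rule: linorder_cases)
    case less then show ?thesis using adj that V by simp
  next
    case equal then show ?thesis using H adjacent_irrefl by blast
  next
    case greater
    then have "adjacent G (xs ! j) (xs ! i) \<longleftrightarrow> adjacent H j i" using adj that V by simp
    then show ?thesis by (simp add: insert_commute)
  qed
qed

lemma all_less_simps:
  "(\<forall>i<Suc n. P i) \<longleftrightarrow> P 0 \<and> (\<forall>i<n. P (Suc i))" "\<forall>i<0::nat. P i"
  by (simp_all add: All_less_Suc2)

lemma C4_free:
  assumes free: "free_of \<H> G" "cycle_graph 4 \<in> \<H>"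
    and e: "adjacent G a b" "adjacent G b c" "adjacent G c d" "adjacent G d a" "a \<noteq> c" "b \<noteq> d"
  shows "adjacent G a c \<or> adjacent G b d"
proof (rule ccontr)
  assume n: "\<not> ?thesis"
  show False
  proof (rule free_of_listD[OF free, of "[a, b, c, d]"])
    show "distinct [a, b, c, d]" using e adjacent_irrefl by auto
    show "\<forall>j<length [a, b, c, d]. \<forall>i<j.
        adjacent G ([a, b, c, d] ! i) ([a, b, c, d] ! j) \<longleftrightarrow> adjacent (cycle_graph 4) i j"
      using e n adjacent_sym[OF e(4)] by (simp add: all_less_simps adjacent_cycle_graph)
  qed (use e adjacent_verts in \<open>auto simp: cycle_graph_def doubleton_eq_iff mod_Suc split: if_splits\<close>)
qed

lemma bull_free:
  assumes free: "free_of \<H> G" "bull \<in> \<H>"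
    and e: "adjacent G x y" "adjacent G y z" "adjacent G x z" "adjacent G x p" "adjacent G y q"
      "\<not> adjacent G p y" "\<not> adjacent G p z" "\<not> adjacent G q x" "\<not> adjacent G q z"
  shows "adjacent G p q"
proof (rule ccontr)
  assume n: "\<not> ?thesis"
  have s: "\<not> adjacent G y p" "\<not> adjacent G z p" "\<not> adjacent G x q" "\<not> adjacent G z q"
    using e adjacent_sym by blast+
  show False
  proof (rule free_of_listD[OF free, of "[x, y, z, p, q]"])
    show "distinct [x, y, z, p, q]" using e s n adjacent_irrefl by auto
    show "\<forall>j<length [x, y, z, p, q]. \<forall>i<j.
        adjacent G ([x, y, z, p, q] ! i) ([x, y, z, p, q] ! j) \<longleftrightarrow> adjacent bull i j"
      using e n s by (simp add: all_less_simps bull_def doubleton_eq_iff)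
  qed (use e adjacent_verts in \<open>auto simp: bull_def doubleton_eq_iff\<close>)
qed

lemma P7_free_adjacent:
  assumes "free_of \<H> G" "path_graph 7 \<in> \<H>" shows "P7_free (adjacent G)"
  unfolding P7_free_def
proof (intro notI, elim exE conjE)
  fix a b c d e f g
  assume p: "adjacent G a b" "adjacent G b c" "adjacent G c d" "adjacent G d e" "adjacent G e f"
    "adjacent G f g"
    and n: "\<not> adjacent G a c" "\<not> adjacent G a d" "\<not> adjacent G a e" "\<not> adjacent G a f"
    "\<not> adjacent G a g" "\<not> adjacent G b d" "\<not> adjacent G b e" "\<not> adjacent G b f" "\<not> adjacent G b g"
    "\<not> adjacent G c e" "\<not> adjacent G c f" "\<not> adjacent G c g" "\<not> adjacent G d f" "\<not> adjacent G d g"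
    "\<not> adjacent G e g"
  let ?xs = "[a, b, c, d, e, f, g]"
  show False
  proof (rule free_of_listD[OF assms, of ?xs])
    show "distinct ?xs" using p n adjacent_irrefl p[THEN adjacent_sym] by auto
    show "\<forall>j<length ?xs. \<forall>i<j. adjacent G (?xs ! i) (?xs ! j) \<longleftrightarrow> adjacent (path_graph 7) i j"
      using p n by (simp add: all_less_simps adjacent_path_graph)
  qed (use p adjacent_verts in \<open>auto simp: path_graph_def doubleton_eq_iff\<close>)
qed

lemma fork_free_adjacent:
  assumes "free_of \<H> G" "fork_plus \<in> \<H>" shows "fork_free (adjacent G)"
  unfolding fork_free_def
proof (intro notI, elim exE conjE)
  fix x l l' p q r
  assume e: "adjacent G x l" "adjacent G x l'" "l \<noteq> l'" "adjacent G x p" "adjacent G p q" "adjacent G q r"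
    and n: "\<not> adjacent G x q" "\<not> adjacent G x r" "\<not> adjacent G p r" "\<not> adjacent G l l'"
    "\<not> adjacent G l p" "\<not> adjacent G l q" "\<not> adjacent G l r" "\<not> adjacent G l' p" "\<not> adjacent G l' q"
    "\<not> adjacent G l' r"
  let ?xs = "[x, l, l', p, q, r]"
  show False
  proof (rule free_of_listD[OF assms, of ?xs])
    show "distinct ?xs" using e n adjacent_irrefl adjacent_sym[OF e(1)] adjacent_sym[OF e(2)] by auto
    show "\<forall>j<length ?xs. \<forall>i<j. adjacent G (?xs ! i) (?xs ! j) \<longleftrightarrow> adjacent fork_plus i j"
      using e n by (simp add: all_less_simps fork_plus_def doubleton_eq_iff)
  qed (use e adjacent_verts in \<open>auto simp: fork_plus_def doubleton_eq_iff\<close>)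
qed

end

text \<open>
Choosing \<open>k\<close> vertices from each class along the hole gives an induced blowup of the cycle.
\<close>

lemma (in irreducible) thin_hole_if_blowup_free:
  assumes h: "hole E' (int n) c" and W: "W \<subseteq> verts G" and E: "\<And>u v. E u v \<longleftrightarrow> adjacent G u v"
    and free: "free_of \<H> G" "clique_blowup (cycle_graph n) k \<in> \<H>"
  shows "\<exists>i. weight (c i) < k"
proof (rule ccontr)
  assume "\<not> ?thesis"
  then have k: "k \<le> weight (c i)" for i by (meson not_le)
  have n5: "n \<ge> 5" using hole_len[OF h] by simp
  have "\<exists>g. g ` {..<k} \<subseteq> {x \<in> W. rep x = c (int i)} \<and> inj_on g {..<k}" for i :: nat
    using k[of "int i"] fin by (intro card_le_inj) (auto simp: weight_def)
  then obtain g :: "nat \<Rightarrow> nat \<Rightarrow> 'a" where g: "\<And>i. g i ` {..<k} \<subseteq> {x \<in> W. rep x = c (int i)}"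
    "\<And>i. inj_on (g i) {..<k}" by metis
  define f where "f = (\<lambda>(i, j). g i j)"
  have gW: "g i j \<in> W" "rep (g i j) = c (int i)" if "j < k" for i j using g(1)[of i] that by auto
  have ceq: "c (int i) = c (int j) \<longleftrightarrow> i = j" if "i < n" "j < n" for i j
    using that hole_eq[OF h, of "int i" "int j"] dvd_small[of "int i - int j" "int n"] by auto
  have cadj: "E' (c (int i)) (c (int j)) \<longleftrightarrow> adjacent (cycle_graph n) i j" if ij: "i < n" "j < n" for i j
  proof -
    have sm: "Suc a mod n = (if Suc a = n then 0 else Suc a)" if "a < n" for a
      using that by (simp add: mod_Suc)
    have d: "int n dvd int a - int b - 1 \<longleftrightarrow> a = Suc b mod n" if "a < n" "b < n" for a b
    proof (cases "Suc b = n")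
      case True
      then have "int a - int b - 1 = int a - int n" by simp
      then have "int n dvd int a - int b - 1 \<longleftrightarrow> int n dvd int a"
        by (metis dvd_minus_iff dvd_refl dvd_add_right_iff diff_add_cancel add.commute)
      then show ?thesis using True sm[OF that(2)] dvd_small[of "int a" "int n"] that by auto
    next
      case False
      then show ?thesis using sm[OF that(2)] dvd_small[of "int a - int b - 1" "int n"] that by auto
    qed
    have "int i - int j + 1 = - (int j - int i - 1)" by simp
    then have "int n dvd int i - int j + 1 \<longleftrightarrow> int n dvd int j - int i - 1"
      by (simp only: dvd_minus_iff)
    then show ?thesis unfolding hole_adj[OF h] adjacent_cycle_graph
      using d[OF ij] d[OF ij(2,1)] ij by auto
  qed
  show False
  proof (rule free_ofD[OF free, of f])
    have V: "verts (clique_blowup (cycle_graph n) k) = {..<n} \<times> {..<k}"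
      by (simp add: clique_blowup_def cycle_graph_def)
    show "inj_on f (verts (clique_blowup (cycle_graph n) k))"
    proof (rule inj_onI)
      fix x y assume xy: "x \<in> verts (clique_blowup (cycle_graph n) k)"
        "y \<in> verts (clique_blowup (cycle_graph n) k)" "f x = f y"
      obtain i j i' j' where ij: "x = (i, j)" "y = (i', j')" by fastforce
      have b: "i < n" "j < k" "i' < n" "j' < k" using xy(1,2) unfolding V ij by auto
      have eq: "g i j = g i' j'" using xy(3) by (simp add: f_def ij)
      then have "i = i'" using gW(2)[OF b(2), of i] gW(2)[OF b(4), of i'] ceq[OF b(1,3)] by simp
      then show "x = y" using eq g(2)[of i] b ij by (auto dest: inj_onD)
    qed
    show "f ` verts (clique_blowup (cycle_graph n) k) \<subseteq> verts G"
      using gW W unfolding V f_def by auto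
    show "adjacent G (f x) (f y) \<longleftrightarrow> adjacent (clique_blowup (cycle_graph n) k) x y"
      if xy: "x \<in> verts (clique_blowup (cycle_graph n) k)" "y \<in> verts (clique_blowup (cycle_graph n) k)"
      for x y
    proof -
      obtain i j i' j' where ij: "x = (i, j)" "y = (i', j')" by fastforce
      have b: "i < n" "j < k" "i' < n" "j' < k" using xy(1,2) unfolding V ij by auto
      have "adjacent (clique_blowup (cycle_graph n) k) x y \<longleftrightarrow>
          i = i' \<and> j \<noteq> j' \<or> adjacent (cycle_graph n) i i'"
        unfolding ij adjacent_clique_blowup using b by (simp add: cycle_graph_def)
      moreover have "E (g i j) (g i' j') \<longleftrightarrow> i = i' \<and> j \<noteq> j' \<or> adjacent (cycle_graph n) i i'"
      proof (cases "i = i'")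
        case True
        have "\<not> adjacent (cycle_graph n) i i" using cadj[OF b(1,1)] core.irrefl by blast
        moreover have "g i j = g i j' \<longleftrightarrow> j = j'" using g(2)[of i] b by (auto dest: inj_onD)
        ultimately show ?thesis
          using True twin_adjacent[of "g i j" "g i j'"] gW b irreflE by metis
      next
        case False
        then have "rep (g i j) \<noteq> rep (g i' j')" using gW b ceq by simp
        then show ?thesis using E'_rep[of "g i j" "g i' j'"] gW b cadj False by simp
      qed
      ultimately show ?thesis unfolding E[symmetric] by (simp add: f_def ij)
    qed
  qed
qed

lemma chromatic_number_bound:
  fixes G :: "'a ugraph"
  assumes G: "simple_graph G" and free: "free_of \<H> G" "cycle_graph 4 \<in> \<H>" "bull \<in> \<H>"
    and "strict_mono \<beta>"
    and irr: "\<And>W. W \<subseteq> verts G \<Longrightarrow> irreducible W (adjacent G) \<Longrightarrow>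
      colourable (adjacent G) W (\<beta> (omega (adjacent G) W))"
  shows "chromatic_number G \<le> \<beta> (clique_number G)"
proof -
  have "colourable (adjacent G) (verts G) (\<beta> (omega (adjacent G) (verts G)))"
  proof (rule colourable_by_reduction)
    show "finite (verts G)" using G by (simp add: simple_graph_def)
    show "symp (adjacent G)" using adjacent_sym[OF G] by (auto intro: sympI)
    show "irreflp (adjacent G)" using adjacent_irrefl[OF G] by (auto intro: irreflpI)
    fix W assume W: "W \<subseteq> verts G" "W \<noteq> {}" "atom (adjacent G) W" "\<not> peelable (adjacent G) W"
    have "irreducible W (adjacent G)"
    proof
      show "finite W" using W(1) G finite_subset by (auto simp: simple_graph_def)
      show "adjacent G v u" if "adjacent G u v" for u v by (rule adjacent_sym[OF G that])
      show "\<not> adjacent G u u" for u by (rule adjacent_irrefl[OF G])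
      show "adjacent G a c \<or> adjacent G b d"
        if "adjacent G a b" "adjacent G b c" "adjacent G c d" "adjacent G d a" "a \<noteq> c" "b \<noteq> d"
        for a b c d by (rule C4_free[OF G free(1,2) that])
      show "adjacent G p q"
        if "adjacent G x y" "adjacent G y z" "adjacent G x z" "adjacent G x p" "adjacent G y q"
          "\<not> adjacent G p y" "\<not> adjacent G p z" "\<not> adjacent G q x" "\<not> adjacent G q z"
        for x y z p q by (rule bull_free[OF G free(1,3) that])
    qed (use W in auto)
    then show "colourable (adjacent G) W (\<beta> (omega (adjacent G) W))" by (rule irr[OF W(1)])
  qed fact
  then show ?thesis using chromatic_number_le[OF G] clique_number_omega[OF G] by simp
qed

text \<open>
With \<open>n = 2 m\<close> the left-hand sides are \<open>2 m + \<lceil>m/2\<rceil>\<close>, \<open>2 m + \<lceil>m/3\<rceil>\<close> and \<open>2 m + \<lceil>m/4\<rceil>\<close>. In this form they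
are visibly strictly increasing in \<open>n\<close>.
\<close>

lemma ceiling_bounds:
  "int (n + (n + 3) div 4) \<le> \<lceil>5 / 4 * real n\<rceil>"
  "int (n + (n + 5) div 6) \<le> \<lceil>7 / 6 * real n\<rceil>"
  "int (n + (n + 7) div 8) \<le> \<lceil>9 / 8 * real n\<rceil>"
proof -
  have "real (4 * ((n + 3) div 4)) \<le> real (n + 3)" "real (6 * ((n + 5) div 6)) \<le> real (n + 5)"
    "real (8 * ((n + 7) div 8)) \<le> real (n + 7)"
    by (intro of_nat_mono; simp)+
  then show "int (n + (n + 3) div 4) \<le> \<lceil>5 / 4 * real n\<rceil>"
    "int (n + (n + 5) div 6) \<le> \<lceil>7 / 6 * real n\<rceil>"
    "int (n + (n + 7) div 8) \<le> \<lceil>9 / 8 * real n\<rceil>"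
    unfolding le_ceiling_iff by simp_all
qed

lemma strict_mono_bound: "strict_mono (\<lambda>n. n + (n + a) div (b::nat))"
  unfolding strict_mono_def by (auto intro!: add_less_le_mono div_le_mono)

lemma upper_bounds:
  fixes G :: "'a ugraph" and H :: "nat ugraph"
  assumes G: "simple_graph G" and free: "free_of {cycle_graph 4, H, bull} G"
    and H: "H = path_graph 7 \<or> H = fork_plus"
  shows "int (chromatic_number G) \<le> \<lceil>5 / 4 * real (clique_number G)\<rceil>"
    and "free_of {clique_blowup (cycle_graph 5) 2} G \<Longrightarrow>
      int (chromatic_number G) \<le> \<lceil>7 / 6 * real (clique_number G)\<rceil>"
    and "H = path_graph 7 \<Longrightarrow>
      free_of {clique_blowup (cycle_graph 5) 2, clique_blowup (cycle_graph 7) 4} G \<Longrightarrow>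
      chromatic_number G \<le> clique_number G + 1"
    and "H = fork_plus \<Longrightarrow>
      free_of {clique_blowup (cycle_graph 5) 2, clique_blowup (cycle_graph 7) 4} G \<Longrightarrow>
      int (chromatic_number G) \<le> \<lceil>9 / 8 * real (clique_number G)\<rceil>"
proof -
  let ?E = "adjacent G"
  have P7: "P7_free ?E" if "H = path_graph 7" using P7_free_adjacent[OF G free] that by simp
  have ff: "fork_free ?E" if "H = fork_plus" using fork_free_adjacent[OF G free] that by simp
  have thin5: "irreducible.thin_C5 W ?E"
    if W: "W \<subseteq> verts G" "irreducible W ?E" and f: "free_of \<H> G" "clique_blowup (cycle_graph 5) 2 \<in> \<H>"
    for W \<H>
  proof -
    interpret irreducible W ?E by fact
    show ?thesis
      unfolding thin_C5_def
    proof (intro allI impI)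
      fix c assume "hole E' 5 c"
      then have "hole E' (int 5) c" by simp
      then have "\<exists>i. weight (c i) < 2" by (rule thin_hole_if_blowup_free[OF _ W(1) refl f])
      then show "\<exists>i. weight (c i) \<le> 1" by (auto simp: less_Suc_eq_le numeral_eq_Suc)
    qed
  qed
  have thin7: "irreducible.thin_C7 W ?E"
    if W: "W \<subseteq> verts G" "irreducible W ?E" and f: "free_of \<H> G" "clique_blowup (cycle_graph 7) 4 \<in> \<H>"
    for W \<H>
  proof -
    interpret irreducible W ?E by fact
    show ?thesis
      unfolding thin_C7_def
    proof (intro allI impI)
      fix c assume "hole E' 7 c"
      then have "hole E' (int 7) c" by simp
      then have "\<exists>i. weight (c i) < 4" by (rule thin_hole_if_blowup_free[OF _ W(1) refl f])
      then show "\<exists>i. weight (c i) \<le> 3" by (auto simp: less_Suc_eq_le numeral_eq_Suc)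
    qed
  qed
  have main: "\<exists>m. omega ?E W = 2 * m \<and> colourable ?E W (2 * m + (m + 1) div 2) \<and>
      (irreducible.thin_C5 W ?E \<longrightarrow> colourable ?E W (2 * m + (m + 2) div 3))"
    if "irreducible W ?E" for W
    using H irreducible.P7_free_bounds[OF that P7] irreducible.fork_free_bounds[OF that ff] by blast
  show "int (chromatic_number G) \<le> \<lceil>5 / 4 * real (clique_number G)\<rceil>"
  proof -
    have "chromatic_number G \<le> clique_number G + (clique_number G + 3) div 4"
    proof (rule chromatic_number_bound[OF G free _ _ strict_mono_bound])
      fix W assume "W \<subseteq> verts G" "irreducible W ?E"
      then obtain m where m: "omega ?E W = 2 * m" "colourable ?E W (2 * m + (m + 1) div 2)"
        using main by blast
      have "(2 * m + 3) div 4 = (m + 1) div 2" by presburger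
      then show "colourable ?E W (omega ?E W + (omega ?E W + 3) div 4)" using m by simp
    qed auto
    then show ?thesis using ceiling_bounds(1)[of "clique_number G"] by linarith
  qed
  show "int (chromatic_number G) \<le> \<lceil>7 / 6 * real (clique_number G)\<rceil>"
    if f: "free_of {clique_blowup (cycle_graph 5) 2} G"
  proof -
    have "chromatic_number G \<le> clique_number G + (clique_number G + 5) div 6"
    proof (rule chromatic_number_bound[OF G free _ _ strict_mono_bound])
      fix W assume W: "W \<subseteq> verts G" "irreducible W ?E"
      have "irreducible.thin_C5 W ?E" by (rule thin5[OF W f]) simp
      then obtain m where m: "omega ?E W = 2 * m" "colourable ?E W (2 * m + (m + 2) div 3)"
        using main[OF W(2)] by blast
      have "(2 * m + 5) div 6 = (m + 2) div 3" by presburger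
      then show "colourable ?E W (omega ?E W + (omega ?E W + 5) div 6)" using m by simp
    qed auto
    then show ?thesis using ceiling_bounds(2)[of "clique_number G"] by linarith
  qed
  show "chromatic_number G \<le> clique_number G + 1"
    if f: "H = path_graph 7" "free_of {clique_blowup (cycle_graph 5) 2, clique_blowup (cycle_graph 7) 4} G"
  proof (rule chromatic_number_bound[OF G free])
    fix W assume W: "W \<subseteq> verts G" "irreducible W ?E"
    have "irreducible.thin_C5 W ?E" by (rule thin5[OF W f(2)]) simp
    moreover have "irreducible.thin_C7 W ?E" by (rule thin7[OF W f(2)]) simp
    ultimately show "colourable ?E W (omega ?E W + 1)"
      using irreducible.P7_free_bounds[OF W(2) P7[OF f(1)]] by auto
  qed (auto simp: strict_mono_def)
  show "int (chromatic_number G) \<le> \<lceil>9 / 8 * real (clique_number G)\<rceil>"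
    if f: "H = fork_plus" "free_of {clique_blowup (cycle_graph 5) 2, clique_blowup (cycle_graph 7) 4} G"
  proof -
    have "chromatic_number G \<le> clique_number G + (clique_number G + 7) div 8"
    proof (rule chromatic_number_bound[OF G free _ _ strict_mono_bound])
      fix W assume W: "W \<subseteq> verts G" "irreducible W ?E"
      have "irreducible.thin_C5 W ?E" by (rule thin5[OF W f(2)]) simp
      moreover have "irreducible.thin_C7 W ?E" by (rule thin7[OF W f(2)]) simp
      ultimately obtain m where m: "omega ?E W = 2 * m" "colourable ?E W (2 * m + (m + 3) div 4)"
        using irreducible.fork_free_bounds[OF W(2) ff[OF f(1)]] by auto
      have "(2 * m + 7) div 8 = (m + 3) div 4" by presburger
      then show "colourable ?E W (omega ?E W + (omega ?E W + 7) div 8)" using m by simp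
    qed auto
    then show ?thesis using ceiling_bounds(3)[of "clique_number G"] by linarith
  qed
qed

section \<open>The five-cycle attains the bounds\<close>

lemma free_ofI:
  assumes "\<And>H g. H \<in> \<H> \<Longrightarrow> inj_on g (verts H) \<Longrightarrow> g ` verts H \<subseteq> verts G \<Longrightarrow>
    (\<And>u v. u \<in> verts H \<Longrightarrow> v \<in> verts H \<Longrightarrow> adjacent G (g u) (g v) \<longleftrightarrow> adjacent H u v) \<Longrightarrow> False"
  shows "free_of \<H> G"
  unfolding free_of_def
proof (intro ballI notI, elim exE conjE)
  fix H W assume H: "H \<in> \<H>" "W \<subseteq> verts G" "isomorphic (induced_subgraph G W) H"
  then obtain f where f: "bij_betw f W (verts H)"
    "\<And>u v. u \<in> W \<Longrightarrow> v \<in> W \<Longrightarrow> adjacent G u v \<longleftrightarrow> adjacent H (f u) (f v)"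
    unfolding isomorphic_def by (auto simp: induced_subgraph_def)
  define g where "g = the_inv_into W f"
  have g: "bij_betw g (verts H) W" unfolding g_def by (rule bij_betw_the_inv_into[OF f(1)])
  have fg: "f (g u) = u" "g u \<in> W" if "u \<in> verts H" for u
    using f_the_inv_into_f_bij_betw[OF f(1)] that g unfolding g_def bij_betw_def by blast+
  show False
    by (rule assms[OF H(1), of g]) (use g H(2) f(2) fg in \<open>auto simp: bij_betw_def\<close>)
qed

lemma C5_adjacent:
  "adjacent (cycle_graph 5) i j \<longleftrightarrow>
     (i, j) \<in> {(0,1),(1,2),(2,3),(3,4),(4,0),(1,0),(2,1),(3,2),(4,3),(0,4)}"
proof -
  have "i < 5 \<and> j = Suc i mod 5 \<longleftrightarrow> (i, j) \<in> {(0,1),(1,2),(2,3),(3,4),(4,0)}" for i j :: nat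
  proof (cases "i < 5")
    case True
    then have "i = 0 \<or> i = 1 \<or> i = 2 \<or> i = 3 \<or> i = 4" by auto
    then show ?thesis by (elim disjE) auto
  qed auto
  then show ?thesis unfolding adjacent_cycle_graph by auto
qed

lemma C5_nbr:
  assumes "adjacent (cycle_graph 5) i j"
  shows "j = (i + 1) mod 5 \<or> j = (i + 4) mod 5"
    and "i = 0 \<or> i = 1 \<or> i = 2 \<or> i = 3 \<or> i = 4"
  using assms unfolding C5_adjacent by auto

lemma verts_C5: "verts (cycle_graph 5) = {0,1,2,3,4}"
  by (auto simp: cycle_graph_def)

lemma C5_free_of_large:
  assumes "\<And>H. H \<in> \<H> \<Longrightarrow> card (verts H) > 5" shows "free_of \<H> (cycle_graph 5)"
proof (rule free_ofI)
  fix H g assume H: "H \<in> \<H>" and g: "inj_on g (verts H)" "g ` verts H \<subseteq> verts (cycle_graph 5)"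
  have "card (verts H) \<le> 5" using card_inj_on_le[OF g] by (simp add: cycle_graph_def)
  then show False using assms[OF H] by simp
qed

lemma C5_free:
  assumes "\<And>H. H \<in> \<H> \<Longrightarrow> H = cycle_graph 4 \<or> H = bull \<or> card (verts H) > 5"
  shows "free_of \<H> (cycle_graph 5)"
proof (rule free_ofI)
  fix H g assume H: "H \<in> \<H>" and g: "inj_on g (verts H)" "g ` verts H \<subseteq> verts (cycle_graph 5)"
    "\<And>u v. u \<in> verts H \<Longrightarrow> v \<in> verts H \<Longrightarrow> adjacent (cycle_graph 5) (g u) (g v) \<longleftrightarrow> adjacent H u v"
  from assms[OF H] show False
  proof (elim disjE)
    assume H: "H = cycle_graph 4"
    then have V: "verts H = {0,1,2,3}" by (auto simp: cycle_graph_def)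
    have "g 0 \<noteq> g 2" "g 1 \<noteq> g 3" using g(1) unfolding V inj_on_def by auto
    moreover have e: "adjacent (cycle_graph 5) (g 0) (g 1)" "adjacent (cycle_graph 5) (g 2) (g 1)"
      "adjacent (cycle_graph 5) (g 2) (g 3)" "adjacent (cycle_graph 5) (g 0) (g 3)"
      using g(3) unfolding V unfolding H adjacent_cycle_graph by auto
    ultimately show False
      using C5_nbr[OF e(1)] C5_nbr[OF e(2)] C5_nbr(1)[OF e(3)] C5_nbr(1)[OF e(4)]
      by (elim disjE) simp_all
  next
    assume H: "H = bull"
    then have V: "verts H = {0,1,2,3,4}" by (auto simp: bull_def)
    have "g 1 \<noteq> g 2" "g 1 \<noteq> g 3" "g 2 \<noteq> g 3" using g(1) unfolding V inj_on_def by auto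
    moreover have e: "adjacent (cycle_graph 5) (g 0) (g 1)" "adjacent (cycle_graph 5) (g 0) (g 2)"
      "adjacent (cycle_graph 5) (g 0) (g 3)"
      using g(3) unfolding V unfolding H by (auto simp: bull_def)
    ultimately show False using C5_nbr(1)[OF e(1)] C5_nbr(1)[OF e(2)] C5_nbr(1)[OF e(3)] by auto
  next
    assume "card (verts H) > 5"
    moreover have "card (verts H) \<le> 5"
      using card_inj_on_le[OF g(1,2)] by (simp add: cycle_graph_def)
    ultimately show False by simp
  qed
qed

lemma simple_graph_C5: "simple_graph (cycle_graph 5)"
  by (auto simp: simple_graph_def cycle_graph_def card_insert_if mod_Suc)

lemma clique_number_C5: "clique_number (cycle_graph 5) = 2"
  unfolding clique_number_def
proof (rule Max_eqI)
  have "finite (verts (cycle_graph 5))" by (simp add: cycle_graph_def)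
  then show "finite {card K |K. clique (cycle_graph 5) K}"
    by (auto simp: clique_def intro: finite_subset[of _ "card ` Pow (verts (cycle_graph 5))"])
  have "clique (cycle_graph 5) {0, 1}" unfolding clique_def verts_C5 by (auto simp: C5_adjacent)
  then show "2 \<in> {card K |K. clique (cycle_graph 5) K}"
    by (intro CollectI exI[of _ "{0, 1}"]) simp
  fix y assume "y \<in> {card K |K. clique (cycle_graph 5) K}"
  then obtain K where K: "clique (cycle_graph 5) K" "y = card K" by blast
  show "y \<le> 2"
  proof (rule ccontr)
    assume "\<not> y \<le> 2"
    then have "3 \<le> card K" using K(2) by simp
    then obtain T where T: "T \<subseteq> K" "card T = 3" using obtain_subset_with_card_n by metis
    then obtain a b c where "a \<in> K" "b \<in> K" "c \<in> K" "a \<noteq> b" "b \<noteq> c" "a \<noteq> c"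
      unfolding card_3_iff by auto
    then have e: "adjacent (cycle_graph 5) a b" "adjacent (cycle_graph 5) b c"
      "adjacent (cycle_graph 5) a c"
      using K(1) by (auto simp: clique_def)
    show False using C5_nbr[OF e(1)] C5_nbr(1)[OF e(2)] C5_nbr(1)[OF e(3)] by (elim disjE) simp_all
  qed
qed

lemma chromatic_number_C5: "chromatic_number (cycle_graph 5) = 3"
  unfolding chromatic_number_def
proof (rule Least_equality)
  have "proper_colouring (cycle_graph 5) 3 (\<lambda>i. if i = 4 then 2 else i mod 2)"
    unfolding proper_colouring_def verts_C5 C5_adjacent by auto
  then show "\<exists>c. proper_colouring (cycle_graph 5) 3 c" by blast
  fix k assume "\<exists>c. proper_colouring (cycle_graph 5) k c"
  then obtain c where c: "proper_colouring (cycle_graph 5) k c" by blast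
  have "c 0 \<noteq> c 1" "c 1 \<noteq> c 2" "c 2 \<noteq> c 3" "c 3 \<noteq> c 4" "c 4 \<noteq> c 0"
    "c 0 < k" "c 1 < k" "c 2 < k" "c 3 < k" "c 4 < k"
    using c unfolding proper_colouring_def verts_C5 C5_adjacent by auto
  then show "3 \<le> k" by linarith
qed

theorem theorem1p5:
  fixes H :: "nat ugraph"
  assumes "H = path_graph 7 \<or> H = fork_plus"
  shows
    "(\<forall>G :: 'a ugraph. simple_graph G \<and> free_of {cycle_graph 4, H, bull} G \<longrightarrow>
        (int (chromatic_number G) \<le> \<lceil>5 / 4 * real (clique_number G)\<rceil> \<and>
         (free_of {clique_blowup (cycle_graph 5) 2} G \<longrightarrow>
            int (chromatic_number G) \<le> \<lceil>7 / 6 * real (clique_number G)\<rceil>)) \<and>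
        (H = path_graph 7 \<and>
         free_of {clique_blowup (cycle_graph 5) 2, clique_blowup (cycle_graph 7) 4} G \<longrightarrow>
            chromatic_number G \<le> clique_number G + 1) \<and>
        (H = fork_plus \<and>
         free_of {clique_blowup (cycle_graph 5) 2, clique_blowup (cycle_graph 7) 4} G \<longrightarrow>
            int (chromatic_number G) \<le> \<lceil>9 / 8 * real (clique_number G)\<rceil>)) \<and>
     (\<exists>G :: nat ugraph. simple_graph G \<and> verts G \<noteq> {} \<and>
        free_of {cycle_graph 4, H, bull} G \<and>
        int (chromatic_number G) = \<lceil>5 / 4 * real (clique_number G)\<rceil>) \<and>
     (\<exists>G :: nat ugraph. simple_graph G \<and> verts G \<noteq> {} \<and>
        free_of {cycle_graph 4, H, bull} G \<and>
        free_of {clique_blowup (cycle_graph 5) 2} G \<and>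
        int (chromatic_number G) = \<lceil>7 / 6 * real (clique_number G)\<rceil>) \<and>
     (H = fork_plus \<longrightarrow>
        (\<exists>G :: nat ugraph. simple_graph G \<and> verts G \<noteq> {} \<and>
           free_of {cycle_graph 4, H, bull} G \<and>
           free_of {clique_blowup (cycle_graph 5) 2, clique_blowup (cycle_graph 7) 4} G \<and>
           int (chromatic_number G) = \<lceil>9 / 8 * real (clique_number G)\<rceil>))"
proof -
  let ?C = "cycle_graph 5"
  have H: "card (verts H) > 5" using assms by (auto simp: path_graph_def fork_plus_def)
  have C: "simple_graph ?C" "verts ?C \<noteq> {}" "free_of {cycle_graph 4, H, bull} ?C"
    using simple_graph_C5 H by (auto simp: verts_C5 intro!: C5_free)
  have B: "free_of {clique_blowup (cycle_graph 5) 2} ?C"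
    "free_of {clique_blowup (cycle_graph 5) 2, clique_blowup (cycle_graph 7) 4} ?C"
    by (rule C5_free_of_large; auto simp: clique_blowup_def cycle_graph_def card_cartesian_product)+
  have val: "int (chromatic_number ?C) = \<lceil>5 / 4 * real (clique_number ?C)\<rceil>"
    "int (chromatic_number ?C) = \<lceil>7 / 6 * real (clique_number ?C)\<rceil>"
    "int (chromatic_number ?C) = \<lceil>9 / 8 * real (clique_number ?C)\<rceil>"
    unfolding chromatic_number_C5 clique_number_C5 by (simp_all add: ceiling_unique[symmetric] eq_commute[of "3::int"] ceiling_eq_iff)
  show ?thesis
    using upper_bounds[OF _ _ assms] C B val by blast
qed

end
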